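(* Let $H\in(1/2,1)$, and let $B^H=\{B^H(t)\}_{t\ge 0}$ be a continuous $\mathbb F$-adapted fractional Brownian motion with Hurst index $H$ on a standard stochastic basis $(\Omega,\mathcal F,\mathbb F=\{\mathcal F_t\}_{t\in[0,1]},\mathsf P)$. Let $\xi$ be an $\mathcal F_1$-measurable random variable for which there exist an $\mathbb F$-adapted process $\{Z(t)\}_{t\in[0,1]}$, a number $a>1$ and a finite random variable $C(\omega)$ such that $Z(1)=\xi$ and $$|Z(1)-Z(t)|\le C(\omega)\,|\log(1-t)|^{-a}\qquad\text{for all } t\in[0,1).$$ Then there exists an $\mathbb F$-adapted process $\psi=\{\psi(t)\}_{t\in[0,1]}$ such that $$\xi=\int_0^1\psi(s)\,\mathrm dB^H(s)\qquad\text{almost surely,}$$ with the integral defined in the extended fractional sense.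
   Context: A fractional Brownian motion with Hurst index $H$ is a centered Gaussian process $B^H$ with covariance $\mathsf E[B^H(t)B^H(s)]=\frac12(t^{2H}+s^{2H}-|t-s|^{2H})$. At $t=0$ the bound $|\log(1-t)|^{-a}$ is read as $+\infty$. Fractional Riemann–Liouville derivatives (in Weyl form). For $f,g:[a,b]\to\mathbb R$ and $\alpha\in(0,1)$, $$(D_{a+}^{\alpha}f)(x)=\frac1{\Gamma(1-\alpha)}\left(\frac{f(x)}{(x-a)^\alpha}+\alpha\int_a^x\frac{f(x)-f(u)}{(x-u)^{\alpha+1}}\,\mathrm du\right),$$ $$(D_{b-}^{1-\alpha}g)(x)=\frac{e^{i\pi(1-\alpha)}}{\Gamma(\alpha)}\left(\frac{g(x)}{(b-x)^{1-\alpha}}+(1-\alpha)\int_x^b\frac{g(x)-g(u)}{(u-x)^{2-\alpha}}\,\mathrm du\right),$$ and $g_{b-}(x)=g(x)-g(b)$. Extended fractional integral with respect to $B^H$. Fix $\alpha\in(1-H,1/2)$ and, for some $\mu>1/2$, define the weight $\rho(x)=(1-x)^{H+\alpha-1}|\log(1-x)|^{\mu}$. The admissible integrands are the functions $f:[0,1]\to\mathbb R$ with $D_{0+}^\alpha f\in L^1([0,1],\rho)$, that is, $\int_0^1|(D_{0+}^\alpha f)(x)|\rho(x)\,\mathrm dx<\infty$, and for such $f$ $$\int_0^1f(x)\,\mathrm dB^H(x)=e^{i\pi\alpha}\int_0^1(D_{0+}^\alpha f)(x)\,(D_{1-}^{1-\alpha}B^H_{1-})(x)\,\mathrm dx .$$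 For a process $\psi$ the integral is defined pathwise. *)

theory Defs
  imports "HOL-Probability.Probability"
begin

section \<open>Stochastic bases and adapted processes on the time interval [0,1]\<close>

text \<open>
  ``Standard'' means the usual conditions: the probability space is complete, the filtration is
  right-continuous, and all null sets belong to the initial sigma-algebra. Only the sigma-algebras
  \<open>F t\<close> with \<open>0 \<le> t \<le> 1\<close> are relevant; other values of \<open>F\<close> are unconstrained.
\<close>

definition standard_stochastic_basis :: "'w measure \<Rightarrow> (real \<Rightarrow> 'w measure) \<Rightarrow> bool" where
  "standard_stochastic_basis M F \<longleftrightarrow>
     prob_space M \<and> complete_measure M \<and>
     (\<forall>t\<in>{0..1}. subalgebra M (F t)) \<and>
     (\<forall>s\<in>{0..1}. \<forall>t\<in>{0..1}. s \<le> t \<longrightarrow> sets (F s) \<subseteq> sets (F t)) \<and>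
     null_sets M \<subseteq> sets (F 0) \<and>
     (\<forall>t\<in>{0..<1}. sets (F t) = (\<Inter>s\<in>{t<..1}. sets (F s)))"

definition adapted :: "(real \<Rightarrow> 'w measure) \<Rightarrow> (real \<Rightarrow> 'w \<Rightarrow> real) \<Rightarrow> bool" where
  "adapted F X \<longleftrightarrow> (\<forall>t\<in>{0..1}. X t \<in> borel_measurable (F t))"


section \<open>Fractional Brownian motion\<close>

text \<open>Normal distributions are allowed to be degenerate, i.e. concentrated in one point.\<close>

definition gaussian_rv :: "'w measure \<Rightarrow> ('w \<Rightarrow> real) \<Rightarrow> bool" where
  "gaussian_rv M X \<longleftrightarrow>
     X \<in> borel_measurable M \<and>
     (\<exists>m. (AE \<omega> in M. X \<omega> = m) \<or>
          (\<exists>\<sigma>>0. distributed M lborel X (\<lambda>x. ennreal (normal_density m \<sigma> x))))"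

definition gaussian_process :: "'w measure \<Rightarrow> (real \<Rightarrow> 'w \<Rightarrow> real) \<Rightarrow> bool" where
  "gaussian_process M X \<longleftrightarrow>
     (\<forall>I c. finite I \<and> I \<subseteq> {0..} \<longrightarrow> gaussian_rv M (\<lambda>\<omega>. \<Sum>t\<in>I. c t * X t \<omega>))"

definition fractional_brownian_motion ::
  "'w measure \<Rightarrow> real \<Rightarrow> (real \<Rightarrow> 'w \<Rightarrow> real) \<Rightarrow> bool" where
  "fractional_brownian_motion M H B \<longleftrightarrow>
     gaussian_process M B \<and>
     (\<forall>t\<ge>0. (LINT \<omega>|M. B t \<omega>) = 0) \<and>
     (\<forall>s\<ge>0. \<forall>t\<ge>0. (LINT \<omega>|M. B t \<omega> * B s \<omega>) =
        (t powr (2 * H) + s powr (2 * H) - \<bar>t - s\<bar> powr (2 * H)) / 2)"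

definition continuous_process :: "'w measure \<Rightarrow> (real \<Rightarrow> 'w \<Rightarrow> real) \<Rightarrow> bool" where
  "continuous_process M X \<longleftrightarrow> (AE \<omega> in M. continuous_on {0..} (\<lambda>t. X t \<omega>))"


section \<open>Fractional Riemann-Liouville derivatives in Weyl form\<close>

text \<open>
  Bochner integrals of non-integrable functions are 0, so the absolute convergence of the integral
  in each derivative is recorded by a separate predicate.
\<close>

definition weyl_left :: "real \<Rightarrow> real \<Rightarrow> (real \<Rightarrow> real) \<Rightarrow> real \<Rightarrow> real" where
  "weyl_left a \<alpha> f x = 1 / Gamma (1 - \<alpha>) *
     (f x / (x - a) powr \<alpha>
      + \<alpha> * (LINT u:{a<..<x}|lebesgue. (f x - f u) / (x - u) powr (\<alpha> + 1)))"

definition weyl_left_exists :: "real \<Rightarrow> real \<Rightarrow> (real \<Rightarrow> real) \<Rightarrow> real \<Rightarrow> bool" where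
  "weyl_left_exists a \<alpha> f x \<longleftrightarrow>
     set_integrable lebesgue {a<..<x} (\<lambda>u. (f x - f u) / (x - u) powr (\<alpha> + 1))"

text \<open>The right-sided derivative has order \<open>1 - \<alpha>\<close>, with \<open>\<alpha>\<close> the parameter given here.\<close>

definition weyl_right :: "real \<Rightarrow> real \<Rightarrow> (real \<Rightarrow> real) \<Rightarrow> real \<Rightarrow> complex" where
  "weyl_right b \<alpha> g x = exp (\<i> * of_real (pi * (1 - \<alpha>))) / of_real (Gamma \<alpha>) *
     of_real (g x / (b - x) powr (1 - \<alpha>)
      + (1 - \<alpha>) * (LINT u:{x<..<b}|lebesgue. (g x - g u) / (u - x) powr (2 - \<alpha>)))"

definition weyl_right_exists :: "real \<Rightarrow> real \<Rightarrow> (real \<Rightarrow> real) \<Rightarrow> real \<Rightarrow> bool" where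
  "weyl_right_exists b \<alpha> g x \<longleftrightarrow>
     set_integrable lebesgue {x<..<b} (\<lambda>u. (g x - g u) / (u - x) powr (2 - \<alpha>))"


section \<open>The extended fractional integral on [0,1]\<close>

definition frac_weight :: "real \<Rightarrow> real \<Rightarrow> real \<Rightarrow> real \<Rightarrow> real" where
  "frac_weight H \<alpha> \<mu> x = (1 - x) powr (H + \<alpha> - 1) * \<bar>ln (1 - x)\<bar> powr \<mu>"

definition admissible_integrand :: "real \<Rightarrow> real \<Rightarrow> real \<Rightarrow> (real \<Rightarrow> real) \<Rightarrow> bool" where
  "admissible_integrand H \<alpha> \<mu> f \<longleftrightarrow>
     (AE x in lebesgue. x \<in> {0<..<1} \<longrightarrow> weyl_left_exists 0 \<alpha> f x) \<and>
     set_integrable lebesgue {0..1} (\<lambda>x. weyl_left 0 \<alpha> f x * frac_weight H \<alpha> \<mu> x)"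

definition ext_frac_integrand ::
  "real \<Rightarrow> (real \<Rightarrow> real) \<Rightarrow> (real \<Rightarrow> real) \<Rightarrow> real \<Rightarrow> complex" where
  "ext_frac_integrand \<alpha> f g x =
     of_real (weyl_left 0 \<alpha> f x) * weyl_right 1 \<alpha> (\<lambda>y. g y - g 1) x"

definition ext_frac_integral :: "real \<Rightarrow> (real \<Rightarrow> real) \<Rightarrow> (real \<Rightarrow> real) \<Rightarrow> complex" where
  "ext_frac_integral \<alpha> f g =
     exp (\<i> * of_real (pi * \<alpha>)) * (LINT x:{0..1}|lebesgue. ext_frac_integrand \<alpha> f g x)"

text \<open>
  \<open>f\<close> is admissible and its integral against \<open>g\<close> is a genuine Lebesgue integral with value \<open>v\<close>.
  Convergence must be required explicitly: the weight vanishes at 0, so admissibility gives no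
  control of the integrand near 0.
\<close>

definition has_ext_frac_integral ::
  "real \<Rightarrow> real \<Rightarrow> real \<Rightarrow> (real \<Rightarrow> real) \<Rightarrow> (real \<Rightarrow> real) \<Rightarrow> real \<Rightarrow> bool" where
  "has_ext_frac_integral H \<alpha> \<mu> f g v \<longleftrightarrow>
     admissible_integrand H \<alpha> \<mu> f \<and>
     (AE x in lebesgue. x \<in> {0<..<1} \<longrightarrow> weyl_right_exists 1 \<alpha> (\<lambda>y. g y - g 1) x) \<and>
     set_integrable lebesgue {0..1} (ext_frac_integrand \<alpha> f g) \<and>
     of_real v = ext_frac_integral \<alpha> f g"


section \<open>Logarithmic rate of approximation at time 1\<close>

text \<open>
  At \<open>t = 0\<close> the bound is read as infinity, so only \<open>0 < t < 1\<close> is constrained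
  (whereas \<open>0 powr (- a) = 0\<close> here).
\<close>

definition log_approximated ::
  "'w measure \<Rightarrow> (real \<Rightarrow> 'w \<Rightarrow> real) \<Rightarrow> ('w \<Rightarrow> real) \<Rightarrow> real \<Rightarrow> ('w \<Rightarrow> real) \<Rightarrow> bool" where
  "log_approximated M Z C a \<xi> \<longleftrightarrow>
     (AE \<omega> in M. Z 1 \<omega> = \<xi> \<omega> \<and>
        (\<forall>t\<in>{0<..<1}. \<bar>Z 1 \<omega> - Z t \<omega>\<bar> \<le> C \<omega> * \<bar>ln (1 - t)\<bar> powr (- a)))"

end

theory Submission
  imports Defs
begin

text \<open>
  Let \<open>t\<^sub>n = 1 - exp (- 2^n)\<close>, so that \<open>Z (t\<^sub>n)\<close> differs from \<open>\<xi>\<close> by \<open>O(2^-n)\<close>. On the first half of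
  \<open>[t\<^sub>n, 1]\<close> the integrand tries to make up the whole current shortfall
  \<open>R\<^sub>n = Z (t\<^sub>n) - \<integral>\<psi> dB\<close> (integral up to \<open>t\<^sub>n\<close>) by a discretized multiple of \<open>2 \<integral>x dx\<close>, where \<open>x\<close>
  is the rescaled increment of \<open>B\<close>. On a deterministic grid of polynomially many points this sum equals
  \<open>x\<^sup>2\<close> minus the quadratic variation, which is small because \<open>2H > 1\<close>. The integrand is switched
  off at the first grid point where the gain is at least \<open>R\<^sub>n\<close>; by Borel-Cantelli the gain then exceeds
  \<open>R\<^sub>n\<close> by at most a quarter for all large \<open>n\<close>, so \<open>R\<^sub>n = O(2^-n)\<close> and the integrals converge to \<open>\<xi>\<close>.

  All jump times of \<open>\<psi>\<close> lie in a countable deterministic set. Hence no Hoelder continuity of the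
  paths is needed: the fractional integral of the indicator of \<open>(p, 1]\<close> is \<open>B (1) - B (p)\<close> as soon as
  certain singular integrals are finite, and their expectations are of order \<open>(1 - p)^H\<close>. With the
  weight exponent \<open>\<mu> = 3/4\<close> the blocks cost at most a polynomial in \<open>n\<close> times \<open>2^(-n/4)\<close>, which is summable.
\<close>

section \<open>Singular integrals\<close>

text \<open>The whole construction is a balance of prices. Switching on one unit at time
  \<open>p\<close> costs about \<open>(1 - p) powr H\<close>, up to a logarithmic factor, in the
  norm that controls convergence. A block can succeed only if its rescaled path gets large; giving
  the path the standard deviation (n+1)^2 at the end of the block makes the probability of failure
  summable. This takes a leverage of order (n+1)^2 times \<open>gap n powr (-H)\<close>, which the
  price of a jump just compensates. On m grid points the quadratic variation then has mean (n+1)^4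
  m^(1-2H); with m = (n+1)^p this is summable as soon as p (2H-1) is at least 6. Since each block
  bets only on the current shortfall, an overshoot is simply carried over to the next block: the
  recursion for the shortfall contracts by 1/4, faster than the rate 1/2 at which the targets
  settle. Quantities that might be infinite take values in \<open>ennreal\<close>, so that Tonelli
  gives their expectations before their finiteness is known.\<close>

lemma has_bochner_integral_FTC_Ioo:
  fixes f F :: "real \<Rightarrow> real"
  assumes f[measurable]: "f \<in> borel_measurable borel" and "a \<le> b"
    and cont: "continuous_on {a..b} F"
    and deriv: "\<And>x. a < x \<Longrightarrow> x < b \<Longrightarrow> (F has_real_derivative f x) (at x)"
    and nonneg: "\<And>x. a < x \<Longrightarrow> x < b \<Longrightarrow> 0 \<le> f x"
  shows "has_bochner_integral lborel (\<lambda>x. indicator {a<..<b} x * f x) (F b - F a)"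
proof -
  have "(f has_integral (F b - F a)) {a..b}"
    using deriv by (intro fundamental_theorem_of_calculus_interior \<open>a \<le> b\<close> cont)
      (auto simp: has_real_derivative_iff_has_vector_derivative)
  then have "(f has_integral (F b - F a)) {a<..<b}"
    by (simp add: has_integral_Icc_iff_Ioo)
  then have I: "((\<lambda>x. indicator {a<..<b} x * f x) has_integral (F b - F a)) UNIV"
    by (subst (asm) has_integral_restrict_UNIV [symmetric])
       (auto elim!: has_integral_eq[rotated] simp: indicator_def)
  have nn: "0 \<le> indicator {a<..<b} x * f x" for x
    using nonneg by (auto simp: indicator_def)
  \<comment> \<open>The fundamental theorem gives a gauge integral only; the sign of
    \<open>f\<close> upgrades it to a Lebesgue integral, even if \<open>f\<close> is unbounded at
    the ends.\<close>
  have "integral\<^sup>N lborel (\<lambda>x. indicator {a<..<b} x * f x) = F b - F a"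
    using nn I by (intro nn_integral_has_integral_lborel) auto
  moreover have "0 \<le> F b - F a"
    using has_integral_nonneg[OF I] nn by auto
  ultimately show ?thesis
    using nn by (intro has_bochner_integral_nn_integral) auto
qed

lemma DERIV_powr_shift:
  fixes p r x :: real
  assumes "p < x"
  shows "((\<lambda>x. (x - p) powr r) has_real_derivative r * (x - p) powr (r - 1)) (at x)"
  using DERIV_chain'[of "\<lambda>x. x - p" 1 x UNIV "\<lambda>z. z powr r" "r * (x - p) powr (r - 1)"]
    has_real_derivative_powr[of "x - p" r] assms
  by (auto intro!: derivative_eq_intros)

lemma has_bochner_integral_powr_left:
  fixes c p q :: real
  assumes "c < 1" "p \<le> q"
  shows "has_bochner_integral lborel (\<lambda>x. indicator {p<..<q} x * (x - p) powr (-c))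
           ((q - p) powr (1 - c) / (1 - c))"
proof -
  have "has_bochner_integral lborel (\<lambda>x. indicator {p<..<q} x * (x - p) powr (-c))
      ((q - p) powr (1 - c) / (1 - c) - (p - p) powr (1 - c) / (1 - c))"
  proof (intro has_bochner_integral_FTC_Ioo)
    \<comment> \<open>At the singular end the exponent is positive and
      \<open>0 powr (1 - c) = 0\<close>, so the antiderivative is continuous there.\<close>
    show "continuous_on {p..q} (\<lambda>x. (x - p) powr (1 - c) / (1 - c))"
      using assms by (intro continuous_intros continuous_on_powr') auto
    show "((\<lambda>x. (x - p) powr (1 - c) / (1 - c)) has_real_derivative (x - p) powr (-c)) (at x)"
      if "p < x" for x
      using DERIV_cdivide[OF DERIV_powr_shift[OF that, of "1 - c"], of "1 - c"] assms by simp
  qed (use assms in auto)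
  then show ?thesis by simp
qed

lemma has_bochner_integral_powr_tail:
  fixes \<alpha> x y :: real
  assumes "\<alpha> < 1" "x < y" "y \<le> 1"
  shows "has_bochner_integral lborel (\<lambda>u. indicator {y<..<1} u * (u - x) powr (\<alpha> - 2))
           (((y - x) powr (\<alpha> - 1) - (1 - x) powr (\<alpha> - 1)) / (1 - \<alpha>))"
proof -
  have "has_bochner_integral lborel (\<lambda>u. indicator {y<..<1} u * (u - x) powr (\<alpha> - 2))
      (- ((1 - x) powr (\<alpha> - 1) / (1 - \<alpha>)) - - ((y - x) powr (\<alpha> - 1) / (1 - \<alpha>)))"
  proof (intro has_bochner_integral_FTC_Ioo)
    show "continuous_on {y..1} (\<lambda>u. - ((u - x) powr (\<alpha> - 1) / (1 - \<alpha>)))"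
      using assms by (intro continuous_intros) auto
    fix u assume "y < u"
    then show "((\<lambda>u. - ((u - x) powr (\<alpha> - 1) / (1 - \<alpha>))) has_real_derivative (u - x) powr (\<alpha> - 2)) (at u)"
      using assms
      by (intro DERIV_cong[OF DERIV_minus[OF DERIV_cdivide[OF DERIV_powr_shift[of x u "\<alpha> - 1"], of "1 - \<alpha>"]]])
        (auto simp: divide_simps, auto simp: algebra_simps)
  qed (use assms in auto)
  then show ?thesis by (simp add: diff_divide_distrib)
qed

text \<open>The antiderivative of the integrand is \<open>((x - p) / (u - x)) powr (1 - \<alpha>)\<close> up to a constant.\<close>

lemma has_bochner_integral_powr_product:
  fixes \<alpha> p u \<kappa> :: real
  assumes "\<alpha> < 1" "p < u" "1 < \<kappa>"
  shows "has_bochner_integral lborel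
      (\<lambda>x. indicator {p<..<p + (u - p) / \<kappa>} x * ((x - p) powr (-\<alpha>) * (u - x) powr (\<alpha> - 2)))
      ((\<kappa> - 1) powr (\<alpha> - 1) / ((1 - \<alpha>) * (u - p)))"
proof -
  define q where "q = p + (u - p) / \<kappa>"
  define F where "F = (\<lambda>x. ((x - p) / (u - x)) powr (1 - \<alpha>) / ((1 - \<alpha>) * (u - p)))"
  have q: "p \<le> q" "q < u"
  proof -
    have "(u - p) / \<kappa> < (u - p) / 1"
      using assms by (intro divide_strict_left_mono) auto
    then show "p \<le> q" "q < u" using assms by (auto simp: q_def)
  qed
  have "has_bochner_integral lborel
      (\<lambda>x. indicator {p<..<q} x * ((x - p) powr (-\<alpha>) * (u - x) powr (\<alpha> - 2))) (F q - F p)"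
  proof (intro has_bochner_integral_FTC_Ioo)
    show "continuous_on {p..q} F"
      using assms q unfolding F_def by (intro continuous_intros continuous_on_powr') auto
  next
    fix x assume x: "p < x" "x < q"
    define v where "v = (x - p) / (u - x)"
    have ux: "u - x > 0" "x - p > 0" "u \<noteq> x" "u \<noteq> p" using x q assms by auto
    have v: "v > 0" using ux by (simp add: v_def)
    have "((\<lambda>x. (x - p) / (u - x)) has_real_derivative (u - p) / (u - x)\<^sup>2) (at x)"
      using ux by (auto intro!: derivative_eq_intros simp: power2_eq_square field_simps)
    from DERIV_chain'[OF this has_real_derivative_powr, of "1 - \<alpha>"] v
    have "((\<lambda>x. ((x - p) / (u - x)) powr (1 - \<alpha>)) has_real_derivative
        (1 - \<alpha>) * v powr (1 - \<alpha> - 1) * ((u - p) / (u - x)\<^sup>2)) (at x)"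
      by (simp only: v_def)
    from DERIV_cdivide[OF this, of "(1 - \<alpha>) * (u - p)"]
    have "(F has_real_derivative
        ((1 - \<alpha>) * v powr (1 - \<alpha> - 1) * ((u - p) / (u - x)\<^sup>2)) / ((1 - \<alpha>) * (u - p))) (at x)"
      by (simp only: F_def)
    moreover have "((1 - \<alpha>) * v powr (1 - \<alpha> - 1) * ((u - p) / (u - x)\<^sup>2)) / ((1 - \<alpha>) * (u - p))
       = v powr (-\<alpha>) / (u - x)\<^sup>2"
      using ux assms by simp
    moreover have "\<dots> = (x - p) powr (-\<alpha>) * (u - x) powr (\<alpha> - 2)"
      using ux by (simp add: v_def powr_divide powr_minus powr_diff field_simps)
    ultimately show "(F has_real_derivative (x - p) powr (-\<alpha>) * (u - x) powr (\<alpha> - 2)) (at x)"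
      by simp
  qed (use q in auto)
  moreover have "F p = 0" by (simp add: F_def)
  moreover have "F q = (\<kappa> - 1) powr (\<alpha> - 1) / ((1 - \<alpha>) * (u - p))"
  proof -
    have "(q - p) / (u - q) = 1 / (\<kappa> - 1)"
    proof -
      have "u - q = (q - p) * (\<kappa> - 1)" "q - p \<noteq> 0"
        using assms by (simp_all add: q_def field_simps)
      then show ?thesis by simp
    qed
    then have "((q - p) / (u - q)) powr (1 - \<alpha>) = (\<kappa> - 1) powr (\<alpha> - 1)"
      using assms by (simp add: powr_divide powr_minus_divide[symmetric])
    then show ?thesis by (simp add: F_def)
  qed
  ultimately show ?thesis by (simp add: q_def)
qed

text \<open>The exponents add up to -1, so the Jacobian of the affine map onto (0, 1) cancels and
  the value is independent of \<open>p\<close>. The product of Gammas is the one in the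
  normalizations of the left and the right derivative.\<close>

lemma has_bochner_integral_Beta_kernel:
  fixes \<alpha> p :: real
  assumes "0 < \<alpha>" "\<alpha> < 1" "p < 1"
  shows "has_bochner_integral lborel
      (\<lambda>x. indicator {p<..<1} x * ((x - p) powr (-\<alpha>) * (1 - x) powr (\<alpha> - 1))) (Gamma (1 - \<alpha>) * Gamma \<alpha>)"
proof -
  let ?f = "\<lambda>t::real. indicator {0<..<1} t * (t powr (-\<alpha>) * (1 - t) powr (\<alpha> - 1))"
  have "((\<lambda>t. t powr (-\<alpha>) * (1 - t) powr (\<alpha> - 1)) has_integral Beta (1-\<alpha>) \<alpha>) {0<..<1}"
    using has_integral_Beta_real[of "1-\<alpha>" \<alpha>] assms by (simp add: has_integral_Icc_iff_Ioo)
  then have I: "(?f has_integral Beta (1-\<alpha>) \<alpha>) UNIV"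
    by (subst (asm) has_integral_restrict_UNIV [symmetric])
       (auto elim!: has_integral_eq[rotated] simp: indicator_def)
  have nn: "0 \<le> ?f t" for t by (auto simp: indicator_def)
  have "integral\<^sup>N lborel ?f = Beta (1-\<alpha>) \<alpha>"
    using nn I by (intro nn_integral_has_integral_lborel) auto
  then have B: "has_bochner_integral lborel ?f (Beta (1-\<alpha>) \<alpha>)"
    using nn has_integral_nonneg[OF I] by (intro has_bochner_integral_nn_integral) auto
  have "has_bochner_integral lborel (\<lambda>x. ?f ((-p/(1-p)) + (1/(1-p)) * x)) (Beta (1-\<alpha>) \<alpha> /\<^sub>R \<bar>1/(1-p)\<bar>)"
    using assms lborel_has_bochner_integral_real_affine_iff[of "1/(1-p)" ?f "Beta (1-\<alpha>) \<alpha>" "-p/(1-p)"] B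
    by simp
  then have "has_bochner_integral lborel (\<lambda>x. (1/(1-p)) * ?f ((-p/(1-p)) + (1/(1-p)) * x))
      ((1/(1-p)) * (Beta (1-\<alpha>) \<alpha> /\<^sub>R \<bar>1/(1-p)\<bar>))"
    by (intro has_bochner_integral_mult_right)
  moreover have "(1/(1-p)) * (Beta (1-\<alpha>) \<alpha> /\<^sub>R \<bar>1/(1-p)\<bar>) = Gamma (1 - \<alpha>) * Gamma \<alpha>"
    using assms by (simp add: Beta_def)
  moreover have "(1/(1-p)) * ?f ((-p/(1-p)) + (1/(1-p)) * x) =
      indicator {p<..<1} x * ((x - p) powr (-\<alpha>) * (1 - x) powr (\<alpha> - 1))" for x
  proof -
    have e: "(-p/(1-p)) + (1/(1-p)) * x = (x - p) / (1 - p)" "1 - (x-p)/(1-p) = (1-x)/(1-p)"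
      using assms by (auto simp: divide_simps)
    show ?thesis
    proof (cases "p < x \<and> x < 1")
      case True
      have "(1 - p) powr (-\<alpha>) * (1 - p) powr (\<alpha> - 1) = 1 / (1 - p)"
        using assms powr_minus_divide[of "1 - p" 1] powr_add[of "1 - p" "-\<alpha>" "\<alpha> - 1"] by simp
      then show ?thesis using assms True unfolding e
        by (simp add: powr_divide)
    next
      case False
      then show ?thesis using assms unfolding e
        by (auto simp: indicator_def field_simps)
    qed
  qed
  ultimately show ?thesis by simp
qed

text \<open>For \<open>p < x < 1\<close> and \<alpha> below 1 this is the minimum of the Beta kernel
  and \<open>(\<kappa> - 1) powr (\<alpha> - 1) / (x - p)\<close>. The second branch belongs to
  those \<open>x\<close> for which no \<open>u < 1\<close> satisfies
  \<open>u - p > \<kappa> * (x - p)\<close>.\<close>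

definition mono_kernel :: "real \<Rightarrow> real \<Rightarrow> real \<Rightarrow> real \<Rightarrow> real" where
  "mono_kernel \<alpha> p \<kappa> x =
     (if x < p + (1 - p) / \<kappa> then (x - p) powr (-\<alpha>) * (1 - x) powr (\<alpha> - 1)
      else (\<kappa> - 1) powr (\<alpha> - 1) / (x - p))"

lemma mono_kernel_measurable [measurable]: "mono_kernel \<alpha> p \<kappa> \<in> borel_measurable borel"
  unfolding mono_kernel_def by measurable

lemma mono_kernel_nonneg: "p < x \<Longrightarrow> 0 \<le> mono_kernel \<alpha> p \<kappa> x"
  by (simp add: mono_kernel_def)

lemma less_dilation:
  fixes p x \<kappa> :: real
  assumes "p < x" "1 < \<kappa>"
  shows "x < p + \<kappa> * (x - p)"
  using mult_strict_right_mono[of 1 \<kappa> "x - p"] assms by (auto simp: algebra_simps)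

lemma threshold_iff:
  fixes p x \<kappa> :: real
  assumes "p < x" "1 < \<kappa>"
  shows "x < p + (1 - p) / \<kappa> \<longleftrightarrow> \<kappa> - 1 < (1 - x) / (x - p)"
  using assms by (auto simp: field_simps)

lemma powr_ratio:
  fixes \<alpha> p x :: real
  assumes "p < x" "x < 1"
  shows "(x - p) powr (-\<alpha>) * (1 - x) powr (\<alpha> - 1) = ((1 - x) / (x - p)) powr (\<alpha> - 1) / (x - p)"
proof -
  have "(x - p) powr (-\<alpha>) * (x - p) powr (\<alpha> - 1) = 1 / (x - p)"
    using assms powr_minus_divide[of "x - p" 1] powr_add[of "x - p" "-\<alpha>" "\<alpha> - 1"] by simp
  moreover have "((1 - x) / (x - p)) powr (\<alpha> - 1) * (x - p) powr (\<alpha> - 1) = (1 - x) powr (\<alpha> - 1)"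
    using assms by (simp add: powr_divide)
  ultimately have "(x - p) powr (-\<alpha>) * (1 - x) powr (\<alpha> - 1)
      = ((1 - x) / (x - p)) powr (\<alpha> - 1) * (1 / (x - p))"
    by (metis mult.left_commute)
  then show ?thesis by simp
qed

text \<open>Both branches are the power \<alpha> - 1 of a base, divided by \<open>x - p\<close>. The
  bases are \<open>(1 - x) / (x - p)\<close> and \<open>\<kappa> - 1\<close>, and the kernel uses
  the larger one. The first bound serves as majorant when \<kappa> tends to 1, the second gives
  integrability for fixed \<kappa>.\<close>

lemma mono_kernel_le:
  fixes \<alpha> p x \<kappa> :: real
  assumes "\<alpha> < 1" "p < x" "x < 1" "1 < \<kappa>"
  shows "mono_kernel \<alpha> p \<kappa> x \<le> (x - p) powr (-\<alpha>) * (1 - x) powr (\<alpha> - 1)"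
    and "mono_kernel \<alpha> p \<kappa> x \<le> (\<kappa> - 1) powr (\<alpha> - 1) / (x - p)"
  using assms
  by (auto simp: mono_kernel_def powr_ratio threshold_iff not_less intro!: divide_right_mono powr_mono2')

lemma mono_kernel_tendsto:
  fixes \<alpha> p x :: real
  assumes "p < x" "x < 1"
  shows "(\<lambda>n. mono_kernel \<alpha> p (1 + 1 / real (Suc n)) x) \<longlonglongrightarrow> (x - p) powr (-\<alpha>) * (1 - x) powr (\<alpha> - 1)"
proof -
  have "(\<lambda>n. 1 / real (Suc n)) \<longlonglongrightarrow> 0"
    using LIMSEQ_inverse_real_of_nat by (simp add: inverse_eq_divide)
  moreover have "0 < (1 - x) / (x - p)" using assms by simp
  ultimately have "\<forall>\<^sub>F n in sequentially. 1 / real (Suc n) < (1 - x) / (x - p)"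
    by (rule order_tendstoD)
  then have "\<forall>\<^sub>F n in sequentially. mono_kernel \<alpha> p (1 + 1 / real (Suc n)) x
      = (x - p) powr (-\<alpha>) * (1 - x) powr (\<alpha> - 1)"
  proof eventually_elim
    case (elim n)
    then have "x < p + (1 - p) / (1 + 1 / real (Suc n))"
      using assms by (subst threshold_iff) auto
    then show ?case by (simp add: mono_kernel_def)
  qed
  then show ?thesis by (simp add: tendsto_eventually)
qed

text \<open>
  The region \<open>u - p > \<kappa> (x - p)\<close> is scale invariant around \<open>p\<close>. Separating the two values of \<open>l\<close> on it
  produces multiples of \<open>1 / (x - p)\<close> that cancel except close to 1.
\<close>

lemma truncated_double_integral:
  fixes \<alpha> p \<kappa> :: real and l :: "real \<Rightarrow> real"
  assumes \<alpha>: "0 < \<alpha>" "\<alpha> < 1" and p: "p < 1" and \<kappa>: "1 < \<kappa>"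
    and l[measurable]: "l \<in> borel_measurable borel"
    and int: "integrable lborel (\<lambda>x. indicator {p<..<1} x * (l x / (x - p)))"
  shows "integral\<^sup>L (lborel \<Otimes>\<^sub>M lborel) (\<lambda>(x, u). indicator {p<..<1} x * indicator {p + \<kappa> * (x - p)<..<1} u *
             ((x - p) powr (-\<alpha>) * (u - x) powr (\<alpha> - 2) * (l x - l u)))
         = - (\<integral>x. indicator {p<..<1} x * (l x * mono_kernel \<alpha> p \<kappa> x) \<partial>lborel) / (1 - \<alpha>)"
proof -
  define E :: "real \<Rightarrow> real \<Rightarrow> real" where
    "E = (\<lambda>x u. indicator {p<..<1} x * indicator {p + \<kappa> * (x - p)<..<1} u * ((x - p) powr (-\<alpha>) * (u - x) powr (\<alpha> - 2)))"
  define c where "c = (\<kappa> - 1) powr (\<alpha> - 1)"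
  have E_nn: "0 \<le> E x u" for x u by (simp add: E_def)
  have E_meas[measurable]: "(\<lambda>(x, u). E x u) \<in> borel_measurable (borel \<Otimes>\<^sub>M borel)"
    unfolding E_def greaterThanLessThan_def greaterThan_def lessThan_def indicator_def by measurable
  \<comment> \<open>The bracket lies between 0 and \<open>c / (x - p)\<close>, so a multiple of the
    integrand in \<open>int\<close> dominates.\<close>
  have int_c: "integrable lborel (\<lambda>x. indicator {p<..<1} x * (l x * (c / (x - p) - mono_kernel \<alpha> p \<kappa> x) / (1 - \<alpha>)))"
  proof (rule Bochner_Integration.integrable_bound[OF integrable_mult_right[OF int, of "c / (1 - \<alpha>)"]])
    show "AE x in lborel. norm (indicator {p<..<1} x * (l x * (c / (x - p) - mono_kernel \<alpha> p \<kappa> x) / (1 - \<alpha>)))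
        \<le> norm (c / (1 - \<alpha>) * (indicator {p<..<1} x * (l x / (x - p))))"
    proof (intro AE_I2)
      fix x
      show "norm (indicator {p<..<1} x * (l x * (c / (x - p) - mono_kernel \<alpha> p \<kappa> x) / (1 - \<alpha>)))
        \<le> norm (c / (1 - \<alpha>) * (indicator {p<..<1} x * (l x / (x - p))))"
      proof (cases "p < x \<and> x < 1")
        case True
        have "\<bar>c / (x - p) - mono_kernel \<alpha> p \<kappa> x\<bar> \<le> c / (x - p)"
          using mono_kernel_le(2)[of \<alpha> p x \<kappa>] mono_kernel_nonneg[of p x \<alpha> \<kappa>] True \<alpha> \<kappa> by (auto simp: c_def)
        then have "\<bar>l x\<bar> * \<bar>c / (x - p) - mono_kernel \<alpha> p \<kappa> x\<bar> / (1 - \<alpha>) \<le> \<bar>l x\<bar> * (c / (x - p)) / (1 - \<alpha>)"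
          using \<alpha> by (intro divide_right_mono mult_left_mono) auto
        then show ?thesis using True \<alpha> by (simp add: abs_mult c_def mult_ac)
      qed auto
    qed
  qed (use l in measurable)
  have int_1: "integrable lborel (\<lambda>x. indicator {p<..<1} x * (l x * (c / (x - p)) / (1 - \<alpha>)))"
    using integrable_mult_right[OF int, of "c / (1 - \<alpha>)"] by (simp add: mult_ac)
  \<comment> \<open>The lower limit of the integral over \<open>u\<close> contributes the pole
    \<open>c / (x - p)\<close>, the upper limit 1 the Beta kernel. Where the range of
    \<open>u\<close> is empty the two terms coincide, thanks to the second branch of the
    kernel.\<close>
  have inner_u: "has_bochner_integral lborel (\<lambda>u. E x u) (indicator {p<..<1} x * ((c / (x - p) - mono_kernel \<alpha> p \<kappa> x) / (1 - \<alpha>)))" for x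
  proof (cases "p < x \<and> x < 1")
    case True
    let ?y = "p + \<kappa> * (x - p)"
    have y: "x < ?y" "?y - x = (\<kappa> - 1) * (x - p)"
      using True \<kappa> less_dilation[of p x \<kappa>] by (auto simp: algebra_simps)
    show ?thesis
    proof (cases "?y < 1")
      case y1: True
      have th: "x < p + (1 - p) / \<kappa>" using y1 \<kappa> by (simp add: field_simps)
      have "has_bochner_integral lborel (\<lambda>u. (x - p) powr (-\<alpha>) * (indicator {?y<..<1} u * (u - x) powr (\<alpha> - 2)))
         ((x - p) powr (-\<alpha>) * (((?y - x) powr (\<alpha> - 1) - (1 - x) powr (\<alpha> - 1)) / (1 - \<alpha>)))"
        using y y1 \<alpha> by (intro has_bochner_integral_mult_right has_bochner_integral_powr_tail) auto
      moreover have "(x - p) powr (-\<alpha>) * (((?y - x) powr (\<alpha> - 1) - (1 - x) powr (\<alpha> - 1)) / (1 - \<alpha>))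
         = (c / (x - p) - mono_kernel \<alpha> p \<kappa> x) / (1 - \<alpha>)"
      proof -
        have "(x - p) powr (-\<alpha>) * (x - p) powr (\<alpha> - 1) = 1 / (x - p)"
          using True powr_minus_divide[of "x - p" 1] powr_add[of "x - p" "-\<alpha>" "\<alpha> - 1"] by simp
        then have "(x - p) powr (-\<alpha>) * (?y - x) powr (\<alpha> - 1) = c / (x - p)"
          using True \<kappa> unfolding y c_def
          by (simp add: powr_mult mult.left_commute[of "(x - p) powr (-\<alpha>)"])
        then show ?thesis using th by (simp add: mono_kernel_def right_diff_distrib)
      qed
      moreover have "(\<lambda>u. (x - p) powr (-\<alpha>) * (indicator {?y<..<1} u * (u - x) powr (\<alpha> - 2))) = E x"
        using True by (auto simp: E_def fun_eq_iff)
      ultimately show ?thesis using True \<alpha> by simp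
    next
      case False
      then have th: "\<not> x < p + (1 - p) / \<kappa>" using \<kappa> by (simp add: field_simps)
      have "E x = (\<lambda>u. 0)" using False by (auto simp: E_def indicator_def fun_eq_iff)
      then show ?thesis using th by (auto simp: mono_kernel_def c_def)
    qed
  next
    case False
    then have "E x = (\<lambda>u. 0)" by (auto simp: E_def fun_eq_iff)
    then show ?thesis using False by auto
  qed
  \<comment> \<open>In this order \<open>x < 1\<close> follows from \<open>u < 1\<close>, so the
    full pole \<open>c / (u - p)\<close> appears, without a correction near 1.\<close>
  have inner_x: "has_bochner_integral lborel (\<lambda>x. E x u) (indicator {p<..<1} u * (c / (u - p) / (1 - \<alpha>)))" for u
  proof (cases "p < u \<and> u < 1")
    case True
    have "(\<lambda>x. E x u) = (\<lambda>x. indicator {p<..<p + (u - p) / \<kappa>} x * ((x - p) powr (-\<alpha>) * (u - x) powr (\<alpha> - 2)))"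
    proof
      fix x
      have "x < p + (u - p) / \<kappa> \<longleftrightarrow> p + \<kappa> * (x - p) < u"
        using \<kappa> by (simp add: field_simps)
      moreover have "x < 1" if "p < x" "p + \<kappa> * (x - p) < u"
        using less_dilation[of p x \<kappa>] \<kappa> that True by linarith
      ultimately show "E x u = indicator {p<..<p + (u - p) / \<kappa>} x * ((x - p) powr (-\<alpha>) * (u - x) powr (\<alpha> - 2))"
        using True by (auto simp: E_def indicator_def)
    qed
    then show ?thesis
      using has_bochner_integral_powr_product[of \<alpha> p u \<kappa>] True \<alpha> \<kappa> by (simp add: c_def mult_ac)
  next
    case False
    have "E x u = 0" for x
    proof (cases "p < x")
      case True
      then show ?thesis using False less_dilation[of p x \<kappa>] \<kappa> by (auto simp: E_def indicator_def)
    qed (auto simp: E_def)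
    then show ?thesis using False by auto
  qed
  have int_a: "integrable (lborel \<Otimes>\<^sub>M lborel) (\<lambda>(x, u). l x * E x u)"
  proof (rule lborel_pair.Fubini_integrable)
    have "(\<integral>u. norm (case (x, u) of (x, u) \<Rightarrow> l x * E x u) \<partial>lborel) =
        norm (indicator {p<..<1} x * (l x * (c / (x - p) - mono_kernel \<alpha> p \<kappa> x) / (1 - \<alpha>)))" for x
    proof -
      define G where "G = indicator {p<..<1} x * ((c / (x - p) - mono_kernel \<alpha> p \<kappa> x) / (1 - \<alpha>))"
      have G: "(\<integral>u. E x u \<partial>lborel) = G"
        unfolding G_def by (rule has_bochner_integral_integral_eq[OF inner_u])
      have "0 \<le> (\<integral>u. E x u \<partial>lborel)" using E_nn by simp
      then have "0 \<le> G" unfolding G .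
      moreover have "indicator {p<..<1} x * (l x * (c / (x - p) - mono_kernel \<alpha> p \<kappa> x) / (1 - \<alpha>)) = l x * G"
        by (simp add: G_def)
      moreover have "(\<integral>u. norm (case (x, u) of (x, u) \<Rightarrow> l x * E x u) \<partial>lborel) = \<bar>l x\<bar> * G"
        using E_nn by (simp add: abs_mult G)
      ultimately show ?thesis by (simp add: abs_mult)
    qed
    then show "integrable lborel (\<lambda>x. \<integral>u. norm (case (x, u) of (x, u) \<Rightarrow> l x * E x u) \<partial>lborel)"
      using integrable_norm[OF int_c] by simp
    show "AE x in lborel. integrable lborel (\<lambda>y. case (x, y) of (x, u) \<Rightarrow> l x * E x u)"
      using inner_u by (auto simp: has_bochner_integral_iff)
  qed measurable
  have int_b: "integrable (lborel \<Otimes>\<^sub>M lborel) (\<lambda>(x, u). l u * E x u)"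
  proof (subst lborel_pair.integrable_product_swap_iff[symmetric], simp, rule lborel_pair.Fubini_integrable)
    have "(\<integral>x. norm (case (u, x) of (u, x) \<Rightarrow> l u * E x u) \<partial>lborel) =
        norm (indicator {p<..<1} u * (l u * (c / (u - p)) / (1 - \<alpha>)))" for u
    proof -
      define G where "G = indicator {p<..<1} u * (c / (u - p) / (1 - \<alpha>))"
      have G: "(\<integral>x. E x u \<partial>lborel) = G"
        unfolding G_def by (rule has_bochner_integral_integral_eq[OF inner_x])
      have "0 \<le> (\<integral>x. E x u \<partial>lborel)" using E_nn by simp
      then have "0 \<le> G" unfolding G .
      moreover have "indicator {p<..<1} u * (l u * (c / (u - p)) / (1 - \<alpha>)) = l u * G"
        by (simp add: G_def)
      moreover have "(\<integral>x. norm (case (u, x) of (u, x) \<Rightarrow> l u * E x u) \<partial>lborel) = \<bar>l u\<bar> * G"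
        using E_nn by (simp add: abs_mult G)
      ultimately show ?thesis by (simp add: abs_mult)
    qed
    then show "integrable lborel (\<lambda>u. \<integral>x. norm (case (u, x) of (u, x) \<Rightarrow> l u * E x u) \<partial>lborel)"
      using integrable_norm[OF int_1] by simp
    show "AE u in lborel. integrable lborel (\<lambda>y. case (u, y) of (u, x) \<Rightarrow> l u * E x u)"
      using inner_x by (auto simp: has_bochner_integral_iff)
  qed measurable
  have "integral\<^sup>L (lborel \<Otimes>\<^sub>M lborel) (\<lambda>(x, u). l x * E x u - l u * E x u)
      = integral\<^sup>L (lborel \<Otimes>\<^sub>M lborel) (\<lambda>(x, u). l x * E x u) - integral\<^sup>L (lborel \<Otimes>\<^sub>M lborel) (\<lambda>(x, u). l u * E x u)"
    using Bochner_Integration.integral_diff[OF int_a int_b] by (simp add: split_beta')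
  also have "integral\<^sup>L (lborel \<Otimes>\<^sub>M lborel) (\<lambda>(x, u). l x * E x u) = (\<integral>x. \<integral>u. l x * E x u \<partial>lborel \<partial>lborel)"
    using lborel_pair.integral_fst'[OF int_a] by simp
  also have "\<dots> = (\<integral>x. indicator {p<..<1} x * (l x * (c / (x - p) - mono_kernel \<alpha> p \<kappa> x) / (1 - \<alpha>)) \<partial>lborel)"
    using has_bochner_integral_integral_eq[OF inner_u] by (simp add: mult_ac)
  also have "integral\<^sup>L (lborel \<Otimes>\<^sub>M lborel) (\<lambda>(x, u). l u * E x u) = (\<integral>u. \<integral>x. l u * E x u \<partial>lborel \<partial>lborel)"
    using lborel_pair.integral_snd[OF int_b] by simp
  also have "\<dots> = (\<integral>x. indicator {p<..<1} x * (l x * (c / (x - p)) / (1 - \<alpha>)) \<partial>lborel)"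
    using has_bochner_integral_integral_eq[OF inner_x] by (simp add: mult_ac)
  also have "(\<integral>x. indicator {p<..<1} x * (l x * (c / (x - p) - mono_kernel \<alpha> p \<kappa> x) / (1 - \<alpha>)) \<partial>lborel) - \<dots>
     = (\<integral>x. indicator {p<..<1} x * (l x * (c / (x - p) - mono_kernel \<alpha> p \<kappa> x) / (1 - \<alpha>))
          - indicator {p<..<1} x * (l x * (c / (x - p)) / (1 - \<alpha>)) \<partial>lborel)"
    by (rule Bochner_Integration.integral_diff[OF int_c int_1, symmetric])
  \<comment> \<open>Both poles carry the same function \<open>l\<close> and the same constant. They
    have to cancel before \<kappa> tends to 1, since \<open>c\<close> blows up in that
    limit.\<close>
  also have "\<dots> = (\<integral>x. - (1 / (1 - \<alpha>)) * (indicator {p<..<1} x * (l x * mono_kernel \<alpha> p \<kappa> x)) \<partial>lborel)"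
    by (intro Bochner_Integration.integral_cong) (simp_all add: right_diff_distrib diff_divide_distrib)
  also have "\<dots> = - (\<integral>x. indicator {p<..<1} x * (l x * mono_kernel \<alpha> p \<kappa> x) \<partial>lborel) / (1 - \<alpha>)"
    by (subst integral_mult_right_zero) (simp add: field_simps)
  finally have "integral\<^sup>L (lborel \<Otimes>\<^sub>M lborel) (\<lambda>(x, u). l x * E x u - l u * E x u)
      = - (\<integral>x. indicator {p<..<1} x * (l x * mono_kernel \<alpha> p \<kappa> x) \<partial>lborel) / (1 - \<alpha>)" .
  moreover have "indicator {p<..<1} x * indicator {p + \<kappa> * (x - p)<..<1} u *
      ((x - p) powr (-\<alpha>) * (u - x) powr (\<alpha> - 2) * (l x - l u)) = l x * E x u - l u * E x u" for x u
    unfolding E_def by (simp add: left_diff_distrib right_diff_distrib mult_ac)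
  ultimately show ?thesis by (simp only:)
qed

section \<open>Inversion of the right-sided derivative\<close>

definition right_core :: "real \<Rightarrow> (real \<Rightarrow> real) \<Rightarrow> real \<Rightarrow> real" where
  "right_core \<alpha> g x = (g x - g 1) / (1 - x) powr (1 - \<alpha>)
     + (1 - \<alpha>) * (LINT u:{x<..<1}|lebesgue. (g x - g u) / (u - x) powr (2 - \<alpha>))"

text \<open>A majorant of \<open>right_core\<close> that is meaningful without any integrability: it
  can be averaged over the paths first, and its finiteness is read off afterwards.\<close>

definition right_abs :: "real \<Rightarrow> (real \<Rightarrow> real) \<Rightarrow> real \<Rightarrow> ennreal" where
  "right_abs \<alpha> g x = ennreal (\<bar>g x - g 1\<bar> * (1 - x) powr (\<alpha> - 1))
     + (\<integral>\<^sup>+u. ennreal (indicator {x<..<1} u * (\<bar>g x - g u\<bar> * (u - x) powr (\<alpha> - 2))) \<partial>lborel)"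

text \<open>The right-sided fractional integral of \<open>w\<close> of order 1 - \<alpha> at
  \<open>p\<close>, without its Gamma factor. Up to that factor the kernel is also the left
  derivative of order \<alpha> of the indicator of (p, 1], so this functional prices a jump at
  \<open>p\<close>.\<close>

definition potential :: "real \<Rightarrow> (real \<Rightarrow> ennreal) \<Rightarrow> real \<Rightarrow> ennreal" where
  "potential \<alpha> w p = (\<integral>\<^sup>+x. ennreal (indicator {p<..<1} x * (x - p) powr (-\<alpha>)) * w x \<partial>lborel)"

definition quotient_mass :: "(real \<Rightarrow> real) \<Rightarrow> real \<Rightarrow> ennreal" where
  "quotient_mass g p = (\<integral>\<^sup>+x. ennreal (indicator {p<..<1} x * (\<bar>g x - g p\<bar> / (x - p))) \<partial>lborel)"

lemma weyl_right_eq: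
  "weyl_right 1 \<alpha> (\<lambda>y. g y - g 1) x
     = exp (\<i> * of_real (pi * (1 - \<alpha>))) / of_real (Gamma \<alpha>) * of_real (right_core \<alpha> g x)"
  by (simp add: weyl_right_def right_core_def)

lemma right_core_lborel:
  assumes [measurable]: "g \<in> borel_measurable borel"
  shows "right_core \<alpha> g x = (g x - g 1) * (1 - x) powr (\<alpha> - 1)
     + (1 - \<alpha>) * (\<integral>u. indicator {x<..<1} u * ((u - x) powr (\<alpha> - 2) * (g x - g u)) \<partial>lborel)"
proof -
  have "(LINT u:{x<..<1}|lebesgue. (g x - g u) / (u - x) powr (2 - \<alpha>))
      = (\<integral>u. indicator {x<..<1} u *\<^sub>R ((g x - g u) / (u - x) powr (2 - \<alpha>)) \<partial>lborel)"
    unfolding set_lebesgue_integral_def by (rule integral_completion) measurable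
  also have "\<dots> = (\<integral>u. indicator {x<..<1} u * ((u - x) powr (\<alpha> - 2) * (g x - g u)) \<partial>lborel)"
    using powr_minus_divide[of _ "2 - \<alpha>"] by (intro Bochner_Integration.integral_cong) (auto simp: mult_ac)
  finally show ?thesis
    using powr_minus_divide[of "1 - x" "1 - \<alpha>"] by (simp add: right_core_def)
qed

lemma right_core_measurable [measurable]:
  assumes [measurable]: "g \<in> borel_measurable borel"
  shows "right_core \<alpha> g \<in> borel_measurable borel"
proof -
  have [measurable]: "(\<lambda>(x, u). indicator {x<..<1::real} u * ((u - x) powr (\<alpha> - 2) * (g x - g u)))
      \<in> borel_measurable (borel \<Otimes>\<^sub>M lborel)"
    unfolding greaterThanLessThan_def greaterThan_def lessThan_def indicator_def by measurable
  have "right_core \<alpha> g = (\<lambda>x. (g x - g 1) * (1 - x) powr (\<alpha> - 1)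
     + (1 - \<alpha>) * (\<integral>u. indicator {x<..<1} u * ((u - x) powr (\<alpha> - 2) * (g x - g u)) \<partial>lborel))"
    by (intro ext right_core_lborel assms)
  then show ?thesis by simp
qed

lemma right_abs_measurable [measurable]:
  assumes [measurable]: "g \<in> borel_measurable borel"
  shows "right_abs \<alpha> g \<in> borel_measurable borel"
proof -
  have [measurable]: "(\<lambda>(x, u). ennreal (indicator {x<..<1::real} u * (\<bar>g x - g u\<bar> * (u - x) powr (\<alpha> - 2))))
      \<in> borel_measurable (borel \<Otimes>\<^sub>M lborel)"
    unfolding greaterThanLessThan_def greaterThan_def lessThan_def indicator_def by measurable
  show ?thesis unfolding right_abs_def by measurable
qed

lemma right_core_le_right_abs:
  assumes [measurable]: "g \<in> borel_measurable borel" and \<alpha>: "0 < \<alpha>" "\<alpha> < 1"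
  shows "ennreal \<bar>right_core \<alpha> g x\<bar> \<le> right_abs \<alpha> g x"
proof -
  let ?f = "\<lambda>u. indicator {x<..<1} u * ((u - x) powr (\<alpha> - 2) * (g x - g u))"
  let ?N = "\<integral>\<^sup>+u. ennreal (indicator {x<..<1} u * (\<bar>g x - g u\<bar> * (u - x) powr (\<alpha> - 2))) \<partial>lborel"
  have norm: "norm (?f u) = indicator {x<..<1} u * (\<bar>g x - g u\<bar> * (u - x) powr (\<alpha> - 2))" for u
    by (simp add: abs_mult mult_ac)
  \<comment> \<open>A divergent Bochner integral is 0, so the bound holds in that case as
    well.\<close>
  have I: "ennreal \<bar>integral\<^sup>L lborel ?f\<bar> \<le> ?N"
  proof (cases "integrable lborel ?f")
    case True
    from integral_norm_bound_ennreal[OF this] show ?thesis unfolding norm by simp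
  qed (simp add: not_integrable_integral_eq)
  have "\<bar>right_core \<alpha> g x\<bar> \<le> \<bar>g x - g 1\<bar> * (1 - x) powr (\<alpha> - 1) + \<bar>integral\<^sup>L lborel ?f\<bar>"
  proof -
    have "\<bar>(1 - \<alpha>) * integral\<^sup>L lborel ?f\<bar> \<le> 1 * \<bar>integral\<^sup>L lborel ?f\<bar>"
      using \<alpha> by (subst abs_mult, intro mult_right_mono) auto
    moreover have "\<bar>(g x - g 1) * (1 - x) powr (\<alpha> - 1)\<bar> = \<bar>g x - g 1\<bar> * (1 - x) powr (\<alpha> - 1)"
      by (simp add: abs_mult)
    ultimately show ?thesis
      unfolding right_core_lborel[OF assms(1)] by linarith
  qed
  then have "ennreal \<bar>right_core \<alpha> g x\<bar> \<le> ennreal (\<bar>g x - g 1\<bar> * (1 - x) powr (\<alpha> - 1) + \<bar>integral\<^sup>L lborel ?f\<bar>)"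
    by (rule ennreal_leI)
  also have "\<dots> = ennreal (\<bar>g x - g 1\<bar> * (1 - x) powr (\<alpha> - 1)) + ennreal \<bar>integral\<^sup>L lborel ?f\<bar>"
    by (rule ennreal_plus) auto
  finally show ?thesis
    unfolding right_abs_def using I by (meson add_left_mono order_trans)
qed

lemma right_abs_finite_imp_exists:
  assumes [measurable]: "g \<in> borel_measurable borel" and "right_abs \<alpha> g x < \<infinity>"
  shows "weyl_right_exists 1 \<alpha> (\<lambda>y. g y - g 1) x"
proof -
  have eq: "norm (indicator {x<..<1} u *\<^sub>R ((g x - g u) / (u - x) powr (2 - \<alpha>)))
      = indicator {x<..<1} u * (\<bar>g x - g u\<bar> * (u - x) powr (\<alpha> - 2))" for u
    using powr_minus_divide[of "u - x" "2 - \<alpha>"] by (simp add: abs_mult)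
  have "integrable lborel (\<lambda>u. indicator {x<..<1} u *\<^sub>R ((g x - g u) / (u - x) powr (2 - \<alpha>)))"
    using assms(2) unfolding right_abs_def integrable_iff_bounded eq
    by (auto simp: less_top[symmetric])
  then show ?thesis
    by (simp add: weyl_right_exists_def set_integrable_def integrable_completion)
qed

text \<open>
  The integrability of the difference quotients at \<open>p\<close> replaces the Hoelder continuity of \<open>g\<close> that is
  usually assumed for this inversion formula.
\<close>

lemma right_core_inversion:
  assumes \<alpha>: "0 < \<alpha>" "\<alpha> < 1" and p: "p < 1"
    and g[measurable]: "g \<in> borel_measurable borel"
    and pot: "potential \<alpha> (right_abs \<alpha> g) p < \<infinity>"
    and quot: "quotient_mass g p < \<infinity>"
  shows "has_bochner_integral lborel (\<lambda>x. indicator {p<..<1} x * ((x - p) powr (-\<alpha>) * right_core \<alpha> g x))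
           (Gamma (1 - \<alpha>) * Gamma \<alpha> * (g p - g 1))"
proof -
  define k where "k = (\<lambda>x. indicator {p<..<1} x * ((x - p) powr (-\<alpha>) * (1 - x) powr (\<alpha> - 1)))"
  define l where "l = (\<lambda>x. g x - g p)"
  define F where "F = (\<lambda>x u. indicator {p<..<1} x * indicator {x<..<1::real} u * ((x - p) powr (-\<alpha>) * (u - x) powr (\<alpha> - 2) * (l x - l u)))"
  define \<kappa> where "\<kappa> = (\<lambda>n. 1 + 1 / real (Suc n))"
  define T where "T = (\<lambda>n x u. indicator {p<..<1} x * indicator {p + \<kappa> n * (x - p)<..<1} u * ((x - p) powr (-\<alpha>) * (u - x) powr (\<alpha> - 2) * (l x - l u)))"
  have k: "has_bochner_integral lborel k (Gamma (1 - \<alpha>) * Gamma \<alpha>)"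
    unfolding k_def using \<alpha> p by (intro has_bochner_integral_Beta_kernel)
  have k_nn: "0 \<le> k x" for x by (simp add: k_def)
  have l_meas[measurable]: "l \<in> borel_measurable borel" by (simp add: l_def)
  have F_meas[measurable]: "(\<lambda>(x, u). F x u) \<in> borel_measurable (borel \<Otimes>\<^sub>M borel)"
    unfolding F_def greaterThanLessThan_def greaterThan_def lessThan_def indicator_def by measurable
  have T_meas[measurable]: "(\<lambda>(x, u). T n x u) \<in> borel_measurable (borel \<Otimes>\<^sub>M borel)" for n
    unfolding T_def greaterThanLessThan_def greaterThan_def lessThan_def indicator_def by measurable
  have \<kappa>: "1 < \<kappa> n" for n by (simp add: \<kappa>_def)

  \<comment> \<open>The potential of \<open>right_abs\<close> has two parts: its integral term
    controls the double integral here, its boundary term at 1 gives \<open>int1\<close>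
    below.\<close>
  have intF: "integrable (lborel \<Otimes>\<^sub>M lborel) (\<lambda>(x, u). F x u)"
  proof (rule integrableI_bounded)
    have "(\<integral>\<^sup>+z. norm (case z of (x, u) \<Rightarrow> F x u) \<partial>(lborel \<Otimes>\<^sub>M lborel)) = (\<integral>\<^sup>+x. \<integral>\<^sup>+u. norm (F x u) \<partial>lborel \<partial>lborel)"
      using lborel.nn_integral_fst[of "\<lambda>(x,u). ennreal (norm (F x u))" lborel, symmetric]
      by (simp add: split_beta')
    also have "\<dots> \<le> potential \<alpha> (right_abs \<alpha> g) p"
      unfolding potential_def
    proof (intro nn_integral_mono)
      fix x
      have "(\<integral>\<^sup>+u. norm (F x u) \<partial>lborel) = (\<integral>\<^sup>+u. ennreal (indicator {p<..<1} x * (x - p) powr (-\<alpha>)) *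
           ennreal (indicator {x<..<1} u * (\<bar>g x - g u\<bar> * (u - x) powr (\<alpha> - 2))) \<partial>lborel)"
        by (intro nn_integral_cong) (auto simp: F_def l_def abs_mult ennreal_mult[symmetric] mult_ac indicator_def)
      also have "\<dots> = ennreal (indicator {p<..<1} x * (x - p) powr (-\<alpha>)) *
          (\<integral>\<^sup>+u. ennreal (indicator {x<..<1} u * (\<bar>g x - g u\<bar> * (u - x) powr (\<alpha> - 2))) \<partial>lborel)"
        by (rule nn_integral_cmult) measurable
      also have "\<dots> \<le> ennreal (indicator {p<..<1} x * (x - p) powr (-\<alpha>)) * right_abs \<alpha> g x"
        unfolding right_abs_def by (intro mult_left_mono) auto
      finally show "(\<integral>\<^sup>+u. norm (F x u) \<partial>lborel) \<le> ennreal (indicator {p<..<1} x * (x - p) powr (-\<alpha>)) * right_abs \<alpha> g x" .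
    qed
    finally show "(\<integral>\<^sup>+z. norm (case z of (x, u) \<Rightarrow> F x u) \<partial>(lborel \<Otimes>\<^sub>M lborel)) < \<infinity>"
      using pot by (rule le_less_trans)
  qed measurable

  have int1: "integrable lborel (\<lambda>x. k x * (g x - g 1))"
  proof (rule integrableI_bounded)
    have "(\<integral>\<^sup>+x. norm (k x * (g x - g 1)) \<partial>lborel) \<le> potential \<alpha> (right_abs \<alpha> g) p"
      unfolding potential_def
    proof (intro nn_integral_mono)
      fix x
      have "ennreal (norm (k x * (g x - g 1))) = ennreal (indicator {p<..<1} x * (x - p) powr (-\<alpha>)) * ennreal (\<bar>g x - g 1\<bar> * (1 - x) powr (\<alpha> - 1))"
        by (auto simp: k_def abs_mult ennreal_mult[symmetric] mult_ac indicator_def)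
      also have "\<dots> \<le> ennreal (indicator {p<..<1} x * (x - p) powr (-\<alpha>)) * right_abs \<alpha> g x"
        unfolding right_abs_def by (intro mult_left_mono) auto
      finally show "ennreal (norm (k x * (g x - g 1))) \<le> \<dots>" .
    qed
    then show "(\<integral>\<^sup>+x. norm (k x * (g x - g 1)) \<partial>lborel) < \<infinity>"
      using pot by (rule le_less_trans)
  qed (simp add: k_def)
  have int2: "integrable lborel (\<lambda>x. k x * (g 1 - g p))"
    using k by (intro integrable_mult_left) (auto simp: has_bochner_integral_iff)
  have int3: "integrable lborel (\<lambda>x. k x * l x)"
    using Bochner_Integration.integrable_add[OF int1 int2] by (simp add: l_def algebra_simps)
  have int_q: "integrable lborel (\<lambda>x. indicator {p<..<1} x * (l x / (x - p)))"
  proof (rule integrableI_bounded)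
    have "(\<integral>\<^sup>+x. norm (indicator {p<..<1} x * (l x / (x - p))) \<partial>lborel) = quotient_mass g p"
      unfolding quotient_mass_def by (intro nn_integral_cong) (auto simp: l_def indicator_def abs_mult)
    then show "(\<integral>\<^sup>+x. norm (indicator {p<..<1} x * (l x / (x - p))) \<partial>lborel) < \<infinity>"
      using quot by simp
  qed simp

  \<comment> \<open>By \<open>less_dilation\<close> every truncated region lies in the full one, so
    \<open>F\<close> itself dominates. A pair with \<open>p < x < u\<close> belongs to the truncated
    regions from some \<open>n\<close> on.\<close>
  have "(\<lambda>n. integral\<^sup>L (lborel \<Otimes>\<^sub>M lborel) (\<lambda>(x, u). T n x u)) \<longlonglongrightarrow> integral\<^sup>L (lborel \<Otimes>\<^sub>M lborel) (\<lambda>(x, u). F x u)"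
  proof (rule integral_dominated_convergence[where w = "\<lambda>z. norm (case z of (x, u) \<Rightarrow> F x u)"])
    show "integrable (lborel \<Otimes>\<^sub>M lborel) (\<lambda>z. norm (case z of (x, u) \<Rightarrow> F x u))"
      using intF by (rule integrable_norm)
    show "AE z in lborel \<Otimes>\<^sub>M lborel. norm (case z of (x, u) \<Rightarrow> T n x u) \<le> norm (case z of (x, u) \<Rightarrow> F x u)" for n
    proof (intro AE_I2, clarsimp)
      fix x u
      show "\<bar>T n x u\<bar> \<le> \<bar>F x u\<bar>"
      proof (cases "p < x \<and> p + \<kappa> n * (x - p) < u")
        case True
        then have "x < u" using less_dilation[of p x "\<kappa> n"] \<kappa>[of n] by linarith
        then show ?thesis by (auto simp: T_def F_def indicator_def)
      qed (auto simp: T_def)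
    qed
    show "AE z in lborel \<Otimes>\<^sub>M lborel. (\<lambda>n. case z of (x, u) \<Rightarrow> T n x u) \<longlonglongrightarrow> (case z of (x, u) \<Rightarrow> F x u)"
    proof (intro AE_I2, clarsimp)
      fix x u
      show "(\<lambda>n. T n x u) \<longlonglongrightarrow> F x u"
      proof (cases "p < x \<and> x < u")
        case True
        have "(\<lambda>n. 1 / real (Suc n)) \<longlonglongrightarrow> 0"
          using LIMSEQ_inverse_real_of_nat by (simp add: inverse_eq_divide)
        then have "\<kappa> \<longlonglongrightarrow> 1 + 0"
          unfolding \<kappa>_def by (intro tendsto_add tendsto_const)
        then have "(\<lambda>n. p + \<kappa> n * (x - p)) \<longlonglongrightarrow> p + (1 + 0) * (x - p)"
          by (intro tendsto_intros) auto
        then have "\<forall>\<^sub>F n in sequentially. p + \<kappa> n * (x - p) < u"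
          using True by (intro order_tendstoD) auto
        then have "\<forall>\<^sub>F n in sequentially. T n x u = F x u"
          by eventually_elim (use True in \<open>auto simp: T_def F_def indicator_def\<close>)
        then show ?thesis by (rule tendsto_eventually)
      next
        case False
        have "T n x u = F x u" for n
        proof (cases "p < x")
          case px: True
          have "x < p + \<kappa> n * (x - p)" using less_dilation[of p x "\<kappa> n"] \<kappa>[of n] px by simp
          then show ?thesis using False px by (auto simp: T_def F_def indicator_def)
        qed (auto simp: T_def F_def)
        then show ?thesis by simp
      qed
    qed
  qed measurable
  moreover have "integral\<^sup>L (lborel \<Otimes>\<^sub>M lborel) (\<lambda>(x, u). T n x u)
      = - (\<integral>x. indicator {p<..<1} x * (l x * mono_kernel \<alpha> p (\<kappa> n) x) \<partial>lborel) / (1 - \<alpha>)" for n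
    unfolding T_def by (rule truncated_double_integral[OF \<alpha> p \<kappa> l_meas int_q])
  moreover have "(\<lambda>n. - (\<integral>x. indicator {p<..<1} x * (l x * mono_kernel \<alpha> p (\<kappa> n) x) \<partial>lborel) / (1 - \<alpha>))
      \<longlonglongrightarrow> - (\<integral>x. k x * l x \<partial>lborel) / (1 - \<alpha>)"
  proof (intro tendsto_intros integral_dominated_convergence[where w = "\<lambda>x. norm (k x * l x)"] integrable_norm int3)
    show "AE x in lborel. norm (indicator {p<..<1} x * (l x * mono_kernel \<alpha> p (\<kappa> n) x)) \<le> norm (k x * l x)" for n
    proof (intro AE_I2)
      fix x
      show "norm (indicator {p<..<1} x * (l x * mono_kernel \<alpha> p (\<kappa> n) x)) \<le> norm (k x * l x)"
      proof (cases "p < x \<and> x < 1")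
        case True
        have "\<bar>mono_kernel \<alpha> p (\<kappa> n) x\<bar> \<le> k x"
          using True mono_kernel_nonneg[of p x \<alpha> "\<kappa> n"] mono_kernel_le(1)[of \<alpha> p x "\<kappa> n"] \<alpha> \<kappa>[of n] by (simp add: k_def)
        then have "\<bar>l x\<bar> * \<bar>mono_kernel \<alpha> p (\<kappa> n) x\<bar> \<le> \<bar>l x\<bar> * k x" by (intro mult_left_mono) auto
        then show ?thesis using True k_nn[of x] by (simp add: abs_mult mult_ac)
      qed auto
    qed
    show "AE x in lborel. (\<lambda>n. indicator {p<..<1} x * (l x * mono_kernel \<alpha> p (\<kappa> n) x)) \<longlonglongrightarrow> k x * l x"
    proof (intro AE_I2)
      fix x
      show "(\<lambda>n. indicator {p<..<1} x * (l x * mono_kernel \<alpha> p (\<kappa> n) x)) \<longlonglongrightarrow> k x * l x"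
      proof (cases "p < x \<and> x < 1")
        case True
        have "(\<lambda>n. l x * mono_kernel \<alpha> p (\<kappa> n) x) \<longlonglongrightarrow> l x * ((x - p) powr (-\<alpha>) * (1 - x) powr (\<alpha> - 1))"
          unfolding \<kappa>_def using True by (intro tendsto_mult tendsto_const mono_kernel_tendsto) auto
        then show ?thesis using True by (simp add: k_def mult_ac)
      qed (auto simp: k_def)
    qed
  qed (use \<alpha> in \<open>auto simp: k_def\<close>)
  ultimately have F_eq: "integral\<^sup>L (lborel \<Otimes>\<^sub>M lborel) (\<lambda>(x, u). F x u) = - (\<integral>x. k x * l x \<partial>lborel) / (1 - \<alpha>)"
    using LIMSEQ_unique by fastforce

  have core: "indicator {p<..<1} x * ((x - p) powr (-\<alpha>) * right_core \<alpha> g x)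
      = k x * (g x - g 1) + (1 - \<alpha>) * (\<integral>u. F x u \<partial>lborel)" for x
  proof -
    have "(\<integral>u. F x u \<partial>lborel) = (\<integral>u. (indicator {p<..<1} x * (x - p) powr (-\<alpha>)) *
        (indicator {x<..<1} u * ((u - x) powr (\<alpha> - 2) * (g x - g u))) \<partial>lborel)"
      by (intro Bochner_Integration.integral_cong) (auto simp: F_def l_def)
    also have "\<dots> = (indicator {p<..<1} x * (x - p) powr (-\<alpha>)) *
        (\<integral>u. indicator {x<..<1} u * ((u - x) powr (\<alpha> - 2) * (g x - g u)) \<partial>lborel)"
      by (rule integral_mult_right_zero)
    finally show ?thesis
      unfolding right_core_lborel[OF g] k_def by (simp add: algebra_simps)
  qed
  have "has_bochner_integral lborel (\<lambda>x. k x * (g x - g 1) + (1 - \<alpha>) * (\<integral>u. F x u \<partial>lborel))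
     ((\<integral>x. k x * (g x - g 1) \<partial>lborel) + (1 - \<alpha>) * integral\<^sup>L (lborel \<Otimes>\<^sub>M lborel) (\<lambda>(x, u). F x u))"
    using int1 lborel_pair.integrable_fst'[OF intF] lborel_pair.integral_fst'[OF intF]
    by (intro has_bochner_integral_add has_bochner_integral_mult_right) (auto simp: has_bochner_integral_iff)
  \<comment> \<open>Subtracting \<open>l x = g x - g p\<close> from \<open>g x - g 1\<close> removes
    the path; the constant \<open>g p - g 1\<close> is left under the Beta kernel.\<close>
  moreover have "(\<integral>x. k x * (g x - g 1) \<partial>lborel) + (1 - \<alpha>) * integral\<^sup>L (lborel \<Otimes>\<^sub>M lborel) (\<lambda>(x, u). F x u)
      = (\<integral>x. k x * (g x - g 1) - k x * l x \<partial>lborel)"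
    using \<alpha> by (simp add: F_eq Bochner_Integration.integral_diff[OF int1 int3])
  moreover have "\<dots> = (\<integral>x. k x * (g p - g 1) \<partial>lborel)"
    by (simp add: l_def algebra_simps)
  moreover have "\<dots> = Gamma (1 - \<alpha>) * Gamma \<alpha> * (g p - g 1)"
    using k by (simp add: has_bochner_integral_iff)
  ultimately show ?thesis by (auto simp: core)
qed

section \<open>Integrals of step functions\<close>

lemma weyl_left_exists_cong:
  assumes "\<And>u. 0 < u \<Longrightarrow> u \<le> x \<Longrightarrow> f u = g u" "0 < x"
  shows "weyl_left_exists 0 \<alpha> f x \<longleftrightarrow> weyl_left_exists 0 \<alpha> g x"
  unfolding weyl_left_exists_def by (rule set_integrable_cong) (use assms in auto)

lemma weyl_left_cong:
  assumes "\<And>u. 0 < u \<Longrightarrow> u \<le> x \<Longrightarrow> f u = g u" "0 < x"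
  shows "weyl_left 0 \<alpha> f x = weyl_left 0 \<alpha> g x"
proof -
  have "(LINT u:{0<..<x}|lebesgue. (f x - f u) / (x - u) powr (\<alpha> + 1))
      = (LINT u:{0<..<x}|lebesgue. (g x - g u) / (x - u) powr (\<alpha> + 1))"
    unfolding set_lebesgue_integral_def
    by (rule Bochner_Integration.integral_cong) (use assms in \<open>auto simp: indicator_def\<close>)
  then show ?thesis using assms by (simp add: weyl_left_def)
qed

lemma weyl_left_add:
  assumes "weyl_left_exists 0 \<alpha> f x" "weyl_left_exists 0 \<alpha> g x"
  shows "weyl_left_exists 0 \<alpha> (\<lambda>t. f t + g t) x"
    and "weyl_left 0 \<alpha> (\<lambda>t. f t + g t) x = weyl_left 0 \<alpha> f x + weyl_left 0 \<alpha> g x"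
proof -
  have eq: "(f x + g x - (f u + g u)) / (x - u) powr (\<alpha> + 1)
      = (f x - f u) / (x - u) powr (\<alpha> + 1) + (g x - g u) / (x - u) powr (\<alpha> + 1)" for u
    by (simp add: add_divide_distrib[symmetric])
  show "weyl_left_exists 0 \<alpha> (\<lambda>t. f t + g t) x"
    using assms unfolding weyl_left_exists_def eq by (rule set_integral_add)
  show "weyl_left 0 \<alpha> (\<lambda>t. f t + g t) x = weyl_left 0 \<alpha> f x + weyl_left 0 \<alpha> g x"
    using set_integral_add(2)[OF assms[unfolded weyl_left_exists_def]]
    unfolding weyl_left_def eq by (simp add: algebra_simps add_divide_distrib)
qed

lemma weyl_left_cmult:
  assumes "weyl_left_exists 0 \<alpha> f x"
  shows "weyl_left_exists 0 \<alpha> (\<lambda>t. c * f t) x"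
    and "weyl_left 0 \<alpha> (\<lambda>t. c * f t) x = c * weyl_left 0 \<alpha> f x"
proof -
  have eq: "(c * f x - c * f u) / (x - u) powr (\<alpha> + 1) = c * ((f x - f u) / (x - u) powr (\<alpha> + 1))" for u
    by (simp add: algebra_simps diff_divide_distrib)
  show "weyl_left_exists 0 \<alpha> (\<lambda>t. c * f t) x"
    using assms unfolding weyl_left_exists_def eq by (intro set_integrable_mult_right) auto
  show "weyl_left 0 \<alpha> (\<lambda>t. c * f t) x = c * weyl_left 0 \<alpha> f x"
  proof -
    have "(LINT u:{0<..<x}|lebesgue. (c * f x - c * f u) / (x - u) powr (\<alpha> + 1))
        = c * (LINT u:{0<..<x}|lebesgue. (f x - f u) / (x - u) powr (\<alpha> + 1))"
      unfolding eq by (rule set_integral_mult_right)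
    then show ?thesis unfolding weyl_left_def by (simp only:) (simp add: algebra_simps)
  qed
qed

lemma weyl_left_zero: "weyl_left_exists 0 \<alpha> (\<lambda>_. 0) x" "weyl_left 0 \<alpha> (\<lambda>_. 0) x = 0"
  by (auto simp: weyl_left_exists_def weyl_left_def set_integrable_def)

lemma weyl_left_sum:
  assumes "finite I" "\<And>i. i \<in> I \<Longrightarrow> weyl_left_exists 0 \<alpha> (f i) x"
  shows "weyl_left_exists 0 \<alpha> (\<lambda>t. \<Sum>i\<in>I. f i t) x \<and>
    weyl_left 0 \<alpha> (\<lambda>t. \<Sum>i\<in>I. f i t) x = (\<Sum>i\<in>I. weyl_left 0 \<alpha> (f i) x)"
  using assms
proof (induction I rule: finite_induct)
  case empty
  then show ?case using weyl_left_zero by simp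
next
  case (insert i I)
  then show ?case
    using weyl_left_add[of \<alpha> "f i" x "\<lambda>t. \<Sum>i\<in>I. f i t"] by simp
qed

text \<open>Both terms vanish by convention: the quotient has the denominator
  \<open>0 powr \<alpha> = 0\<close>, and the integral runs over an empty interval.\<close>

lemma weyl_left_at_0: "weyl_left 0 \<alpha> f 0 = 0"
  by (simp add: weyl_left_def set_lebesgue_integral_def)

lemma weyl_right_at_1: "weyl_right 1 \<alpha> g 1 = 0"
  by (simp add: weyl_right_def set_lebesgue_integral_def)

text \<open>To the right of \<open>p\<close> the integral over (0, p) contributes
  \<open>(x - p) powr (-\<alpha>) - x powr (-\<alpha>)\<close>, and its second term cancels the
  boundary term of the derivative.\<close>

lemma weyl_left_heaviside:
  assumes \<alpha>: "0 < \<alpha>" "\<alpha> < 1" and p: "0 < p" and x: "0 \<le> x"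
  shows "weyl_left_exists 0 \<alpha> (indicator {p<..}) x"
    and "weyl_left 0 \<alpha> (indicator {p<..}) x = indicator {p<..} x * (x - p) powr (-\<alpha>) / Gamma (1 - \<alpha>)"
proof -
  let ?h = "indicator {p<..} :: real \<Rightarrow> real"
  define J where "J = (if p < x then ((x - p) powr (-\<alpha>) - x powr (-\<alpha>)) / \<alpha> else 0)"
  have *: "has_bochner_integral lborel (\<lambda>u. indicator {0<..<x} u *\<^sub>R ((?h x - ?h u) / (x - u) powr (\<alpha> + 1))) J"
  proof (cases "p < x")
    case True
    have d: "((\<lambda>u. (x - u) powr (-\<alpha>) / \<alpha>) has_real_derivative (x - u) powr (-(\<alpha> + 1))) (at u)" if "u < p" for u
    proof -
      have 1: "((\<lambda>u. x - u) has_real_derivative -1) (at u)"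
        by (auto intro!: derivative_eq_intros)
      have "0 < x - u" using True that by simp
      from DERIV_cdivide[OF DERIV_chain'[OF 1 has_real_derivative_powr[OF this, of "-\<alpha>"]], of \<alpha>]
      show ?thesis by (rule DERIV_cong) (use \<alpha> in simp)
    qed
    have "has_bochner_integral lborel (\<lambda>u. indicator {0<..<p} u * (x - u) powr (-(\<alpha> + 1)))
         ((x - p) powr (-\<alpha>) / \<alpha> - (x - 0) powr (-\<alpha>) / \<alpha>)"
      using True p d \<alpha>
      by (intro has_bochner_integral_FTC_Ioo[where F = "\<lambda>u. (x - u) powr (-\<alpha>) / \<alpha>"])
         (auto intro!: continuous_intros)
    then have "has_bochner_integral lborel (\<lambda>u. indicator {0<..<p} u * (x - u) powr (-(\<alpha> + 1))) J"
      using True by (simp add: J_def diff_divide_distrib)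
    \<comment> \<open>The two functions differ at \<open>u = p\<close>, where the indicator of
      \<open>{p<..}\<close> is still 0.\<close>
    moreover have "AE u in lborel. indicator {0<..<p} u * (x - u) powr (-(\<alpha> + 1))
        = indicator {0<..<x} u *\<^sub>R ((?h x - ?h u) / (x - u) powr (\<alpha> + 1))"
      using AE_lborel_singleton[of p]
    proof eventually_elim
      case (elim u)
      then show ?case using True p powr_minus_divide[of "x - u" "\<alpha> + 1"] by (auto simp: indicator_def)
    qed
    ultimately show ?thesis
      by (subst (asm) has_bochner_integral_cong_AE) auto
  next
    case False
    then have "(\<lambda>u. indicator {0<..<x} u *\<^sub>R ((?h x - ?h u) / (x - u) powr (\<alpha> + 1))) = (\<lambda>u. 0)"
      by (auto simp: indicator_def fun_eq_iff)
    then show ?thesis using False by (auto simp: J_def)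
  qed
  have L: "(LINT u:{0<..<x}|lebesgue. (?h x - ?h u) / (x - u) powr (\<alpha> + 1)) = J"
    unfolding set_lebesgue_integral_def
    using has_bochner_integral_integral_eq[OF *] by (subst integral_completion) auto
  show "weyl_left_exists 0 \<alpha> ?h x"
    using * unfolding weyl_left_exists_def set_integrable_def
    by (subst integrable_completion) (auto simp: has_bochner_integral_iff)
  show "weyl_left 0 \<alpha> ?h x = indicator {p<..} x * (x - p) powr (-\<alpha>) / Gamma (1 - \<alpha>)"
    using \<alpha> p powr_minus_divide[of x \<alpha>] unfolding weyl_left_def L
    by (auto simp: J_def indicator_def divide_simps left_diff_distrib)
qed

definition ext_norm :: "real \<Rightarrow> real \<Rightarrow> real \<Rightarrow> (real \<Rightarrow> real) \<Rightarrow> (real \<Rightarrow> real) \<Rightarrow> real" where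
  "ext_norm H \<alpha> \<mu> g f = (LINT x:{0..1}|lebesgue.
     \<bar>weyl_left 0 \<alpha> f x * frac_weight H \<alpha> \<mu> x\<bar> + norm (ext_frac_integrand \<alpha> f g x))"

text \<open>Existence of the left derivative is required at every inner point, so that sums can be
  differentiated without exceptional sets. The condition on the right derivative does not involve
  \<open>f\<close>; it is added once, at the end.\<close>

definition ext_bounded :: "real \<Rightarrow> real \<Rightarrow> real \<Rightarrow> (real \<Rightarrow> real) \<Rightarrow> (real \<Rightarrow> real) \<Rightarrow> real \<Rightarrow> real \<Rightarrow> bool" where
  "ext_bounded H \<alpha> \<mu> g f v K \<longleftrightarrow>
     (\<forall>x\<in>{0<..<1}. weyl_left_exists 0 \<alpha> f x) \<and>
     set_integrable lebesgue {0..1} (\<lambda>x. weyl_left 0 \<alpha> f x * frac_weight H \<alpha> \<mu> x) \<and>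
     set_integrable lebesgue {0..1} (ext_frac_integrand \<alpha> f g) \<and>
     of_real v = ext_frac_integral \<alpha> f g \<and> ext_norm H \<alpha> \<mu> g f \<le> K"

lemma ext_boundedI:
  assumes "\<And>x. 0 < x \<Longrightarrow> x < 1 \<Longrightarrow> weyl_left_exists 0 \<alpha> f x"
    and "set_integrable lebesgue {0..1} (\<lambda>x. weyl_left 0 \<alpha> f x * frac_weight H \<alpha> \<mu> x)"
    and "set_integrable lebesgue {0..1} (ext_frac_integrand \<alpha> f g)"
    and "of_real v = ext_frac_integral \<alpha> f g" "ext_norm H \<alpha> \<mu> g f \<le> K"
  shows "ext_bounded H \<alpha> \<mu> g f v K"
  using assms by (auto simp: ext_bounded_def)

lemma ext_bounded_imp_has_ext_frac_integral:
  assumes "ext_bounded H \<alpha> \<mu> g f v K"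
    and "AE x in lebesgue. x \<in> {0<..<1} \<longrightarrow> weyl_right_exists 1 \<alpha> (\<lambda>y. g y - g 1) x"
  shows "has_ext_frac_integral H \<alpha> \<mu> f g v"
  using assms by (auto simp: ext_bounded_def has_ext_frac_integral_def admissible_integrand_def)

text \<open>
  By the junk values below, the end point 1 never has to be excluded, although the left derivative
  of a general integrand need not exist there.
\<close>

lemma frac_weight_at_1: "frac_weight H \<alpha> \<mu> 1 = 0"
  by (simp add: frac_weight_def)

lemma ext_frac_integrand_at_1: "ext_frac_integrand \<alpha> f g 1 = 0"
  by (simp add: ext_frac_integrand_def weyl_right_at_1)

lemma ext_bounded_lincomb_eq:
  assumes "\<And>x. 0 < x \<Longrightarrow> x < 1 \<Longrightarrow> weyl_left 0 \<alpha> f x = c * weyl_left 0 \<alpha> f1 x + d * weyl_left 0 \<alpha> f2 x"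
    and "0 \<le> x" "x \<le> 1"
  shows "weyl_left 0 \<alpha> f x * frac_weight H \<alpha> \<mu> x
      = c * (weyl_left 0 \<alpha> f1 x * frac_weight H \<alpha> \<mu> x) + d * (weyl_left 0 \<alpha> f2 x * frac_weight H \<alpha> \<mu> x)"
    and "ext_frac_integrand \<alpha> f g x = of_real c * ext_frac_integrand \<alpha> f1 g x + of_real d * ext_frac_integrand \<alpha> f2 g x"
proof -
  consider "x = 0" | "x = 1" | "0 < x" "x < 1" using assms(2,3) by force
  note cs = this
  show "weyl_left 0 \<alpha> f x * frac_weight H \<alpha> \<mu> x
      = c * (weyl_left 0 \<alpha> f1 x * frac_weight H \<alpha> \<mu> x) + d * (weyl_left 0 \<alpha> f2 x * frac_weight H \<alpha> \<mu> x)"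
    using cs by cases (auto simp: frac_weight_at_1 weyl_left_at_0 assms(1) algebra_simps)
  show "ext_frac_integrand \<alpha> f g x = of_real c * ext_frac_integrand \<alpha> f1 g x + of_real d * ext_frac_integrand \<alpha> f2 g x"
    using cs by cases (auto simp: ext_frac_integrand_def weyl_right_at_1 weyl_left_at_0 assms(1) algebra_simps)
qed

lemma set_integrable_ext_norm:
  assumes "ext_bounded H \<alpha> \<mu> g f v K"
  shows "set_integrable lebesgue {0..1} (\<lambda>x. \<bar>weyl_left 0 \<alpha> f x * frac_weight H \<alpha> \<mu> x\<bar> + norm (ext_frac_integrand \<alpha> f g x))"
  using assms by (intro set_integral_add set_integrable_abs set_integrable_norm) (auto simp: ext_bounded_def)

lemma ext_bounded_lincomb:
  assumes 1: "ext_bounded H \<alpha> \<mu> g f1 v1 K1" and 2: "ext_bounded H \<alpha> \<mu> g f2 v2 K2"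
  shows "ext_bounded H \<alpha> \<mu> g (\<lambda>t. c * f1 t + d * f2 t) (c * v1 + d * v2) (\<bar>c\<bar> * K1 + \<bar>d\<bar> * K2)"
proof (rule ext_boundedI)
  let ?f = "\<lambda>t. c * f1 t + d * f2 t"
  have e1: "\<And>x. 0 < x \<Longrightarrow> x < 1 \<Longrightarrow> weyl_left_exists 0 \<alpha> f1 x" and e2: "\<And>x. 0 < x \<Longrightarrow> x < 1 \<Longrightarrow> weyl_left_exists 0 \<alpha> f2 x"
    using 1 2 by (auto simp: ext_bounded_def)
  show "weyl_left_exists 0 \<alpha> ?f x" if "0 < x" "x < 1" for x
    using e1 e2 that by (intro weyl_left_add weyl_left_cmult)
  have L: "weyl_left 0 \<alpha> ?f x = c * weyl_left 0 \<alpha> f1 x + d * weyl_left 0 \<alpha> f2 x" if "0 < x" "x < 1" for x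
    using weyl_left_add(2)[OF weyl_left_cmult(1)[OF e1[OF that], of c] weyl_left_cmult(1)[OF e2[OF that], of d]]
      weyl_left_cmult(2)[OF e1[OF that], of c] weyl_left_cmult(2)[OF e2[OF that], of d] by simp
  have eq: "weyl_left 0 \<alpha> ?f x * frac_weight H \<alpha> \<mu> x
      = c * (weyl_left 0 \<alpha> f1 x * frac_weight H \<alpha> \<mu> x) + d * (weyl_left 0 \<alpha> f2 x * frac_weight H \<alpha> \<mu> x)"
    "ext_frac_integrand \<alpha> ?f g x = of_real c * ext_frac_integrand \<alpha> f1 g x + of_real d * ext_frac_integrand \<alpha> f2 g x"
    if "0 \<le> x" "x \<le> 1" for x
    using ext_bounded_lincomb_eq[of \<alpha> ?f c f1 d f2 x] L that by blast+
  have i1: "set_integrable lebesgue {0..1} (\<lambda>x. c * (weyl_left 0 \<alpha> f1 x * frac_weight H \<alpha> \<mu> x) + d * (weyl_left 0 \<alpha> f2 x * frac_weight H \<alpha> \<mu> x))"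
    using 1 2 by (intro set_integral_add set_integrable_mult_right) (auto simp: ext_bounded_def)
  show i2: "set_integrable lebesgue {0..1} (\<lambda>x. weyl_left 0 \<alpha> ?f x * frac_weight H \<alpha> \<mu> x)"
    using i1 by (subst set_integrable_cong[OF refl refl eq(1)]) auto
  have j1: "set_integrable lebesgue {0..1} (\<lambda>x. of_real c * ext_frac_integrand \<alpha> f1 g x)"
    and j2: "set_integrable lebesgue {0..1} (\<lambda>x. of_real d * ext_frac_integrand \<alpha> f2 g x)"
    using 1 2 by (auto intro!: set_integrable_mult_right simp: ext_bounded_def)
  show i3: "set_integrable lebesgue {0..1} (ext_frac_integrand \<alpha> ?f g)"
    using set_integral_add(1)[OF j1 j2] by (subst set_integrable_cong[OF refl refl eq(2)]) auto
  have "(LINT x:{0..1}|lebesgue. ext_frac_integrand \<alpha> ?f g x)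
      = (LINT x:{0..1}|lebesgue. of_real c * ext_frac_integrand \<alpha> f1 g x + of_real d * ext_frac_integrand \<alpha> f2 g x)"
    by (intro set_lebesgue_integral_cong) (auto intro!: eq(2))
  also have "\<dots> = of_real c * (LINT x:{0..1}|lebesgue. ext_frac_integrand \<alpha> f1 g x) + of_real d * (LINT x:{0..1}|lebesgue. ext_frac_integrand \<alpha> f2 g x)"
    by (simp add: set_integral_add(2)[OF j1 j2])
  finally show "of_real (c * v1 + d * v2) = ext_frac_integral \<alpha> ?f g"
    using 1 2 by (simp add: ext_bounded_def ext_frac_integral_def algebra_simps)
  let ?N = "\<lambda>f x. \<bar>weyl_left 0 \<alpha> f x * frac_weight H \<alpha> \<mu> x\<bar> + norm (ext_frac_integrand \<alpha> f g x)"
  have n1: "set_integrable lebesgue {0..1} (\<lambda>x. \<bar>c\<bar> * ?N f1 x)" and n2: "set_integrable lebesgue {0..1} (\<lambda>x. \<bar>d\<bar> * ?N f2 x)"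
    using set_integrable_ext_norm[OF 1] set_integrable_ext_norm[OF 2] by (auto intro!: set_integrable_mult_right)
  have "ext_norm H \<alpha> \<mu> g ?f \<le> (LINT x:{0..1}|lebesgue. \<bar>c\<bar> * ?N f1 x + \<bar>d\<bar> * ?N f2 x)"
    unfolding ext_norm_def
  proof (rule set_integral_mono)
    show "set_integrable lebesgue {0..1} (?N ?f)"
      using i2 i3 by (intro set_integral_add set_integrable_abs set_integrable_norm)
    show "set_integrable lebesgue {0..1} (\<lambda>x. \<bar>c\<bar> * ?N f1 x + \<bar>d\<bar> * ?N f2 x)"
      using n1 n2 by (rule set_integral_add)
    fix x :: real assume "x \<in> {0..1}"
    then have x: "0 \<le> x" "x \<le> 1" by auto
    have "\<bar>weyl_left 0 \<alpha> ?f x * frac_weight H \<alpha> \<mu> x\<bar> \<le> \<bar>c\<bar> * \<bar>weyl_left 0 \<alpha> f1 x * frac_weight H \<alpha> \<mu> x\<bar> + \<bar>d\<bar> * \<bar>weyl_left 0 \<alpha> f2 x * frac_weight H \<alpha> \<mu> x\<bar>"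
      unfolding eq(1)[OF x] by (simp flip: abs_mult)
    moreover have "norm (ext_frac_integrand \<alpha> ?f g x) \<le> \<bar>c\<bar> * norm (ext_frac_integrand \<alpha> f1 g x) + \<bar>d\<bar> * norm (ext_frac_integrand \<alpha> f2 g x)"
      unfolding eq(2)[OF x] by (rule order_trans[OF norm_triangle_ineq]) (simp add: norm_mult)
    ultimately show "?N ?f x \<le> \<bar>c\<bar> * ?N f1 x + \<bar>d\<bar> * ?N f2 x"
      by (simp add: algebra_simps)
  qed
  also have "\<dots> = \<bar>c\<bar> * ext_norm H \<alpha> \<mu> g f1 + \<bar>d\<bar> * ext_norm H \<alpha> \<mu> g f2"
    unfolding ext_norm_def by (simp add: set_integral_add(2)[OF n1 n2])
  also have "\<dots> \<le> \<bar>c\<bar> * K1 + \<bar>d\<bar> * K2"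
    using 1 2 by (intro add_mono mult_left_mono) (auto simp: ext_bounded_def)
  finally show "ext_norm H \<alpha> \<mu> g ?f \<le> \<bar>c\<bar> * K1 + \<bar>d\<bar> * K2" .
qed

lemma ext_bounded_zero: "ext_bounded H \<alpha> \<mu> g (\<lambda>_. 0) 0 0"
  by (auto simp: ext_bounded_def weyl_left_zero ext_frac_integral_def ext_frac_integrand_def[abs_def]
      ext_norm_def set_lebesgue_integral_def set_integrable_def)

lemma ext_bounded_sum:
  assumes "finite I" "\<And>i. i \<in> I \<Longrightarrow> ext_bounded H \<alpha> \<mu> g (f i) (v i) (K i)"
  shows "ext_bounded H \<alpha> \<mu> g (\<lambda>t. \<Sum>i\<in>I. c i * f i t) (\<Sum>i\<in>I. c i * v i) (\<Sum>i\<in>I. \<bar>c i\<bar> * K i)"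
  using assms
proof (induction I rule: finite_induct)
  case empty
  then show ?case using ext_bounded_zero by simp
next
  case (insert i I)
  then show ?case
    using ext_bounded_lincomb[of H \<alpha> \<mu> g "f i" "v i" "K i" "\<lambda>t. \<Sum>i\<in>I. c i * f i t" "\<Sum>i\<in>I. c i * v i" "\<Sum>i\<in>I. \<bar>c i\<bar> * K i" "c i" 1]
    by simp
qed

lemma frac_weight_measurable [measurable]: "frac_weight H \<alpha> \<mu> \<in> borel_measurable borel"
  unfolding frac_weight_def[abs_def] by measurable

lemma frac_weight_nonneg: "0 \<le> frac_weight H \<alpha> \<mu> x"
  by (simp add: frac_weight_def)

text \<open>The left derivative of the jump is the kernel of the fractional integral of order 1 -
  \<alpha>, so integrating it against the right derivative of that order is the inversion formula.
  The two finite potentials bound the two halves of \<open>ext_norm\<close>.\<close>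

lemma ext_bounded_heaviside:
  assumes \<alpha>: "0 < \<alpha>" "\<alpha> < 1" and p: "0 < p" "p < 1"
    and g[measurable]: "g \<in> borel_measurable borel"
    and Y: "potential \<alpha> (right_abs \<alpha> g) p < \<infinity>"
    and quot: "quotient_mass g p < \<infinity>"
    and W: "potential \<alpha> (\<lambda>x. ennreal (frac_weight H \<alpha> \<mu> x)) p < \<infinity>"
  shows "ext_bounded H \<alpha> \<mu> g (indicator {p<..}) (g 1 - g p)
    (enn2real (potential \<alpha> (\<lambda>x. ennreal (frac_weight H \<alpha> \<mu> x)) p) / Gamma (1 - \<alpha>)
      + enn2real (potential \<alpha> (right_abs \<alpha> g) p) / (Gamma (1 - \<alpha>) * Gamma \<alpha>))"
proof (rule ext_boundedI)
  let ?h = "indicator {p<..} :: real \<Rightarrow> real"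
  define w where "w = (\<lambda>x. indicator {p<..<1} x * (x - p) powr (-\<alpha>))"
  define c where "c = exp (\<i> * of_real (pi * (1 - \<alpha>))) / of_real (Gamma \<alpha> * Gamma (1 - \<alpha>))"
  have w_nn: "0 \<le> w x" for x by (simp add: w_def)
  have w_meas[measurable]: "w \<in> borel_measurable borel" by (simp add: w_def)
  have Gp: "0 < Gamma \<alpha>" "0 < Gamma (1 - \<alpha>)" using \<alpha> by auto
  show "weyl_left_exists 0 \<alpha> ?h x" if "0 < x" for x
    using weyl_left_heaviside[of \<alpha> p x] \<alpha> p that by simp
  have L: "weyl_left 0 \<alpha> ?h x = w x / Gamma (1 - \<alpha>)" if "0 \<le> x" "x < 1" for x
    using weyl_left_heaviside(2)[of \<alpha> p x] \<alpha> p that by (simp add: w_def indicator_def)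
  have eq1: "indicator {0..1} x *\<^sub>R (weyl_left 0 \<alpha> ?h x * frac_weight H \<alpha> \<mu> x) = (w x * frac_weight H \<alpha> \<mu> x) / Gamma (1 - \<alpha>)" for x
  proof -
    consider "x < 0 \<or> 1 < x" | "x = 1" | "0 \<le> x" "x < 1" by linarith
    then show ?thesis by cases (use p in \<open>auto simp: L frac_weight_at_1 w_def\<close>)
  qed
  have eq2: "indicator {0..1} x *\<^sub>R ext_frac_integrand \<alpha> ?h g x = c * of_real (w x * right_core \<alpha> g x)" for x
  proof -
    consider "x < 0 \<or> 1 < x" | "x = 1" | "0 \<le> x" "x < 1" by linarith
    then show ?thesis
    proof cases
      case 3
      then show ?thesis
        by (simp add: ext_frac_integrand_def L weyl_right_eq c_def mult_ac)
    qed (use p in \<open>auto simp: ext_frac_integrand_at_1 w_def\<close>)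
  qed
  have nn1: "(\<integral>\<^sup>+x. ennreal (w x * frac_weight H \<alpha> \<mu> x) \<partial>lborel) = potential \<alpha> (\<lambda>x. ennreal (frac_weight H \<alpha> \<mu> x)) p"
    using w_nn unfolding potential_def w_def by (intro nn_integral_cong) (simp add: ennreal_mult frac_weight_nonneg)
  have int1: "integrable lborel (\<lambda>x. w x * frac_weight H \<alpha> \<mu> x)"
    using W w_nn by (intro integrableI_nonneg) (auto simp: nn1 frac_weight_nonneg)
  have nn2: "(\<integral>\<^sup>+x. ennreal (w x * \<bar>right_core \<alpha> g x\<bar>) \<partial>lborel) \<le> potential \<alpha> (right_abs \<alpha> g) p"
    unfolding potential_def w_def
    by (intro nn_integral_mono) (auto simp: ennreal_mult intro!: mult_left_mono right_core_le_right_abs[OF g \<alpha>])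
  have int2a: "integrable lborel (\<lambda>x. w x * \<bar>right_core \<alpha> g x\<bar>)"
    using Y nn2 w_nn by (intro integrableI_nonneg) auto
  have core: "has_bochner_integral lborel (\<lambda>x. w x * right_core \<alpha> g x) (Gamma (1 - \<alpha>) * Gamma \<alpha> * (g p - g 1))"
    using right_core_inversion[OF \<alpha> p(2) g Y quot] by (simp add: w_def mult_ac)
  have core': "has_bochner_integral lborel (\<lambda>x. c * of_real (w x * right_core \<alpha> g x)) (c * of_real (Gamma (1 - \<alpha>) * Gamma \<alpha> * (g p - g 1)))"
    by (intro has_bochner_integral_mult_right has_bochner_integral_of_real core)
  show i1: "set_integrable lebesgue {0..1} (\<lambda>x. weyl_left 0 \<alpha> ?h x * frac_weight H \<alpha> \<mu> x)"
    unfolding set_integrable_def eq1 using int1 by (subst integrable_completion) auto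
  show i2: "set_integrable lebesgue {0..1} (ext_frac_integrand \<alpha> ?h g)"
    unfolding set_integrable_def eq2 using core' by (subst integrable_completion) (auto simp: has_bochner_integral_iff)
  have I: "(LINT x:{0..1}|lebesgue. ext_frac_integrand \<alpha> ?h g x) = c * of_real (Gamma (1 - \<alpha>) * Gamma \<alpha> * (g p - g 1))"
    unfolding set_lebesgue_integral_def eq2 using core'
    by (subst integral_completion) (auto simp: has_bochner_integral_iff)
  show "of_real (g 1 - g p) = ext_frac_integral \<alpha> ?h g"
  proof -
    \<comment> \<open>The phases of the definitions multiply to -1, which turns
      \<open>g p - g 1\<close> into the increment \<open>g 1 - g p\<close>.\<close>
    have "exp (\<i> * of_real (pi * \<alpha>)) * exp (\<i> * of_real (pi * (1 - \<alpha>))) = exp (\<i> * of_real pi)"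
      by (simp add: algebra_simps flip: exp_add)
    also have "\<dots> = -1" by (simp add: mult.commute)
    finally have e: "exp (\<i> * of_real (pi * \<alpha>)) * exp (\<i> * of_real (pi * (1 - \<alpha>))) = -1" .
    have "ext_frac_integral \<alpha> ?h g = (exp (\<i> * of_real (pi * \<alpha>)) * exp (\<i> * of_real (pi * (1 - \<alpha>)))) *
        (of_real (Gamma (1 - \<alpha>) * Gamma \<alpha> * (g p - g 1)) / of_real (Gamma \<alpha> * Gamma (1 - \<alpha>)))"
      unfolding ext_frac_integral_def I c_def by (simp only: times_divide_eq_left times_divide_eq_right mult.assoc)
    also have "\<dots> = of_real (g 1 - g p)"
      unfolding e using Gp by (simp flip: of_real_mult of_real_divide)
    finally show ?thesis by simp
  qed
  have cn: "norm c = 1 / (Gamma (1 - \<alpha>) * Gamma \<alpha>)"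
    using Gp unfolding c_def norm_divide norm_of_real norm_exp_i_times by simp
  have "indicator {0..1} x *\<^sub>R (\<bar>weyl_left 0 \<alpha> ?h x * frac_weight H \<alpha> \<mu> x\<bar> + norm (ext_frac_integrand \<alpha> ?h g x))
     = (w x * frac_weight H \<alpha> \<mu> x) / Gamma (1 - \<alpha>) + (w x * \<bar>right_core \<alpha> g x\<bar>) / (Gamma (1 - \<alpha>) * Gamma \<alpha>)" for x
  proof -
    have "indicator {0..1} x *\<^sub>R (\<bar>weyl_left 0 \<alpha> ?h x * frac_weight H \<alpha> \<mu> x\<bar> + norm (ext_frac_integrand \<alpha> ?h g x))
      = \<bar>indicator {0..1} x *\<^sub>R (weyl_left 0 \<alpha> ?h x * frac_weight H \<alpha> \<mu> x)\<bar> + norm (indicator {0..1} x *\<^sub>R ext_frac_integrand \<alpha> ?h g x)"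
      by (simp add: indicator_def)
    also have "\<dots> = \<bar>(w x * frac_weight H \<alpha> \<mu> x) / Gamma (1 - \<alpha>)\<bar> + norm c * \<bar>w x * right_core \<alpha> g x\<bar>"
      unfolding eq1 eq2 norm_mult norm_of_real ..
    finally show ?thesis
      using Gp w_nn[of x] frac_weight_nonneg[of H \<alpha> \<mu> x] by (simp add: cn abs_mult)
  qed
  then have "ext_norm H \<alpha> \<mu> g ?h = (\<integral>x. (w x * frac_weight H \<alpha> \<mu> x) / Gamma (1 - \<alpha>) + (w x * \<bar>right_core \<alpha> g x\<bar>) / (Gamma (1 - \<alpha>) * Gamma \<alpha>) \<partial>lebesgue)"
    by (simp add: ext_norm_def set_lebesgue_integral_def)
  also have "\<dots> = (\<integral>x. (w x * frac_weight H \<alpha> \<mu> x) / Gamma (1 - \<alpha>) + (w x * \<bar>right_core \<alpha> g x\<bar>) / (Gamma (1 - \<alpha>) * Gamma \<alpha>) \<partial>lborel)"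
    by (rule integral_completion) measurable
  also have "\<dots> = (\<integral>x. (w x * frac_weight H \<alpha> \<mu> x) \<partial>lborel) / Gamma (1 - \<alpha>) + (\<integral>x. w x * \<bar>right_core \<alpha> g x\<bar> \<partial>lborel) / (Gamma (1 - \<alpha>) * Gamma \<alpha>)"
    using int1 int2a by simp
  also have "(\<integral>x. (w x * frac_weight H \<alpha> \<mu> x) \<partial>lborel) = enn2real (potential \<alpha> (\<lambda>x. ennreal (frac_weight H \<alpha> \<mu> x)) p)"
    using w_nn by (subst integral_eq_nn_integral) (auto simp: frac_weight_nonneg nn1)
  also have "(\<integral>x. w x * \<bar>right_core \<alpha> g x\<bar> \<partial>lborel) \<le> enn2real (potential \<alpha> (right_abs \<alpha> g) p)"
    using w_nn Y nn2 by (subst integral_eq_nn_integral) (auto intro!: enn2real_mono)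
  finally show "ext_norm H \<alpha> \<mu> g ?h \<le> enn2real (potential \<alpha> (\<lambda>x. ennreal (frac_weight H \<alpha> \<mu> x)) p) / Gamma (1 - \<alpha>)
      + enn2real (potential \<alpha> (right_abs \<alpha> g) p) / (Gamma (1 - \<alpha>) * Gamma \<alpha>)"
    using Gp by (simp add: divide_right_mono)
qed

text \<open>The left derivative at \<open>x\<close> looks only at the past of \<open>x\<close>, and
  before \<open>x < 1\<close> only finitely many \<phi> have started. Pointwise the series is
  therefore a finite sum; summability of \<open>K\<close> is what allows integrating it term by term
  up to time 1.\<close>

lemma ext_bounded_suminf:
  assumes \<phi>: "\<And>n. ext_bounded H \<alpha> \<mu> g (\<phi> n) (v n) (K n)" and K: "summable K"
    and zero: "\<And>n u. u \<le> s n \<Longrightarrow> \<phi> n u = 0" and s: "s \<longlonglongrightarrow> 1" and v: "v sums V"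
  shows "ext_bounded H \<alpha> \<mu> g (\<lambda>t. \<Sum>n. \<phi> n t) V (ext_norm H \<alpha> \<mu> g (\<lambda>t. \<Sum>n. \<phi> n t))"
proof (rule ext_boundedI)
  let ?\<psi> = "\<lambda>t. \<Sum>n. \<phi> n t"
  have loc: "\<exists>N. (\<forall>n\<ge>N. weyl_left 0 \<alpha> (\<phi> n) x = 0) \<and> weyl_left_exists 0 \<alpha> ?\<psi> x
      \<and> weyl_left 0 \<alpha> ?\<psi> x = (\<Sum>n<N. weyl_left 0 \<alpha> (\<phi> n) x)" if x: "0 < x" "x < 1" for x
  proof -
    obtain N where N: "\<And>n. n \<ge> N \<Longrightarrow> x < s n"
      using order_tendstoD(1)[OF s x(2)] by (auto simp: eventually_sequentially)
    have z: "\<phi> n u = 0" if "n \<ge> N" "u \<le> x" for n u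
      using zero[of u n] N[of n] that by simp
    have "?\<psi> u = (\<Sum>n<N. \<phi> n u)" if "u \<le> x" for u
      by (rule suminf_finite) (use z that in \<open>auto simp: not_less\<close>)
    note \<psi> = this
    have "weyl_left_exists 0 \<alpha> (\<phi> n) x" for n using \<phi>[of n] x by (auto simp: ext_bounded_def)
    then have sm: "weyl_left_exists 0 \<alpha> (\<lambda>t. \<Sum>n<N. \<phi> n t) x \<and>
        weyl_left 0 \<alpha> (\<lambda>t. \<Sum>n<N. \<phi> n t) x = (\<Sum>n<N. weyl_left 0 \<alpha> (\<phi> n) x)"
      by (intro weyl_left_sum) auto
    have "weyl_left 0 \<alpha> (\<phi> n) x = 0" if "n \<ge> N" for n
      using weyl_left_cong[of x "\<phi> n" "\<lambda>_. 0" \<alpha>] z that x by (simp add: weyl_left_zero)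
    moreover have "weyl_left_exists 0 \<alpha> ?\<psi> x"
      using sm weyl_left_exists_cong[of x ?\<psi> "\<lambda>t. \<Sum>n<N. \<phi> n t" \<alpha>] \<psi> x by blast
    moreover have "weyl_left 0 \<alpha> ?\<psi> x = (\<Sum>n<N. weyl_left 0 \<alpha> (\<phi> n) x)"
      using sm weyl_left_cong[of x ?\<psi> "\<lambda>t. \<Sum>n<N. \<phi> n t" \<alpha>] \<psi> x by auto
    ultimately show ?thesis by blast
  qed
  then show "weyl_left_exists 0 \<alpha> ?\<psi> x" if "0 < x" "x < 1" for x
    using that by blast
  define F where "F = (\<lambda>n x. indicator {0..1} x *\<^sub>R (weyl_left 0 \<alpha> (\<phi> n) x * frac_weight H \<alpha> \<mu> x))"
  define G where "G = (\<lambda>n x. indicator {0..1} x *\<^sub>R ext_frac_integrand \<alpha> (\<phi> n) g x)"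
  have fin: "\<exists>N. (\<forall>n\<ge>N. F n x = 0) \<and> (\<forall>n\<ge>N. G n x = 0)
      \<and> indicator {0..1} x *\<^sub>R (weyl_left 0 \<alpha> ?\<psi> x * frac_weight H \<alpha> \<mu> x) = (\<Sum>n<N. F n x)
      \<and> indicator {0..1} x *\<^sub>R ext_frac_integrand \<alpha> ?\<psi> g x = (\<Sum>n<N. G n x)" for x
  proof -
    consider "x < 0 \<or> 1 < x \<or> x = 0 \<or> x = 1" | "0 < x" "x < 1" by linarith
    then show ?thesis
    proof cases
      case 1
      then show ?thesis
        by (intro exI[of _ 0]) (auto simp: F_def G_def weyl_left_at_0 frac_weight_at_1 ext_frac_integrand_at_1 ext_frac_integrand_def weyl_right_at_1)
    next
      case 2
      from loc[OF 2] obtain N where "\<And>n. n \<ge> N \<Longrightarrow> weyl_left 0 \<alpha> (\<phi> n) x = 0"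
        "weyl_left 0 \<alpha> ?\<psi> x = (\<Sum>n<N. weyl_left 0 \<alpha> (\<phi> n) x)" by blast
      then show ?thesis using 2
        by (intro exI[of _ N]) (simp add: F_def G_def ext_frac_integrand_def sum_distrib_right)
    qed
  qed
  have eqF: "indicator {0..1} x *\<^sub>R (weyl_left 0 \<alpha> ?\<psi> x * frac_weight H \<alpha> \<mu> x) = (\<Sum>n. F n x)"
    and eqG: "indicator {0..1} x *\<^sub>R ext_frac_integrand \<alpha> ?\<psi> g x = (\<Sum>n. G n x)"
    and sF: "summable (\<lambda>n. norm (F n x))" and sG: "summable (\<lambda>n. norm (G n x))" for x
  proof -
    obtain N where N: "\<forall>n\<ge>N. F n x = 0" "\<forall>n\<ge>N. G n x = 0"
      "indicator {0..1} x *\<^sub>R (weyl_left 0 \<alpha> ?\<psi> x * frac_weight H \<alpha> \<mu> x) = (\<Sum>n<N. F n x)"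
      "indicator {0..1} x *\<^sub>R ext_frac_integrand \<alpha> ?\<psi> g x = (\<Sum>n<N. G n x)" using fin[of x] by blast
    show "indicator {0..1} x *\<^sub>R (weyl_left 0 \<alpha> ?\<psi> x * frac_weight H \<alpha> \<mu> x) = (\<Sum>n. F n x)"
      unfolding N(3) by (rule suminf_finite[symmetric]) (use N in \<open>auto simp: not_less\<close>)
    show "indicator {0..1} x *\<^sub>R ext_frac_integrand \<alpha> ?\<psi> g x = (\<Sum>n. G n x)"
      unfolding N(4) by (rule suminf_finite[symmetric]) (use N in \<open>auto simp: not_less\<close>)
    show "summable (\<lambda>n. norm (F n x))"
      by (rule summable_finite[of "{..<N}"]) (use N in \<open>auto simp: not_less\<close>)
    show "summable (\<lambda>n. norm (G n x))"
      by (rule summable_finite[of "{..<N}"]) (use N in \<open>auto simp: not_less\<close>)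
  qed
  have intF: "integrable lebesgue (F n)" and intG: "integrable lebesgue (G n)" for n
    using \<phi>[of n] by (auto simp: ext_bounded_def set_integrable_def F_def G_def)
  have nF: "(\<integral>x. norm (F n x) \<partial>lebesgue) \<le> K n" and nG: "(\<integral>x. norm (G n x) \<partial>lebesgue) \<le> K n" for n
  proof -
    have e: "indicator {0..1} x *\<^sub>R (\<bar>weyl_left 0 \<alpha> (\<phi> n) x * frac_weight H \<alpha> \<mu> x\<bar> + norm (ext_frac_integrand \<alpha> (\<phi> n) g x))
       = norm (F n x) + norm (G n x)" for x
      by (simp add: F_def G_def indicator_def)
    have "ext_norm H \<alpha> \<mu> g (\<phi> n) = (\<integral>x. norm (F n x) + norm (G n x) \<partial>lebesgue)"
      unfolding ext_norm_def set_lebesgue_integral_def e ..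
    then have "ext_norm H \<alpha> \<mu> g (\<phi> n) = (\<integral>x. norm (F n x) \<partial>lebesgue) + (\<integral>x. norm (G n x) \<partial>lebesgue)"
      using intF intG by simp
    moreover have "ext_norm H \<alpha> \<mu> g (\<phi> n) \<le> K n" using \<phi>[of n] by (simp add: ext_bounded_def)
    moreover have "0 \<le> (\<integral>x. norm (F n x) \<partial>lebesgue)" "0 \<le> (\<integral>x. norm (G n x) \<partial>lebesgue)" by simp_all
    ultimately show "(\<integral>x. norm (F n x) \<partial>lebesgue) \<le> K n" "(\<integral>x. norm (G n x) \<partial>lebesgue) \<le> K n" by linarith+
  qed
  have smF: "summable (\<lambda>n. \<integral>x. norm (F n x) \<partial>lebesgue)" and smG: "summable (\<lambda>n. \<integral>x. norm (G n x) \<partial>lebesgue)"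
    using nF nG by (auto intro!: summable_comparison_test'[OF K, of 0])
  show "set_integrable lebesgue {0..1} (\<lambda>x. weyl_left 0 \<alpha> ?\<psi> x * frac_weight H \<alpha> \<mu> x)"
    unfolding set_integrable_def eqF using sF by (intro integrable_suminf intF smF) auto
  show "set_integrable lebesgue {0..1} (ext_frac_integrand \<alpha> ?\<psi> g)"
    unfolding set_integrable_def eqG using sG by (intro integrable_suminf intG smG) auto
  have "(\<lambda>n. integral\<^sup>L lebesgue (G n)) sums (\<integral>x. (\<Sum>n. G n x) \<partial>lebesgue)"
    using sG by (intro sums_integral intG smG) auto
  then have "(\<lambda>n. exp (\<i> * of_real (pi * \<alpha>)) * integral\<^sup>L lebesgue (G n)) sums
      (exp (\<i> * of_real (pi * \<alpha>)) * (\<integral>x. (\<Sum>n. G n x) \<partial>lebesgue))"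
    by (rule sums_mult)
  moreover have "exp (\<i> * of_real (pi * \<alpha>)) * integral\<^sup>L lebesgue (G n) = of_real (v n)" for n
    using \<phi>[of n] unfolding G_def by (simp add: ext_bounded_def ext_frac_integral_def set_lebesgue_integral_def)
  moreover have "exp (\<i> * of_real (pi * \<alpha>)) * (\<integral>x. (\<Sum>n. G n x) \<partial>lebesgue) = ext_frac_integral \<alpha> ?\<psi> g"
    unfolding eqG[symmetric] ext_frac_integral_def set_lebesgue_integral_def ..
  ultimately have "(\<lambda>n. complex_of_real (v n)) sums ext_frac_integral \<alpha> ?\<psi> g" by simp
  moreover have "(\<lambda>n. complex_of_real (v n)) sums of_real V"
    using v by (simp add: sums_of_real)
  ultimately show "of_real V = ext_frac_integral \<alpha> ?\<psi> g"
    using sums_unique2 by blast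
qed simp

section \<open>Weight and moment estimates\<close>

text \<open>The weight need not be monotone on (p, 1). Writing \<open>1 - x = (1 - p) * r\<close>
  compares it with its value at \<open>p\<close>: as \<open>\<bar>ln (1 - p)\<bar>\<close> is at
  least 1, the logarithm is at most the product of this number and
  \<open>1 + \<bar>ln r\<bar>\<close>, and \<open>r powr b\<close> absorbs the second factor. The
  exponents \<open>b\<close> and 1 - \<alpha> add up to \<open>H\<close>.\<close>

lemma potential_frac_weight_le:
  fixes H \<alpha> \<mu> p :: real
  assumes \<alpha>: "0 < \<alpha>" "\<alpha> < 1" and H: "0 < H + \<alpha> - 1" and \<mu>: "0 \<le> \<mu>" "\<mu> \<le> 1" and p: "p < 1" "1 - p \<le> exp (-1)"
  shows "potential \<alpha> (\<lambda>x. ennreal (frac_weight H \<alpha> \<mu> x)) p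
    \<le> ennreal ((1 + 1 / (H + \<alpha> - 1)) / (1 - \<alpha>) * ((1 - p) powr H * \<bar>ln (1 - p)\<bar> powr \<mu>))"
proof -
  define b where "b = H + \<alpha> - 1"
  define A where "A = (1 + 1 / b) * ((1 - p) powr b * \<bar>ln (1 - p)\<bar> powr \<mu>)"
  have b: "0 < b" using H by (simp add: b_def)
  have "ln (1 - p) \<le> ln (exp (-1))" using p by (subst ln_le_cancel_iff) auto
  then have l1: "1 \<le> \<bar>ln (1 - p)\<bar>" by simp
  have bound: "frac_weight H \<alpha> \<mu> x \<le> A" if x: "p < x" "x < 1" for x
  proof -
    define r where "r = (1 - x) / (1 - p)"
    have r: "0 < r" "r < 1" "1 - x = (1 - p) * r" using x p by (auto simp: r_def)
    have lr: "ln r < 0" using r by simp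
    have "\<bar>ln (1 - x)\<bar> = \<bar>ln (1 - p)\<bar> + \<bar>ln r\<bar>"
    proof -
      have "ln (1 - x) = ln (1 - p) + ln r" using r p by (simp add: ln_mult)
      moreover have "ln (1 - p) < 0" using \<open>ln (1 - p) \<le> ln (exp (-1))\<close> by simp
      ultimately show ?thesis using lr by simp
    qed
    also have "\<dots> \<le> \<bar>ln (1 - p)\<bar> * (1 + \<bar>ln r\<bar>)"
      using mult_right_mono[OF l1, of "\<bar>ln r\<bar>"] by (simp add: algebra_simps)
    finally have "\<bar>ln (1 - x)\<bar> powr \<mu> \<le> (\<bar>ln (1 - p)\<bar> * (1 + \<bar>ln r\<bar>)) powr \<mu>"
      using \<mu> by (intro powr_mono2) auto
    also have "\<dots> = \<bar>ln (1 - p)\<bar> powr \<mu> * (1 + \<bar>ln r\<bar>) powr \<mu>"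
      by (rule powr_mult)
    also have "\<dots> \<le> \<bar>ln (1 - p)\<bar> powr \<mu> * (1 + \<bar>ln r\<bar>)"
      using powr_mono[of \<mu> 1 "1 + \<bar>ln r\<bar>"] \<mu> by (intro mult_left_mono) auto
    finally have 1: "\<bar>ln (1 - x)\<bar> powr \<mu> \<le> \<bar>ln (1 - p)\<bar> powr \<mu> * (1 + \<bar>ln r\<bar>)" .
    \<comment> \<open>This is \<open>ln y \<le> y - 1\<close> for
      \<open>y = r powr (-b)\<close>.\<close>
    have "b * \<bar>ln r\<bar> \<le> r powr (-b)"
    proof -
      have "ln (r powr (-b)) \<le> r powr (-b) - 1" using r by (intro ln_le_minus_one) auto
      then show ?thesis using lr r by (simp add: ln_powr)
    qed
    then have "r powr b * (b * \<bar>ln r\<bar>) \<le> r powr b * r powr (-b)" by (intro mult_left_mono) auto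
    also have "\<dots> = 1" using r by (simp flip: powr_add)
    finally have "r powr b * \<bar>ln r\<bar> \<le> 1 / b" using b by (simp add: field_simps)
    moreover have "r powr b \<le> 1" using r b by (intro powr_le1) auto
    ultimately have 2: "r powr b * (1 + \<bar>ln r\<bar>) \<le> 1 + 1 / b" by (simp add: algebra_simps)
    have "frac_weight H \<alpha> \<mu> x = (1 - p) powr b * r powr b * \<bar>ln (1 - x)\<bar> powr \<mu>"
      unfolding frac_weight_def b_def[symmetric] r(3) using r p by (simp add: powr_mult)
    also have "\<dots> \<le> (1 - p) powr b * r powr b * (\<bar>ln (1 - p)\<bar> powr \<mu> * (1 + \<bar>ln r\<bar>))"
      using 1 by (intro mult_left_mono) auto
    also have "\<dots> = ((1 - p) powr b * \<bar>ln (1 - p)\<bar> powr \<mu>) * (r powr b * (1 + \<bar>ln r\<bar>))" by (simp add: mult_ac)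
    also have "\<dots> \<le> ((1 - p) powr b * \<bar>ln (1 - p)\<bar> powr \<mu>) * (1 + 1 / b)"
      using 2 by (intro mult_left_mono) auto
    finally show ?thesis by (simp add: A_def mult_ac)
  qed
  have A: "0 \<le> A" using b by (simp add: A_def)
  have "potential \<alpha> (\<lambda>x. ennreal (frac_weight H \<alpha> \<mu> x)) p
    \<le> (\<integral>\<^sup>+x. ennreal (A * (indicator {p<..<1} x * (x - p) powr (-\<alpha>))) \<partial>lborel)"
    unfolding potential_def
  proof (intro nn_integral_mono)
    fix x
    show "ennreal (indicator {p<..<1} x * (x - p) powr (-\<alpha>)) * ennreal (frac_weight H \<alpha> \<mu> x) \<le> ennreal (A * (indicator {p<..<1} x * (x - p) powr (-\<alpha>)))"
      using bound[of x] A by (auto simp: indicator_def mult.commute frac_weight_nonneg simp flip: ennreal_mult intro!: ennreal_leI mult_left_mono)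
  qed
  also have "\<dots> = ennreal (A * ((1 - p) powr (1 - \<alpha>) / (1 - \<alpha>)))"
    using has_bochner_integral_mult_right[OF has_bochner_integral_powr_left[of \<alpha> p 1], of A] \<alpha> p A
    by (subst nn_integral_eq_integral) (auto simp: has_bochner_integral_iff)
  also have "A * ((1 - p) powr (1 - \<alpha>) / (1 - \<alpha>)) = (1 + 1 / b) / (1 - \<alpha>) * ((1 - p) powr H * \<bar>ln (1 - p)\<bar> powr \<mu>)"
  proof -
    have "(1 - p) powr b * (1 - p) powr (1 - \<alpha>) = (1 - p) powr H"
      by (simp add: b_def flip: powr_add)
    then show ?thesis by (simp add: A_def mult_ac)
  qed
  finally show ?thesis by (simp add: b_def)
qed

section \<open>Moments and small ball probabilities of the increments\<close>

context prob_space begin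

lemma gaussian_process_measurable:
  assumes "gaussian_process M B" "0 \<le> t"
  shows "B t \<in> borel_measurable M"
proof -
  have "finite {t} \<and> {t} \<subseteq> {0..}" using assms by auto
  with assms have "gaussian_rv M (\<lambda>\<omega>. \<Sum>t\<in>{t}. 1 * B t \<omega>)"
    unfolding gaussian_process_def by (elim allE[of _ "{t}"] allE[of _ "\<lambda>_. 1"]) blast
  then show ?thesis by (simp add: gaussian_rv_def)
qed

lemma fbm_increment:
  assumes fbm: "fractional_brownian_motion M H B" and st: "0 < s" "0 < t"
  shows "(\<lambda>\<omega>. B t \<omega> - B s \<omega>) \<in> borel_measurable M"
    and "integrable M (\<lambda>\<omega>. (B t \<omega> - B s \<omega>)\<^sup>2)"
    and "(\<integral>\<omega>. (B t \<omega> - B s \<omega>)\<^sup>2 \<partial>M) = \<bar>t - s\<bar> powr (2 * H)"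
    and "(\<integral>\<omega>. B t \<omega> - B s \<omega> \<partial>M) = 0"
    and "gaussian_rv M (\<lambda>\<omega>. B t \<omega> - B s \<omega>)"
proof -
  have gp: "gaussian_process M B" using fbm by (simp add: fractional_brownian_motion_def)
  have cov: "(\<integral>\<omega>. B u \<omega> * B v \<omega> \<partial>M) = (u powr (2 * H) + v powr (2 * H) - \<bar>u - v\<bar> powr (2 * H)) / 2" if "0 \<le> u" "0 \<le> v" for u v
    using fbm that by (simp add: fractional_brownian_motion_def)
  have mean: "(\<integral>\<omega>. B u \<omega> \<partial>M) = 0" if "0 \<le> u" for u
    using fbm that by (simp add: fractional_brownian_motion_def)
  have [measurable]: "B u \<in> borel_measurable M" if "0 < u" for u
    using gaussian_process_measurable[OF gp] that by simp
  note [measurable] = this[OF st(1)] this[OF st(2)]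
  have sq: "(\<integral>\<omega>. (B u \<omega>)\<^sup>2 \<partial>M) = u powr (2 * H)" if "0 < u" for u
    using cov[of u u] that by (simp add: power2_eq_square)
  \<comment> \<open>A non-integrable function has Bochner integral 0, whereas the covariance formula
    gives a positive value. This argument needs a positive time.\<close>
  have isq: "integrable M (\<lambda>\<omega>. (B u \<omega>)\<^sup>2)" if "0 < u" for u
    using sq[OF that] that not_integrable_integral_eq[of M "\<lambda>\<omega>. (B u \<omega>)\<^sup>2"] by force
  note [simp] = isq[OF st(1)] isq[OF st(2)]
  have ip: "integrable M (\<lambda>\<omega>. B t \<omega> * B s \<omega>)"
  proof (rule Bochner_Integration.integrable_bound[of M "\<lambda>\<omega>. (B t \<omega>)\<^sup>2 + (B s \<omega>)\<^sup>2"])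
    show "AE \<omega> in M. norm (B t \<omega> * B s \<omega>) \<le> norm ((B t \<omega>)\<^sup>2 + (B s \<omega>)\<^sup>2)"
    proof (intro AE_I2)
      fix \<omega>
      have "2 * \<bar>B t \<omega>\<bar> * \<bar>B s \<omega>\<bar> \<le> \<bar>B t \<omega>\<bar>\<^sup>2 + \<bar>B s \<omega>\<bar>\<^sup>2" by (rule sum_squares_bound)
      moreover have "0 \<le> \<bar>B t \<omega>\<bar> * \<bar>B s \<omega>\<bar>" by simp
      ultimately have "\<bar>B t \<omega>\<bar> * \<bar>B s \<omega>\<bar> \<le> (B t \<omega>)\<^sup>2 + (B s \<omega>)\<^sup>2"
        unfolding power2_abs by linarith
      then show "norm (B t \<omega> * B s \<omega>) \<le> norm ((B t \<omega>)\<^sup>2 + (B s \<omega>)\<^sup>2)" by (simp add: abs_mult)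
    qed
  qed auto
  have eq: "(B t \<omega> - B s \<omega>)\<^sup>2 = (B t \<omega>)\<^sup>2 + (B s \<omega>)\<^sup>2 - 2 * (B t \<omega> * B s \<omega>)" for \<omega>
    by (simp add: power2_diff)
  show "(\<lambda>\<omega>. B t \<omega> - B s \<omega>) \<in> borel_measurable M" by measurable
  show "integrable M (\<lambda>\<omega>. (B t \<omega> - B s \<omega>)\<^sup>2)" unfolding eq using ip by simp
  show "(\<integral>\<omega>. (B t \<omega> - B s \<omega>)\<^sup>2 \<partial>M) = \<bar>t - s\<bar> powr (2 * H)"
    unfolding eq using ip st cov[of t s] by (simp add: sq)
  have "integrable M (B u)" if "0 < u" for u
    by (rule square_integrable_imp_integrable[OF gaussian_process_measurable[OF gp] isq[OF that]]) (use that in simp)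
  note this[OF st(1)] this[OF st(2)]
  then show "(\<integral>\<omega>. B t \<omega> - B s \<omega> \<partial>M) = 0"
    using mean[of s] mean[of t] st by simp
  show "gaussian_rv M (\<lambda>\<omega>. B t \<omega> - B s \<omega>)"
  proof (cases "s = t")
    case True
    then show ?thesis unfolding gaussian_rv_def by (auto intro!: exI[of _ 0])
  next
    case False
    have "finite {s, t} \<and> {s, t} \<subseteq> {0..}" using st by auto
    with gp have "gaussian_rv M (\<lambda>\<omega>. \<Sum>u\<in>{s, t}. (if u = t then 1 else -1) * B u \<omega>)"
      unfolding gaussian_process_def by (elim allE[of _ "{s, t}"] allE[of _ "\<lambda>u. if u = t then 1 else -1"]) blast
    moreover have "(\<lambda>\<omega>. \<Sum>u\<in>{s, t}. (if u = t then 1 else -1) * B u \<omega>) = (\<lambda>\<omega>. B t \<omega> - B s \<omega>)"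
      using False by (auto simp: fun_eq_iff)
    ultimately show ?thesis by simp
  qed
qed

text \<open>With \<open>r\<close> the standard deviation, the inequality of arithmetic and geometric
  means bounds the absolute value by its square over \<open>2 * r\<close> plus \<open>r / 2\<close>,
  whose mean is \<open>r\<close>.\<close>

lemma fbm_increment_nn_abs:
  assumes fbm: "fractional_brownian_motion M H B" and st: "0 < s" "0 < t"
  shows "(\<integral>\<^sup>+\<omega>. ennreal \<bar>B t \<omega> - B s \<omega>\<bar> \<partial>M) \<le> ennreal (\<bar>t - s\<bar> powr H)"
proof (cases "s = t")
  case False
  define r where "r = \<bar>t - s\<bar> powr H"
  have r: "0 < r" using False by (simp add: r_def)
  have r2: "\<bar>t - s\<bar> powr (2 * H) = r\<^sup>2"
    using False by (simp add: r_def power2_eq_square flip: powr_add)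
  have [measurable]: "(\<lambda>\<omega>. B t \<omega> - B s \<omega>) \<in> borel_measurable M" by (rule fbm_increment(1)[OF assms])
  have "(\<integral>\<^sup>+\<omega>. ennreal \<bar>B t \<omega> - B s \<omega>\<bar> \<partial>M) \<le> (\<integral>\<^sup>+\<omega>. ennreal ((B t \<omega> - B s \<omega>)\<^sup>2 / (2 * r) + r / 2) \<partial>M)"
  proof (intro nn_integral_mono ennreal_leI)
    fix \<omega>
    have "2 * \<bar>B t \<omega> - B s \<omega>\<bar> * r \<le> \<bar>B t \<omega> - B s \<omega>\<bar>\<^sup>2 + r\<^sup>2" by (rule sum_squares_bound)
    then show "\<bar>B t \<omega> - B s \<omega>\<bar> \<le> (B t \<omega> - B s \<omega>)\<^sup>2 / (2 * r) + r / 2"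
      using r by (simp add: field_simps power2_eq_square)
  qed
  also have "\<dots> = ennreal (\<integral>\<omega>. (B t \<omega> - B s \<omega>)\<^sup>2 / (2 * r) + r / 2 \<partial>M)"
    using fbm_increment(2)[OF assms] r by (intro nn_integral_eq_integral) auto
  also have "(\<integral>\<omega>. (B t \<omega> - B s \<omega>)\<^sup>2 / (2 * r) + r / 2 \<partial>M) = r"
    using fbm_increment(2,3)[OF assms] r by (simp add: r2 prob_space power2_eq_square)
  finally show ?thesis by (simp add: r_def)
qed simp

text \<open>The interval has length \<open>2 * z\<close>, and the normal density is at most
  \<open>1 / (2 * \<sigma>)\<close> because \<open>sqrt (2 * pi)\<close> is at least 2.\<close>

lemma fbm_small_ball:
  assumes fbm: "fractional_brownian_motion M H B" and st: "0 < s" "0 < t" "s \<noteq> t" and z: "0 \<le> z"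
  shows "prob {\<omega>\<in>space M. \<bar>B t \<omega> - B s \<omega>\<bar> \<le> z} \<le> z / \<bar>t - s\<bar> powr H"
proof -
  define X where "X = (\<lambda>\<omega>. B t \<omega> - B s \<omega>)"
  note inc = fbm_increment[OF fbm st(1,2), folded X_def]
  have [measurable]: "X \<in> borel_measurable M" by (rule inc)
  have sq: "(\<integral>\<omega>. (X \<omega>)\<^sup>2 \<partial>M) = \<bar>t - s\<bar> powr (2 * H)"
    using inc(3) by (simp add: X_def)
  obtain m where "(AE \<omega> in M. X \<omega> = m) \<or> (\<exists>\<sigma>>0. distributed M lborel X (\<lambda>x. ennreal (normal_density m \<sigma> x)))"
    using inc(5) unfolding gaussian_rv_def by blast
  then show ?thesis
  proof
    assume c: "AE \<omega> in M. X \<omega> = m"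
    \<comment> \<open>A degenerate law would sit at the mean 0, against the positive second
      moment.\<close>
    have "(\<integral>\<omega>. X \<omega> \<partial>M) = (\<integral>\<omega>. m \<partial>M)" using c by (intro integral_cong_AE) auto
    then have "m = 0" using inc(4) by (simp add: prob_space)
    then have "(\<integral>\<omega>. (X \<omega>)\<^sup>2 \<partial>M) = (\<integral>\<omega>. 0 \<partial>M)" using c by (intro integral_cong_AE) auto
    then show ?thesis using sq st by simp
  next
    assume "\<exists>\<sigma>>0. distributed M lborel X (\<lambda>x. ennreal (normal_density m \<sigma> x))"
    then obtain \<sigma> where \<sigma>: "0 < \<sigma>" and D: "distributed M lborel X (normal_density m \<sigma>)" by blast
    have "m = 0" using normal_distributed_expectation[OF \<sigma> D] inc(4) by simp
    moreover have "variance X = \<sigma>\<^sup>2" by (rule normal_distributed_variance[OF \<sigma> D])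
    ultimately have "\<sigma>\<^sup>2 = (\<bar>t - s\<bar> powr H)\<^sup>2"
      using sq inc(4) st by (simp add: power2_eq_square flip: powr_add)
    then have \<sigma>_eq: "\<sigma> = \<bar>t - s\<bar> powr H"
      using \<sigma> by (simp add: power2_eq_iff_nonneg)
    have dens: "normal_density m \<sigma> x \<le> 1 / (2 * \<sigma>)" for x
    proof -
      have "2 \<le> sqrt (2 * pi)" using pi_gt3 by (intro real_le_rsqrt) auto
      then have "2 * \<sigma> \<le> sqrt (2 * pi) * \<sigma>" using \<sigma> by (intro mult_right_mono) auto
      then have "1 / sqrt (2 * pi * \<sigma>\<^sup>2) \<le> 1 / (2 * \<sigma>)"
        using \<sigma> by (intro divide_left_mono) (auto simp: real_sqrt_mult)
      moreover have "normal_density m \<sigma> x \<le> 1 / sqrt (2 * pi * \<sigma>\<^sup>2) * 1"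
        unfolding normal_density_def using \<sigma> by (intro mult_left_mono) auto
      ultimately show ?thesis by simp
    qed
    have "{\<omega>\<in>space M. \<bar>X \<omega>\<bar> \<le> z} = X -` {-z..z} \<inter> space M" by auto
    then have "emeasure M {\<omega>\<in>space M. \<bar>X \<omega>\<bar> \<le> z} = (\<integral>\<^sup>+x. ennreal (normal_density m \<sigma> x) * indicator {-z..z} x \<partial>lborel)"
      using distributed_emeasure[OF D, of "{-z..z}"] by simp
    also have "\<dots> \<le> (\<integral>\<^sup>+x. ennreal (1 / (2 * \<sigma>)) * indicator {-z..z} x \<partial>lborel)"
      by (intro nn_integral_mono mult_right_mono ennreal_leI dens) auto
    also have "\<dots> = ennreal (1 / (2 * \<sigma>)) * ennreal (2 * z)"
      using z by (subst nn_integral_cmult_indicator) auto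
    also have "\<dots> = ennreal (z / \<sigma>)" using \<sigma> z by (subst ennreal_mult[symmetric]) auto
    finally have "ennreal (prob {\<omega>\<in>space M. \<bar>X \<omega>\<bar> \<le> z}) \<le> ennreal (z / \<sigma>)"
      by (simp add: emeasure_eq_measure)
    then show ?thesis using \<sigma> z by (simp add: \<sigma>_eq X_def)
  qed
qed

end

context prob_space begin

text \<open>Rounding time down to a multiple of \<open>1 / Suc n\<close> leaves countably many
  times, for which joint measurability is clear; continuity of the paths gives the limit.\<close>

lemma jointly_measurable_if_continuous:
  fixes X :: "real \<Rightarrow> 'a \<Rightarrow> real"
  assumes X: "\<And>t. X t \<in> borel_measurable M" and cont: "\<And>\<omega>. continuous_on UNIV (\<lambda>t. X t \<omega>)"
  shows "case_prod X \<in> borel_measurable (borel \<Otimes>\<^sub>M M)"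
proof (rule borel_measurable_LIMSEQ_real)
  show "(\<lambda>z. X (of_int \<lfloor>real (Suc n) * fst z\<rfloor> / real (Suc n)) (snd z)) \<in> borel_measurable (borel \<Otimes>\<^sub>M M)" for n
  proof (rule measurable_compose_countable[where g = "\<lambda>z. \<lfloor>real (Suc n) * fst z\<rfloor>" and f = "\<lambda>i z. X (of_int i / real (Suc n)) (snd z)"])
    show "(\<lambda>z. X (of_int i / real (Suc n)) (snd z)) \<in> borel_measurable (borel \<Otimes>\<^sub>M M)" for i
      using X by measurable
  qed measurable
next
  fix z :: "real \<times> 'a"
  have "(\<lambda>n. of_int \<lfloor>real (Suc n) * fst z\<rfloor> / real (Suc n)) \<longlonglongrightarrow> fst z"
  proof (rule tendsto_sandwich)
    show "\<forall>\<^sub>F n in sequentially. fst z - 1 / real (Suc n) \<le> of_int \<lfloor>real (Suc n) * fst z\<rfloor> / real (Suc n)"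
    proof (intro always_eventually allI)
      fix n
      have "real (Suc n) * fst z - 1 \<le> of_int \<lfloor>real (Suc n) * fst z\<rfloor>" by linarith
      then have "(real (Suc n) * fst z - 1) / real (Suc n) \<le> of_int \<lfloor>real (Suc n) * fst z\<rfloor> / real (Suc n)"
        by (intro divide_right_mono) auto
      then show "fst z - 1 / real (Suc n) \<le> of_int \<lfloor>real (Suc n) * fst z\<rfloor> / real (Suc n)"
        by (simp add: diff_divide_distrib del: of_nat_Suc)
    qed
    show "\<forall>\<^sub>F n in sequentially. of_int \<lfloor>real (Suc n) * fst z\<rfloor> / real (Suc n) \<le> fst z"
    proof (intro always_eventually allI)
      fix n
      have "of_int \<lfloor>real (Suc n) * fst z\<rfloor> / real (Suc n) \<le> (real (Suc n) * fst z) / real (Suc n)"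
        by (intro divide_right_mono) auto
      then show "of_int \<lfloor>real (Suc n) * fst z\<rfloor> / real (Suc n) \<le> fst z" by (simp del: of_nat_Suc)
    qed
    have "(\<lambda>n. 1 / real (Suc n)) \<longlonglongrightarrow> 0"
      using LIMSEQ_inverse_real_of_nat by (simp add: inverse_eq_divide)
    then have "(\<lambda>n. fst z - 1 / real (Suc n)) \<longlonglongrightarrow> fst z - 0" by (intro tendsto_diff tendsto_const)
    then show "(\<lambda>n. fst z - 1 / real (Suc n)) \<longlonglongrightarrow> fst z" by simp
  qed simp
  moreover have "isCont (\<lambda>t. X t (snd z)) (fst z)"
    using cont[of "snd z"] by (simp add: continuous_on_eq_continuous_at)
  ultimately show "(\<lambda>n. X (of_int \<lfloor>real (Suc n) * fst z\<rfloor> / real (Suc n)) (snd z)) \<longlonglongrightarrow> case_prod X z"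
    using isCont_tendsto_compose by (auto simp: split_beta')
qed

section \<open>Expected size of the singular integrals along a random path\<close>

context
  fixes X :: "real \<Rightarrow> 'a \<Rightarrow> real" and H \<alpha> :: real
  assumes X: "case_prod X \<in> borel_measurable (borel \<Otimes>\<^sub>M M)"
    and inc: "\<And>x u. 0 < x \<Longrightarrow> x \<le> 1 \<Longrightarrow> 0 < u \<Longrightarrow> u \<le> 1 \<Longrightarrow>
      (\<integral>\<^sup>+\<omega>. ennreal \<bar>X x \<omega> - X u \<omega>\<bar> \<partial>M) \<le> ennreal (\<bar>x - u\<bar> powr H)"
    and \<alpha>: "0 < \<alpha>" "\<alpha> < 1" and H: "0 < H" "0 < H + \<alpha> - 1"
begin

lemma X_compose:
  assumes "f \<in> measurable N borel" "h \<in> measurable N M"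
  shows "(\<lambda>z. X (f z) (h z)) \<in> borel_measurable N"
  using measurable_compose[OF measurable_Pair[OF assms] X] by simp

lemma right_abs_joint:
  "(\<lambda>(x, \<omega>). right_abs \<alpha> (\<lambda>t. X t \<omega>) x) \<in> borel_measurable (borel \<Otimes>\<^sub>M M)"
proof -
  note X_compose[measurable (raw)]
  have [measurable]: "(\<lambda>(z, u). ennreal (indicator {fst z<..<1::real} u * (\<bar>X (fst z) (snd z) - X u (snd z)\<bar> * (u - fst z) powr (\<alpha> - 2))))
      \<in> borel_measurable ((borel \<Otimes>\<^sub>M M) \<Otimes>\<^sub>M lborel)"
    unfolding greaterThanLessThan_def greaterThan_def lessThan_def indicator_def by measurable
  show ?thesis unfolding right_abs_def split_beta' by measurable
qed

text \<open>By Tonelli the mean increment replaces the path, and the singularity softens to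
  \<open>(u - x) powr (H + \<alpha> - 2)\<close>, which is integrable because H + \<alpha> exceeds
  1.\<close>

lemma nn_integral_right_abs_le:
  assumes x: "0 < x" "x < 1"
  shows "(\<integral>\<^sup>+\<omega>. right_abs \<alpha> (\<lambda>t. X t \<omega>) x \<partial>M) \<le> ennreal ((1 + 1 / (H + \<alpha> - 1)) * (1 - x) powr (H + \<alpha> - 1))"
proof -
  interpret pair_sigma_finite lborel M ..
  note X_compose[measurable (raw)] right_abs_joint[measurable]
  have scale: "(\<integral>\<^sup>+\<omega>. ennreal (\<bar>X x \<omega> - X u \<omega>\<bar> * c) \<partial>M) \<le> ennreal (\<bar>x - u\<bar> powr H * c)"
    if "0 \<le> c" "0 < u" "u \<le> 1" for c u
  proof -
    have "(\<integral>\<^sup>+\<omega>. ennreal (\<bar>X x \<omega> - X u \<omega>\<bar> * c) \<partial>M) = (\<integral>\<^sup>+\<omega>. ennreal \<bar>X x \<omega> - X u \<omega>\<bar> \<partial>M) * ennreal c"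
      using that by (subst nn_integral_multc[symmetric]) (auto simp: ennreal_mult)
    also have "\<dots> \<le> ennreal (\<bar>x - u\<bar> powr H) * ennreal c"
      using that x by (intro mult_right_mono inc) auto
    finally show ?thesis using that by (simp add: ennreal_mult)
  qed
  have m2[measurable]: "(\<lambda>(u, \<omega>). ennreal (indicator {x<..<1} u * (\<bar>X x \<omega> - X u \<omega>\<bar> * (u - x) powr (\<alpha> - 2)))) \<in> borel_measurable (lborel \<Otimes>\<^sub>M M)"
    unfolding greaterThanLessThan_def greaterThan_def lessThan_def indicator_def by measurable
  have "(\<integral>\<^sup>+\<omega>. \<integral>\<^sup>+u. ennreal (indicator {x<..<1} u * (\<bar>X x \<omega> - X u \<omega>\<bar> * (u - x) powr (\<alpha> - 2))) \<partial>lborel \<partial>M)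
     = (\<integral>\<^sup>+u. \<integral>\<^sup>+\<omega>. ennreal (indicator {x<..<1} u * (\<bar>X x \<omega> - X u \<omega>\<bar> * (u - x) powr (\<alpha> - 2))) \<partial>M \<partial>lborel)"
    by (rule Fubini'[OF m2])
  also have "\<dots> \<le> (\<integral>\<^sup>+u. ennreal (indicator {x<..<1} u * (u - x) powr (-(1 - (H + \<alpha> - 1)))) \<partial>lborel)"
  proof (intro nn_integral_mono)
    fix u
    show "(\<integral>\<^sup>+\<omega>. ennreal (indicator {x<..<1} u * (\<bar>X x \<omega> - X u \<omega>\<bar> * (u - x) powr (\<alpha> - 2))) \<partial>M)
        \<le> ennreal (indicator {x<..<1} u * (u - x) powr (-(1 - (H + \<alpha> - 1))))"
    proof (cases "x < u \<and> u < 1")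
      case True
      have "\<bar>x - u\<bar> powr H * (u - x) powr (\<alpha> - 2) = (u - x) powr (-(1 - (H + \<alpha> - 1)))"
        using True by (simp add: algebra_simps flip: powr_add)
      then show ?thesis using scale[of "(u - x) powr (\<alpha> - 2)" u] True x by simp
    qed auto
  qed
  also have "\<dots> = ennreal ((1 - x) powr (H + \<alpha> - 1) / (H + \<alpha> - 1))"
    using has_bochner_integral_powr_left[of "1 - (H + \<alpha> - 1)" x 1] x H
    by (subst nn_integral_eq_integral) (auto simp: has_bochner_integral_iff)
  finally have 2: "(\<integral>\<^sup>+\<omega>. \<integral>\<^sup>+u. ennreal (indicator {x<..<1} u * (\<bar>X x \<omega> - X u \<omega>\<bar> * (u - x) powr (\<alpha> - 2))) \<partial>lborel \<partial>M)
     \<le> ennreal ((1 - x) powr (H + \<alpha> - 1) / (H + \<alpha> - 1))" .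
  have 1: "(\<integral>\<^sup>+\<omega>. ennreal (\<bar>X x \<omega> - X 1 \<omega>\<bar> * (1 - x) powr (\<alpha> - 1)) \<partial>M) \<le> ennreal ((1 - x) powr (H + \<alpha> - 1))"
    using scale[of "(1 - x) powr (\<alpha> - 1)" 1] x by (simp add: algebra_simps flip: powr_add)
  have "(\<integral>\<^sup>+\<omega>. right_abs \<alpha> (\<lambda>t. X t \<omega>) x \<partial>M)
     = (\<integral>\<^sup>+\<omega>. ennreal (\<bar>X x \<omega> - X 1 \<omega>\<bar> * (1 - x) powr (\<alpha> - 1)) \<partial>M)
      + (\<integral>\<^sup>+\<omega>. \<integral>\<^sup>+u. ennreal (indicator {x<..<1} u * (\<bar>X x \<omega> - X u \<omega>\<bar> * (u - x) powr (\<alpha> - 2))) \<partial>lborel \<partial>M)"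
    unfolding right_abs_def by (rule nn_integral_add) measurable
  also have "\<dots> \<le> ennreal ((1 - x) powr (H + \<alpha> - 1)) + ennreal ((1 - x) powr (H + \<alpha> - 1) / (H + \<alpha> - 1))"
    by (rule add_mono[OF 1 2])
  also have "\<dots> = ennreal ((1 + 1 / (H + \<alpha> - 1)) * (1 - x) powr (H + \<alpha> - 1))"
    using H by (subst ennreal_plus[symmetric]) (auto simp: distrib_right)
  finally show ?thesis .
qed

lemma potential_measurable:
  "(\<lambda>\<omega>. potential \<alpha> (right_abs \<alpha> (\<lambda>t. X t \<omega>)) p) \<in> borel_measurable M"
proof -
  note right_abs_joint[measurable]
  have [measurable]: "(\<lambda>(\<omega>, x). right_abs \<alpha> (\<lambda>t. X t \<omega>) x) \<in> borel_measurable (M \<Otimes>\<^sub>M lborel)"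
    using measurable_compose[OF measurable_pair_swap' right_abs_joint] by (simp add: split_beta')
  show ?thesis unfolding potential_def by measurable
qed

text \<open>The mean of \<open>right_abs\<close> at \<open>x\<close> is largest at the left end; the
  exponents H + \<alpha> - 1 and 1 - \<alpha> then add up to \<open>H\<close>.\<close>

lemma nn_integral_potential_le:
  assumes p: "0 \<le> p" "p < 1"
  shows "(\<integral>\<^sup>+\<omega>. potential \<alpha> (right_abs \<alpha> (\<lambda>t. X t \<omega>)) p \<partial>M)
    \<le> ennreal ((1 + 1 / (H + \<alpha> - 1)) / (1 - \<alpha>) * (1 - p) powr H)"
proof -
  interpret pair_sigma_finite lborel M ..
  note X_compose[measurable (raw)] right_abs_joint[measurable]
  define A where "A = (1 + 1 / (H + \<alpha> - 1)) * (1 - p) powr (H + \<alpha> - 1)"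
  have A: "0 \<le> A" using H by (simp add: A_def)
  have m: "(\<lambda>(x, \<omega>). ennreal (indicator {p<..<1} x * (x - p) powr (-\<alpha>)) * right_abs \<alpha> (\<lambda>t. X t \<omega>) x) \<in> borel_measurable (lborel \<Otimes>\<^sub>M M)"
    by measurable
  have mx: "(\<lambda>\<omega>. right_abs \<alpha> (\<lambda>t. X t \<omega>) x) \<in> borel_measurable M" for x
    by measurable
  have "(\<integral>\<^sup>+\<omega>. potential \<alpha> (right_abs \<alpha> (\<lambda>t. X t \<omega>)) p \<partial>M)
     = (\<integral>\<^sup>+x. \<integral>\<^sup>+\<omega>. ennreal (indicator {p<..<1} x * (x - p) powr (-\<alpha>)) * right_abs \<alpha> (\<lambda>t. X t \<omega>) x \<partial>M \<partial>lborel)"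
    unfolding potential_def by (rule Fubini'[OF m])
  also have "\<dots> \<le> (\<integral>\<^sup>+x. ennreal (A * (indicator {p<..<1} x * (x - p) powr (-\<alpha>))) \<partial>lborel)"
  proof (intro nn_integral_mono)
    fix x
    show "(\<integral>\<^sup>+\<omega>. ennreal (indicator {p<..<1} x * (x - p) powr (-\<alpha>)) * right_abs \<alpha> (\<lambda>t. X t \<omega>) x \<partial>M)
      \<le> ennreal (A * (indicator {p<..<1} x * (x - p) powr (-\<alpha>)))"
    proof (cases "p < x \<and> x < 1")
      case True
      have "(1 + 1 / (H + \<alpha> - 1)) * (1 - x) powr (H + \<alpha> - 1) \<le> A"
        unfolding A_def using True p H by (intro mult_left_mono powr_mono2) auto
      then have "(\<integral>\<^sup>+\<omega>. right_abs \<alpha> (\<lambda>t. X t \<omega>) x \<partial>M) \<le> ennreal A"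
        using nn_integral_right_abs_le[of x] True p by (meson ennreal_leI order_trans le_less_trans)
      then have "ennreal ((x - p) powr (-\<alpha>)) * (\<integral>\<^sup>+\<omega>. right_abs \<alpha> (\<lambda>t. X t \<omega>) x \<partial>M) \<le> ennreal ((x - p) powr (-\<alpha>)) * ennreal A"
        by (intro mult_left_mono) auto
      then show ?thesis using True A by (simp add: nn_integral_cmult[OF mx] mult.commute flip: ennreal_mult)
    qed auto
  qed
  also have "\<dots> = ennreal (A * ((1 - p) powr (1 - \<alpha>) / (1 - \<alpha>)))"
    using has_bochner_integral_mult_right[OF has_bochner_integral_powr_left[of \<alpha> p 1], of A] \<alpha> p A
    by (subst nn_integral_eq_integral) (auto simp: has_bochner_integral_iff)
  also have "A * ((1 - p) powr (1 - \<alpha>) / (1 - \<alpha>)) = (1 + 1 / (H + \<alpha> - 1)) / (1 - \<alpha>) * (1 - p) powr H"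
  proof -
    have "(1 - p) powr (H + \<alpha> - 1) * (1 - p) powr (1 - \<alpha>) = (1 - p) powr H"
      by (simp flip: powr_add)
    then show ?thesis by (simp add: A_def mult_ac)
  qed
  finally show ?thesis .
qed

lemma quotient_mass_measurable:
  "(\<lambda>\<omega>. quotient_mass (\<lambda>t. X t \<omega>) p) \<in> borel_measurable M"
proof -
  note X_compose[measurable (raw)]
  show ?thesis unfolding quotient_mass_def by measurable
qed

text \<open>On average the difference quotient at \<open>p\<close> has size
  \<open>(x - p) powr (H - 1)\<close>, integrable since \<open>H\<close> is positive. So at a fixed
  time it is almost surely integrable along the path.\<close>

lemma nn_integral_quotient_mass_le:
  assumes p: "0 < p" "p < 1"
  shows "(\<integral>\<^sup>+\<omega>. quotient_mass (\<lambda>t. X t \<omega>) p \<partial>M) \<le> ennreal ((1 - p) powr H / H)"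
proof -
  interpret pair_sigma_finite lborel M ..
  note X_compose[measurable (raw)] right_abs_joint[measurable]
  have m: "(\<lambda>(x, \<omega>). ennreal (indicator {p<..<1} x * (\<bar>X x \<omega> - X p \<omega>\<bar> / (x - p)))) \<in> borel_measurable (lborel \<Otimes>\<^sub>M M)"
    by measurable
  have "(\<integral>\<^sup>+\<omega>. quotient_mass (\<lambda>t. X t \<omega>) p \<partial>M)
     = (\<integral>\<^sup>+x. \<integral>\<^sup>+\<omega>. ennreal (indicator {p<..<1} x * (\<bar>X x \<omega> - X p \<omega>\<bar> / (x - p))) \<partial>M \<partial>lborel)"
    unfolding quotient_mass_def by (rule Fubini'[OF m])
  also have "\<dots> \<le> (\<integral>\<^sup>+x. ennreal (indicator {p<..<1} x * (x - p) powr (-(1 - H))) \<partial>lborel)"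
  proof (intro nn_integral_mono)
    fix x
    show "(\<integral>\<^sup>+\<omega>. ennreal (indicator {p<..<1} x * (\<bar>X x \<omega> - X p \<omega>\<bar> / (x - p))) \<partial>M)
      \<le> ennreal (indicator {p<..<1} x * (x - p) powr (-(1 - H)))"
    proof (cases "p < x \<and> x < 1")
      case True
      have "(\<integral>\<^sup>+\<omega>. ennreal (\<bar>X x \<omega> - X p \<omega>\<bar> / (x - p)) \<partial>M) = (\<integral>\<^sup>+\<omega>. ennreal \<bar>X x \<omega> - X p \<omega>\<bar> \<partial>M) * ennreal (1 / (x - p))"
        using True by (subst nn_integral_multc[symmetric]) (auto simp flip: ennreal_mult)
      also have "\<dots> \<le> ennreal (\<bar>x - p\<bar> powr H) * ennreal (1 / (x - p))"
        using True p by (intro mult_right_mono inc) auto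
      also have "\<dots> = ennreal ((x - p) powr (-(1 - H)))"
        using True by (simp add: powr_diff flip: ennreal_mult)
      finally show ?thesis using True by simp
    qed auto
  qed
  also have "\<dots> = ennreal ((1 - p) powr H / H)"
    using has_bochner_integral_powr_left[of "1 - H" p 1] p H
    by (subst nn_integral_eq_integral) (auto simp: has_bochner_integral_iff)
  finally show ?thesis .
qed

end

text \<open>Markov's inequality and the first Borel-Cantelli lemma. All almost sure bounds that hold
  for large \<open>n\<close> and come from expectations are obtained from it.\<close>

lemma AE_eventually_le_1:
  fixes f :: "nat \<Rightarrow> 'a \<Rightarrow> ennreal"
  assumes [measurable]: "\<And>n. f n \<in> borel_measurable M"
    and le: "\<And>n. (\<integral>\<^sup>+\<omega>. f n \<omega> \<partial>M) \<le> ennreal (c n)" and c: "\<And>n. 0 \<le> c n" "summable c"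
  shows "AE \<omega> in M. eventually (\<lambda>n. f n \<omega> \<le> 1) sequentially"
proof -
  let ?A = "\<lambda>n. {\<omega>\<in>space M. 1 \<le> f n \<omega>}"
  have "AE \<omega> in M. eventually (\<lambda>n. \<omega> \<in> space M - ?A n) sequentially"
  proof (rule borel_cantelli_AE1)
    have "measure M (?A n) \<le> c n" for n
    proof -
      have "emeasure M (?A n) \<le> (\<integral>\<^sup>+\<omega>. f n \<omega> \<partial>M)"
        using nn_integral_Markov_inequality[of "f n" "space M" M 1] by (simp cong: nn_integral_cong)
      also have "\<dots> \<le> ennreal (c n)" by (rule le)
      finally show ?thesis using c by (simp add: emeasure_eq_measure)
    qed
    then show "summable (\<lambda>n. measure M (?A n))"
      using c by (intro summable_comparison_test'[OF c(2), of 0]) auto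
  qed (auto simp: less_top[symmetric])
  then show ?thesis
  proof eventually_elim
    case (elim \<omega>)
    then show ?case by eventually_elim auto
  qed
qed

end

section \<open>The replicating strategy\<close>

definition quad_var :: "(nat \<Rightarrow> real) \<Rightarrow> nat \<Rightarrow> real" where
  "quad_var x i = (\<Sum>j<i. (x (Suc j) - x j)\<^sup>2)"

text \<open>
  \<open>(x i)\<^sup>2 - quad_var x i\<close> is the gain of the unstopped strategy \<open>2 * x\<close>; it is stopped on reaching 1.
\<close>

definition strat :: "(nat \<Rightarrow> real) \<Rightarrow> nat \<Rightarrow> real" where
  "strat x i = (if \<forall>j\<in>{..i}. (x j)\<^sup>2 - quad_var x j < 1 then 2 * x i else 0)"

definition gain :: "(nat \<Rightarrow> real) \<Rightarrow> nat \<Rightarrow> real" where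
  "gain x m = (\<Sum>i<m. strat x i * (x (Suc i) - x i))"

lemma quad_var_mono: "i \<le> m \<Longrightarrow> quad_var x i \<le> quad_var x m"
  unfolding quad_var_def by (intro sum_mono2) auto

text \<open>Before stopping, the square of the path is below 1 plus a small quadratic variation, so
  twice the path stays below 3.\<close>

lemma strat_bound:
  assumes "quad_var x m \<le> 1 / 128" "i \<le> m"
  shows "\<bar>strat x i\<bar> \<le> 3"
proof (cases "\<forall>j\<in>{..i}. (x j)\<^sup>2 - quad_var x j < 1")
  case True
  then have "(x i)\<^sup>2 < 1 + quad_var x i" by force
  then have "(2 * \<bar>x i\<bar>)\<^sup>2 \<le> 3\<^sup>2"
    using quad_var_mono[OF assms(2), of x] assms(1) by (simp add: power_mult_distrib)
  then have "2 * \<bar>x i\<bar> \<le> 3" by (rule power2_le_imp_le) simp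
  then show ?thesis by (simp add: strat_def abs_mult)
qed (auto simp: strat_def)

text \<open>The bound 1/128 is made for the overshoot: before stopping the square of the path is at
  most 2, so path times step is at most 1/8 and a single step adds at most 1/4 to a gain below
  1.\<close>

lemma gain_near_1:
  assumes x0: "x 0 = 0" and qv: "quad_var x m \<le> 1 / 128" and xm: "2 \<le> (x m)\<^sup>2"
  shows "\<bar>gain x m - 1\<bar> \<le> 1 / 4"
proof -
  define U where "U = (\<lambda>i. (x i)\<^sup>2 - quad_var x i)"
  have qv0: "0 \<le> quad_var x i" for i unfolding quad_var_def by (intro sum_nonneg) auto
  \<comment> \<open>Either level 1 was not reached strictly before \<open>i\<close> and the gain is
    still \<open>U i\<close>, or it was reached and the gain is frozen. The first case includes the
    index of the crossing itself, hence its bound 5/4.\<close>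
  have "i \<le> m \<Longrightarrow> ((\<forall>j<i. U j < 1) \<and> gain x i = U i \<and> U i \<le> 5 / 4)
      \<or> ((\<exists>j<i. 1 \<le> U j) \<and> 1 \<le> gain x i \<and> gain x i \<le> 5 / 4)" for i
  proof (induction i)
    case 0
    then show ?case by (simp add: U_def gain_def quad_var_def x0)
  next
    case (Suc i)
    let ?d = "x (Suc i) - x i"
    have step: "U (Suc i) = U i + 2 * x i * ?d"
      by (simp add: U_def quad_var_def power2_eq_square algebra_simps)
    have gain: "gain x (Suc i) = gain x i + strat x i * ?d" by (simp add: gain_def)
    show ?case
    proof (cases "\<forall>j\<le>i. U j < 1")
      case True
      then have "\<not> (\<exists>j<i. 1 \<le> U j)" by (auto simp: not_le)
      then have IH: "gain x i = U i" using Suc.IH Suc.prems by auto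
      have "U i < 1" using True by simp
      have "strat x i = 2 * x i" using True by (auto simp: strat_def U_def)
      then have g: "gain x (Suc i) = U (Suc i)" unfolding gain step IH by simp
      have "?d\<^sup>2 \<le> quad_var x (Suc i)" by (simp add: quad_var_def sum_nonneg)
      then have d: "?d\<^sup>2 \<le> 1 / 128" using quad_var_mono[OF Suc.prems, of x] qv by simp
      have "(x i)\<^sup>2 \<le> 2" using \<open>U i < 1\<close> quad_var_mono[of i m x] Suc.prems qv by (simp add: U_def)
      then have "(x i)\<^sup>2 * ?d\<^sup>2 \<le> 2 * (1 / 128)" using d by (intro mult_mono) auto
      then have "(x i * ?d)\<^sup>2 \<le> (1 / 8)\<^sup>2" unfolding power_mult_distrib by (simp add: power_divide)
      then have "x i * ?d \<le> 1 / 8" by (rule power2_le_imp_le) simp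
      then have "U (Suc i) \<le> 5 / 4" using \<open>U i < 1\<close> unfolding step by simp
      then show ?thesis using True g by (auto simp: less_Suc_eq_le)
    next
      case False
      then have "\<not> (\<forall>j\<in>{..i}. (x j)\<^sup>2 - quad_var x j < 1)" by (auto simp: U_def)
      then have "strat x i = 0" unfolding strat_def by (rule if_not_P)
      then have g: "gain x (Suc i) = gain x i" by (simp add: gain)
      obtain j where j: "j \<le> i" "1 \<le> U j" using False by (auto simp: not_less)
      have "1 \<le> gain x i \<and> gain x i \<le> 5 / 4"
      proof (cases "j = i")
        case True
        then show ?thesis using Suc.IH Suc.prems j by auto
      next
        case False
        then have "\<not> (\<forall>j<i. U j < 1)" using j by (auto simp: not_less intro!: exI[of _ j])
        then show ?thesis using Suc.IH Suc.prems by auto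
      qed
      then show ?thesis using j g by (auto simp: less_Suc_eq_le)
    qed
  qed
  \<comment> \<open>The first case is impossible at \<open>m\<close>, since \<open>U m\<close> is at
    least 2 - 1/128, which exceeds 5/4.\<close>
  from this[of m] show ?thesis
    using qv xm by (auto simp: U_def)
qed

text \<open>\<open>z n\<close> is the target at the start of block \<open>n\<close> and
  \<open>G n\<close> the gain of the block per unit bet; the whole shortfall is bet, so
  \<open>G n = 1\<close> would hit the target \<open>z n\<close> exactly.\<close>

fun wealth :: "(nat \<Rightarrow> real) \<Rightarrow> (nat \<Rightarrow> real) \<Rightarrow> nat \<Rightarrow> real" where
  "wealth z G 0 = 0"
| "wealth z G (Suc n) = wealth z G n + (z n - wealth z G n) * G n"

text \<open>The new shortfall is the movement of the target plus the old shortfall times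
  \<open>1 - G n\<close>, a factor of at most 1/4 in absolute value.\<close>

lemma wealth_error:
  assumes G: "\<forall>\<^sub>F n in sequentially. \<bar>G n - 1\<bar> \<le> 1 / 4"
    and z: "\<And>n. \<bar>z (Suc n) - z n\<bar> \<le> K * (1 / 2) ^ n"
  obtains L where "\<forall>\<^sub>F n in sequentially. \<bar>z n - wealth z G n\<bar> \<le> L * (1 / 2) ^ n" "0 \<le> L"
proof -
  obtain N where N: "\<And>n. N \<le> n \<Longrightarrow> \<bar>G n - 1\<bar> \<le> 1 / 4"
    using G by (auto simp: eventually_sequentially)
  define R where "R = (\<lambda>n. z n - wealth z G n)"
  \<comment> \<open>The entry \<open>4 * K\<close> makes each of the two contributions at most a
    quarter of \<open>L * (1 / 2) ^ n\<close>, together \<open>L * (1 / 2) ^ Suc n\<close>. The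
    other entry starts the induction at \<open>N\<close>.\<close>
  define L where "L = max (4 * K) (2 ^ N * \<bar>R N\<bar>)"
  have "\<bar>R n\<bar> \<le> L * (1 / 2) ^ n" if "N \<le> n" for n
    using that
  proof (induction n rule: dec_induct)
    case base
    have "2 ^ N * \<bar>R N\<bar> * (1 / 2) ^ N \<le> L * (1 / 2) ^ N"
      by (intro mult_right_mono) (auto simp: L_def)
    then show ?case by (simp add: power_divide)
  next
    case (step n)
    have "R (Suc n) = (z (Suc n) - z n) + R n * (1 - G n)"
      by (simp add: R_def algebra_simps)
    then have "\<bar>R (Suc n)\<bar> \<le> \<bar>z (Suc n) - z n\<bar> + \<bar>R n\<bar> * \<bar>1 - G n\<bar>"
      by (simp add: abs_mult[symmetric])
    also have "\<dots> \<le> K * (1 / 2) ^ n + (L * (1 / 2) ^ n) * (1 / 4)"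
      using step.IH N[OF step.hyps(1)] z[of n] by (intro add_mono mult_mono) (auto simp: abs_minus_commute)
    also have "\<dots> \<le> (L / 4) * (1 / 2) ^ n + (L * (1 / 2) ^ n) * (1 / 4)"
      by (intro add_mono mult_right_mono) (auto simp: L_def)
    also have "\<dots> = L * (1 / 2) ^ Suc n" by simp
    finally show ?case .
  qed
  moreover have "0 \<le> L" by (simp add: L_def le_max_iff_disj)
  ultimately show ?thesis
    by (intro that[of L]) (auto simp: eventually_sequentially R_def)
qed

text \<open>
  Doubly exponential gaps turn the logarithmic rate of \<open>Z\<close> into the geometric rate \<open>(1 / 2) ^ n\<close>.
\<close>

definition gap :: "nat \<Rightarrow> real" where
  "gap n = exp (- (2 ^ n))"

definition mesh :: "nat \<Rightarrow> nat \<Rightarrow> nat" where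
  "mesh p n = Suc n ^ p"

text \<open>Ending the block half way keeps all its nodes at distance between
  \<open>gap n / 2\<close> and \<open>gap n\<close> from time 1, so one power of
  \<open>gap n\<close> and one logarithm describe the cost of all of them.\<close>

definition node :: "nat \<Rightarrow> nat \<Rightarrow> nat \<Rightarrow> real" where
  "node p n i = 1 - gap n + gap n / 2 * (real i / real (mesh p n))"

text \<open>The denominator is the standard deviation of the increment of \<open>B\<close> over the
  whole block. The square in the numerator makes the probability of a small rescaled increment of
  order \<open>1 / (Suc n) ^ 2\<close>, a summable bound.\<close>

definition leverage :: "real \<Rightarrow> nat \<Rightarrow> real" where
  "leverage H n = (real (Suc n))\<^sup>2 / (gap n / 2) powr H"

section \<open>Elementary properties of the time grid\<close>

lemma gap_pos: "0 < gap n" by (simp add: gap_def)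

lemma gap_le_exp: "gap n \<le> exp (-1)"
  by (simp add: gap_def)

lemma gap_le_half: "gap n \<le> 1 / 2"
proof -
  have "exp (-1) \<le> (1 / 2 :: real)"
    using exp_ge_add_one_self[of 1] by (simp add: exp_minus field_simps)
  then show ?thesis using gap_le_exp[of n] by simp
qed

lemma gap_Suc: "gap (Suc n) = gap n * gap n"
  by (simp add: gap_def flip: exp_add)

lemma gap_Suc_le: "gap (Suc n) \<le> gap n / 2"
  using mult_left_mono[OF gap_le_half, of "gap n" n] gap_pos[of n] by (simp add: gap_Suc)

lemma gap_tendsto: "gap \<longlonglongrightarrow> 0"
proof (rule tendsto_sandwich[where f = "\<lambda>_. 0" and h = "\<lambda>n. (1 / 2) ^ n"])
  show "(\<lambda>n. (1 / 2) ^ n) \<longlonglongrightarrow> (0 :: real)" by (simp add: LIMSEQ_realpow_zero)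
  have "gap n \<le> (1 / 2) ^ n" for n
  proof (induction n)
    case 0 then show ?case using gap_le_half[of 0] by simp
  next
    case (Suc n) then show ?case using gap_Suc_le[of n] by simp
  qed
  then show "\<forall>\<^sub>F n in sequentially. gap n \<le> (1 / 2) ^ n" by simp
qed (auto simp: gap_pos less_imp_le)

lemma mesh_pos: "0 < mesh p n" by (simp add: mesh_def)

lemma node_0: "node p n 0 = 1 - gap n" by (simp add: node_def)

lemma node_mesh: "node p n (mesh p n) = 1 - gap n / 2"
  using mesh_pos[of p n] by (simp add: node_def)

lemma node_mono: "i \<le> j \<Longrightarrow> node p n i \<le> node p n j"
  using gap_pos[of n] by (simp add: node_def divide_right_mono mult_left_mono)

lemma node_Suc_diff: "node p n (Suc i) - node p n i = gap n / 2 / real (mesh p n)"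
  by (simp add: node_def add_divide_distrib algebra_simps)

lemma node_bounds:
  assumes "i \<le> mesh p n"
  shows "1 - gap n \<le> node p n i" "node p n i \<le> 1 - gap n / 2" "0 < node p n i" "node p n i < 1"
  using node_mono[of 0 i p n] node_mono[OF assms, of p n] gap_pos[of n] gap_le_half[of n]
  by (auto simp: node_0 node_mesh)

text \<open>Block \<open>n\<close> is over when block \<open>n + 1\<close> starts, so its gain is
  known when the next shortfall is computed.\<close>

lemma node_le_next: "i \<le> mesh p n \<Longrightarrow> node p n i \<le> node p (Suc n) 0"
  using node_bounds(2)[of i p n] gap_Suc_le[of n] by (simp add: node_0)

lemma leverage_pos: "0 < leverage H n"
  using gap_pos[of n] by (simp add: leverage_def)

text \<open>The leverage meets the cost of a jump: the powers of \<open>gap n\<close> cancel and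
  only a polynomial in \<open>n\<close> survives.\<close>

lemma leverage_gap: "leverage H n * gap n powr H = 2 powr H * (real (Suc n))\<^sup>2"
  using gap_pos[of n] by (simp add: leverage_def powr_divide)

lemma abs_ln_node:
  assumes "i \<le> mesh p n"
  shows "\<bar>ln (1 - node p n i)\<bar> \<le> 2 * 2 ^ n"
proof -
  have "ln (gap n / 2) \<le> ln (1 - node p n i)"
    using node_bounds[OF assms] gap_pos[of n] by (subst ln_le_cancel_iff) auto
  moreover have "ln (gap n / 2) = - (2 ^ n) - ln 2" using gap_pos[of n] by (subst ln_div) (auto simp: gap_def)
  moreover have "ln 2 \<le> (2 - 1 :: real)" by (rule ln_le_minus_one) simp
  moreover have "(1::real) \<le> 2 ^ n" by simp
  moreover have "ln (1 - node p n i) < 0" using node_bounds[OF assms] by simp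
  ultimately show ?thesis by linarith
qed

lemma potential_node_le:
  fixes H \<alpha> \<mu> :: real
  assumes \<alpha>: "0 < \<alpha>" "\<alpha> < 1" and H: "0 < H" "0 < H + \<alpha> - 1" and \<mu>: "0 \<le> \<mu>" "\<mu> \<le> 1" and i: "i \<le> mesh p n"
  shows "potential \<alpha> (\<lambda>x. ennreal (frac_weight H \<alpha> \<mu> x)) (node p n i)
    \<le> ennreal ((1 + 1 / (H + \<alpha> - 1)) / (1 - \<alpha>) * (gap n powr H * (2 * 2 ^ n) powr \<mu>))"
proof -
  note b = node_bounds[OF i]
  have "potential \<alpha> (\<lambda>x. ennreal (frac_weight H \<alpha> \<mu> x)) (node p n i)
    \<le> ennreal ((1 + 1 / (H + \<alpha> - 1)) / (1 - \<alpha>) * ((1 - node p n i) powr H * \<bar>ln (1 - node p n i)\<bar> powr \<mu>))"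
    using b gap_le_exp[of n] by (intro potential_frac_weight_le[OF \<alpha> H(2) \<mu>]) auto
  also have "\<dots> \<le> ennreal ((1 + 1 / (H + \<alpha> - 1)) / (1 - \<alpha>) * (gap n powr H * (2 * 2 ^ n) powr \<mu>))"
    using b abs_ln_node[OF i] \<alpha> H \<mu> by (intro ennreal_leI mult_left_mono mult_mono powr_mono2) auto
  finally show ?thesis .
qed

lemma summable_polynomial_geometric:
  fixes r :: real
  assumes "0 < r" "r < 1"
  shows "summable (\<lambda>n. real (Suc n) ^ k * r ^ n)"
proof -
  have "(\<lambda>n. 1 / real (Suc n)) \<longlonglongrightarrow> 0"
    using LIMSEQ_inverse_real_of_nat by (simp add: inverse_eq_divide)
  then have "(\<lambda>n. (1 + 1 / real (Suc n)) ^ k * r) \<longlonglongrightarrow> (1 + 0) ^ k * r"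
    by (intro tendsto_intros)
  then have "\<forall>\<^sub>F n in sequentially. (1 + 1 / real (Suc n)) ^ k * r < (r + 1) / 2"
    using assms by (intro order_tendstoD) auto
  then obtain N where N: "\<And>n. N \<le> n \<Longrightarrow> (1 + 1 / real (Suc n)) ^ k * r < (r + 1) / 2"
    by (auto simp: eventually_sequentially)
  show ?thesis
  proof (rule summable_ratio_test)
    show "(r + 1) / 2 < 1" using assms by simp
    fix n assume "N \<le> n"
    have e: "real (Suc (Suc n)) = (1 + 1 / real (Suc n)) * real (Suc n)" by (simp add: field_simps)
    have "real (Suc (Suc n)) ^ k * r ^ Suc n = ((1 + 1 / real (Suc n)) ^ k * r) * (real (Suc n) ^ k * r ^ n)"
      unfolding e power_mult_distrib by simp
    also have "\<dots> \<le> (r + 1) / 2 * (real (Suc n) ^ k * r ^ n)"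
      using N[OF \<open>N \<le> n\<close>] assms by (intro mult_right_mono) auto
    finally show "norm (real (Suc (Suc n)) ^ k * r ^ Suc n) \<le> (r + 1) / 2 * norm (real (Suc n) ^ k * r ^ n)"
      using assms by (simp del: of_nat_Suc)
  qed
qed

text \<open>
  The polynomial losses are absorbed because the exponent \<open>3/4\<close> of the logarithmic weight is smaller
  than 1, the guaranteed decay rate of the error on the grid.
\<close>

lemma step_integrand_ext_bounded:
  fixes H \<alpha> :: real and R :: "nat \<Rightarrow> real" and h :: "nat \<Rightarrow> nat \<Rightarrow> real"
  assumes \<alpha>: "0 < \<alpha>" "\<alpha> < 1" and H: "0 < H" "0 < H + \<alpha> - 1"
    and g: "g \<in> borel_measurable borel"
    and Yfin: "\<And>n i. i \<le> mesh p n \<Longrightarrow> potential \<alpha> (right_abs \<alpha> g) (node p n i) < \<infinity>"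
    and Qfin: "\<And>n i. i \<le> mesh p n \<Longrightarrow> quotient_mass g (node p n i) < \<infinity>"
    and Y: "\<forall>\<^sub>F n in sequentially. (\<Sum>i\<le>mesh p n. potential \<alpha> (right_abs \<alpha> g) (node p n i))
        \<le> ennreal (C * (real (Suc n) ^ (p + 2) * gap n powr H))"
    and C: "0 \<le> C" and L: "0 \<le> L"
    and R: "\<forall>\<^sub>F n in sequentially. \<bar>R n\<bar> \<le> L * (1 / 2) ^ n"
    and h: "\<forall>\<^sub>F n in sequentially. \<forall>i<mesh p n. \<bar>h n i\<bar> \<le> 3"
    and V: "(\<lambda>n. \<Sum>i<mesh p n. R n * leverage H n * h n i * (g (node p n (Suc i)) - g (node p n i))) sums V"
  shows "\<exists>K. ext_bounded H \<alpha> (3/4) g (\<lambda>t. \<Sum>n. \<Sum>i<mesh p n. R n * leverage H n * h n i *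
           (indicator {node p n i<..} t - indicator {node p n (Suc i)<..} t)) V K"
proof -
  define W where "W = (\<lambda>q. potential \<alpha> (\<lambda>x. ennreal (frac_weight H \<alpha> (3/4) x)) q)"
  define Z where "Z = (\<lambda>q. potential \<alpha> (right_abs \<alpha> g) q)"
  define k where "k = (\<lambda>q. enn2real (W q) / Gamma (1 - \<alpha>) + enn2real (Z q) / (Gamma (1 - \<alpha>) * Gamma \<alpha>))"
  have Gp: "0 < Gamma \<alpha>" "0 < Gamma (1 - \<alpha>)" using \<alpha> by auto
  have k_nn: "0 \<le> k q" for q using Gp by (simp add: k_def)
  define CW where "CW = (1 + 1 / (H + \<alpha> - 1)) / (1 - \<alpha>)"
  have CW: "0 \<le> CW" using \<alpha> H by (simp add: CW_def)
  have W: "W (node p n i) \<le> ennreal (CW * (gap n powr H * (2 * 2 ^ n) powr (3/4)))" if "i \<le> mesh p n" for n i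
    unfolding W_def CW_def using that by (intro potential_node_le[OF \<alpha> H]) auto
  have Wfin: "W (node p n i) < \<infinity>" if "i \<le> mesh p n" for n i
    using W[OF that] by (simp add: le_less_trans)
  have heav: "ext_bounded H \<alpha> (3/4) g (indicator {node p n i<..}) (g 1 - g (node p n i)) (k (node p n i))"
    if "i \<le> mesh p n" for n i
    unfolding k_def W_def Z_def
    using node_bounds[OF that] Yfin[OF that] Qfin[OF that] Wfin[OF that]
    by (intro ext_bounded_heaviside[OF \<alpha> _ _ g]) (auto simp: W_def)
  \<comment> \<open>A constant position on one grid interval is a difference of two jumps and is
    charged for both.\<close>
  define K where "K = (\<lambda>n. \<Sum>i<mesh p n. \<bar>R n * leverage H n * h n i\<bar> * (k (node p n i) + k (node p n (Suc i))))"
  have block: "ext_bounded H \<alpha> (3/4) g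
      (\<lambda>t. \<Sum>i<mesh p n. R n * leverage H n * h n i * (indicator {node p n i<..} t - indicator {node p n (Suc i)<..} t))
      (\<Sum>i<mesh p n. R n * leverage H n * h n i * (g (node p n (Suc i)) - g (node p n i))) (K n)" for n
    unfolding K_def
  proof (rule ext_bounded_sum)
    fix i assume "i \<in> {..<mesh p n}"
    then have "i \<le> mesh p n" "Suc i \<le> mesh p n" by auto
    from ext_bounded_lincomb[OF heav[OF this(1)] heav[OF this(2)], of 1 "-1"]
    show "ext_bounded H \<alpha> (3/4) g (\<lambda>t. indicator {node p n i<..} t - indicator {node p n (Suc i)<..} t)
        (g (node p n (Suc i)) - g (node p n i)) (k (node p n i) + k (node p n (Suc i)))"
      by simp
  qed simp
  define D where "D = 6 * L * 2 powr H * (2 * CW * 2 powr (3/4) / Gamma (1 - \<alpha>) + C / (Gamma (1 - \<alpha>) * Gamma \<alpha>))"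
  have "\<forall>\<^sub>F n in sequentially. norm (K n) \<le> D * (real (Suc n) ^ (p + 4) * ((1/2) powr (1/4)) ^ n)"
    using Y R h
  proof eventually_elim
    case (elim n)
    let ?m = "mesh p n"
    let ?N = "real (Suc n)"
    have N1: "1 \<le> ?N" by simp
    have sumk: "(\<Sum>i\<le>?m. k (node p n i)) \<le> (2 * CW * 2 powr (3/4) / Gamma (1 - \<alpha>) + C / (Gamma (1 - \<alpha>) * Gamma \<alpha>))
        * (?N ^ (p + 2) * gap n powr H * (2 powr (3/4)) ^ n)" (is "_ \<le> (?A + ?B) * ?T")
    proof -
      have two: "(2 * 2 ^ n :: real) powr (3/4) = 2 powr (3/4) * (2 powr (3/4)) ^ n"
        by (simp add: powr_mult powr_powr powr_realpow[symmetric] mult.commute)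
      have pw: "1 \<le> (2 powr (3/4) :: real) ^ n" by (intro one_le_power ge_one_powr_ge_zero) auto
      have "enn2real (W (node p n i)) \<le> CW * (gap n powr H * (2 * 2 ^ n) powr (3/4))" if "i \<le> ?m" for i
        using W[OF that] CW by (intro enn2real_leI) auto
      then have "(\<Sum>i\<le>?m. enn2real (W (node p n i))) \<le> (\<Sum>i\<le>?m. CW * (gap n powr H * (2 * 2 ^ n) powr (3/4)))"
        by (intro sum_mono) auto
      also have "\<dots> = (real ?m + 1) * (CW * 2 powr (3/4) * (gap n powr H * (2 powr (3/4)) ^ n))"
        by (simp add: two mult_ac)
      also have "\<dots> \<le> (2 * ?N ^ (p + 2)) * (CW * 2 powr (3/4) * (gap n powr H * (2 powr (3/4)) ^ n))"
      proof (intro mult_right_mono)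
        \<comment> \<open>Generous by two powers of \<open>?N\<close>, so that both kinds of cost
          share the factor \<open>?T\<close>.\<close>
        have "real ?m \<le> ?N ^ (p + 2)" unfolding mesh_def of_nat_power by (intro power_increasing N1) auto
        moreover have "1 \<le> ?N ^ (p + 2)" by (intro one_le_power N1)
        ultimately show "real ?m + 1 \<le> 2 * ?N ^ (p + 2)" by linarith
      qed (use CW in auto)
      finally have "(\<Sum>i\<le>?m. enn2real (W (node p n i))) / Gamma (1 - \<alpha>) \<le> (2 * CW * 2 powr (3/4) * ?T) / Gamma (1 - \<alpha>)"
        using Gp by (intro divide_right_mono) (auto simp: mult_ac)
      moreover have "(\<Sum>i\<le>?m. enn2real (Z (node p n i))) / (Gamma (1 - \<alpha>) * Gamma \<alpha>) \<le> (C * ?T) / (Gamma (1 - \<alpha>) * Gamma \<alpha>)"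
      proof (intro divide_right_mono)
        have "(\<Sum>i\<le>?m. enn2real (Z (node p n i))) = enn2real (\<Sum>i\<le>?m. Z (node p n i))"
          using Yfin[of _ n] by (subst enn2real_sum) (auto simp: Z_def)
        also have "\<dots> \<le> C * (?N ^ (p + 2) * gap n powr H)"
          using elim(1) C by (intro enn2real_leI) (auto simp: Z_def)
        also have "\<dots> \<le> C * ?T"
          using C pw mult_left_mono[OF pw, of "?N ^ (p + 2) * gap n powr H"] by (intro mult_left_mono) auto
        finally show "(\<Sum>i\<le>?m. enn2real (Z (node p n i))) \<le> C * ?T" .
      qed (use Gp in auto)
      moreover have "(\<Sum>i\<le>?m. k (node p n i)) = (\<Sum>i\<le>?m. enn2real (W (node p n i))) / Gamma (1 - \<alpha>)
          + (\<Sum>i\<le>?m. enn2real (Z (node p n i))) / (Gamma (1 - \<alpha>) * Gamma \<alpha>)"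
        by (simp add: k_def sum.distrib sum_divide_distrib)
      ultimately show ?thesis by (simp add: distrib_right)
    qed
    \<comment> \<open>Stated for arbitrary reals, so that the rearrangement is pure algebra in which
      no power gets rewritten.\<close>
    have gen1: "(l * e * v * 3) * (S * (N * G * w) + S * (N * G * w)) = 6 * l * S * (v * G) * (N * (e * w))"
      for l e v S N G w :: real by (simp add: algebra_simps)
    have gen2: "6 * l * S * (q * N\<^sup>2) * (N ^ (p + 2) * w) = 6 * l * q * S * (N ^ (p + 4) * w)"
      for l S q N w :: real by (simp add: power_add power2_eq_square power4_eq_xxxx)
    have lev: "0 < leverage H n" by (rule leverage_pos)
    have "K n \<le> (\<Sum>i<?m. (L * (1/2) ^ n * leverage H n * 3) * (k (node p n i) + k (node p n (Suc i))))"
      unfolding K_def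
    proof (intro sum_mono mult_right_mono)
      fix i assume "i \<in> {..<?m}"
      then show "\<bar>R n * leverage H n * h n i\<bar> \<le> L * (1/2) ^ n * leverage H n * 3"
        unfolding abs_mult using elim(2,3) lev L by (intro mult_mono) auto
    qed (use k_nn in auto)
    also have "\<dots> = (L * (1/2) ^ n * leverage H n * 3) * ((\<Sum>i<?m. k (node p n i)) + (\<Sum>i<?m. k (node p n (Suc i))))"
      by (simp only: sum_distrib_left sum.distrib distrib_left)
    also have "\<dots> \<le> (L * (1/2) ^ n * leverage H n * 3) * ((\<Sum>i\<le>?m. k (node p n i)) + (\<Sum>i\<le>?m. k (node p n i)))"
    proof (intro mult_left_mono add_mono)
      show "(\<Sum>i<?m. k (node p n i)) \<le> (\<Sum>i\<le>?m. k (node p n i))"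
        using k_nn by (intro sum_mono2) auto
      have "(\<Sum>i\<le>?m. k (node p n i)) = k (node p n 0) + (\<Sum>i<?m. k (node p n (Suc i)))"
        by (rule sum.atMost_shift)
      then show "(\<Sum>i<?m. k (node p n (Suc i))) \<le> (\<Sum>i\<le>?m. k (node p n i))"
        using k_nn[of "node p n 0"] by simp
    qed (use L lev in auto)
    also have "\<dots> \<le> (L * (1/2) ^ n * leverage H n * 3) * ((?A + ?B) * ?T + (?A + ?B) * ?T)"
      using sumk L lev by (intro mult_left_mono add_mono) auto
    also have "\<dots> = 6 * L * (?A + ?B) * (leverage H n * gap n powr H) * (?N ^ (p + 2) * ((1/2) ^ n * (2 powr (3/4)) ^ n))"
      by (rule gen1)
    also have "\<dots> = D * (?N ^ (p + 4) * ((1/2) ^ n * (2 powr (3/4)) ^ n))"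
      unfolding leverage_gap D_def by (rule gen2)
    also have "(1/2 :: real) ^ n * (2 powr (3/4)) ^ n = ((1/2) powr (1/4)) ^ n"
    proof -
      have "(1/2 :: real) powr (1/4) = inverse (2 powr (1/4))"
        unfolding inverse_eq_divide[symmetric] by (rule inverse_powr)
      also have "\<dots> = 2 powr (-(1/4))" by (rule powr_minus[symmetric])
      also have "-(1/4 :: real) = 3/4 - 1" by simp
      also have "(2 :: real) powr (3/4 - 1) = 2 powr (3/4) / 2 powr 1" by (rule powr_diff)
      also have "(2 :: real) powr 1 = 2" by (rule powr_one) simp
      finally have "(1/2) * 2 powr (3/4) = (1/2 :: real) powr (1/4)"
        by (simp only: times_divide_eq_left mult_1)
      then show ?thesis by (simp only: power_mult_distrib[symmetric])
    qed
    finally show ?case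
      using k_nn by (simp add: K_def sum_nonneg)
  qed
  moreover have "summable (\<lambda>n. D * (real (Suc n) ^ (p + 4) * ((1/2) powr (1/4)) ^ n))"
  proof (intro summable_mult summable_polynomial_geometric)
    have "(1/2 :: real) powr (1/4) < 1 powr (1/4)" by (rule powr_less_mono2) auto
    then show "(1/2 :: real) powr (1/4) < 1" by (simp only: powr_one_eq_one)
    show "0 < (1/2 :: real) powr (1/4)" by simp
  qed
  ultimately have "summable K" by (rule summable_comparison_test_ev)
  then have "ext_bounded H \<alpha> (3/4) g (\<lambda>t. \<Sum>n. \<Sum>i<mesh p n. R n * leverage H n * h n i *
           (indicator {node p n i<..} t - indicator {node p n (Suc i)<..} t)) V (ext_norm H \<alpha> (3/4) g (\<lambda>t. \<Sum>n. \<Sum>i<mesh p n. R n * leverage H n * h n i *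
           (indicator {node p n i<..} t - indicator {node p n (Suc i)<..} t)))"
  proof (rule ext_bounded_suminf[OF block])
    fix n u assume u: "u \<le> 1 - gap n"
    have "\<not> node p n i < u" for i using node_mono[of 0 i p n] u by (simp add: node_0)
    then show "(\<Sum>i<mesh p n. R n * leverage H n * h n i * (indicator {node p n i<..} u - indicator {node p n (Suc i)<..} u)) = 0"
      by (intro sum.neutral) (simp add: indicator_def)
  next
    have "(\<lambda>n. 1 - gap n) \<longlonglongrightarrow> 1 - 0" by (intro tendsto_intros gap_tendsto)
    then show "(\<lambda>n. 1 - gap n) \<longlonglongrightarrow> 1" by simp
  qed (rule V)
  then show ?thesis by blast
qed

lemma weyl_right_cong:
  assumes "\<And>u. x \<le> u \<Longrightarrow> u < 1 \<Longrightarrow> f u = g u" "x < 1"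
  shows "weyl_right 1 \<alpha> f x = weyl_right 1 \<alpha> g x" "weyl_right_exists 1 \<alpha> f x \<longleftrightarrow> weyl_right_exists 1 \<alpha> g x"
proof -
  have "(LINT u:{x<..<1}|lebesgue. (f x - f u) / (u - x) powr (2 - \<alpha>))
      = (LINT u:{x<..<1}|lebesgue. (g x - g u) / (u - x) powr (2 - \<alpha>))"
    by (rule set_lebesgue_integral_cong) (use assms in auto)
  then show "weyl_right 1 \<alpha> f x = weyl_right 1 \<alpha> g x"
    using assms by (simp add: weyl_right_def)
  show "weyl_right_exists 1 \<alpha> f x \<longleftrightarrow> weyl_right_exists 1 \<alpha> g x"
    unfolding weyl_right_exists_def by (rule set_integrable_cong) (use assms in auto)
qed

text \<open>Allows working with a Borel function on the whole line that agrees with the path on the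
  time interval.\<close>

lemma has_ext_frac_integral_cong:
  assumes "has_ext_frac_integral H \<alpha> \<mu> f g v" and eq: "\<And>t. 0 \<le> t \<Longrightarrow> t \<le> 1 \<Longrightarrow> g t = g' t"
  shows "has_ext_frac_integral H \<alpha> \<mu> f g' v"
proof -
  have E: "weyl_right_exists 1 \<alpha> (\<lambda>y. g y - g 1) x \<longleftrightarrow> weyl_right_exists 1 \<alpha> (\<lambda>y. g' y - g' 1) x" if "0 < x" "x < 1" for x
    by (rule weyl_right_cong(2)) (use that eq in auto)
  have I: "ext_frac_integrand \<alpha> f g x = ext_frac_integrand \<alpha> f g' x" if "x \<in> {0..1}" for x
  proof (cases "x = 1")
    case False
    have "weyl_right 1 \<alpha> (\<lambda>y. g y - g 1) x = weyl_right 1 \<alpha> (\<lambda>y. g' y - g' 1) x"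
      by (rule weyl_right_cong(1)) (use that False eq in auto)
    then show ?thesis by (simp add: ext_frac_integrand_def)
  qed (simp add: ext_frac_integrand_at_1)
  have "set_integrable lebesgue {0..1} (ext_frac_integrand \<alpha> f g) = set_integrable lebesgue {0..1} (ext_frac_integrand \<alpha> f g')"
    by (rule set_integrable_cong) (use I in auto)
  moreover have "ext_frac_integral \<alpha> f g = ext_frac_integral \<alpha> f g'"
    unfolding ext_frac_integral_def using I by (subst set_lebesgue_integral_cong[of "{0..1}" lebesgue "ext_frac_integrand \<alpha> f g" "ext_frac_integrand \<alpha> f g'"]) auto
  ultimately show ?thesis
    using assms(1) unfolding has_ext_frac_integral_def by (auto simp: E)
qed

text \<open>The kernel of the potential at 0 is positive on all of (0, 1), so finiteness there makes
  \<open>right_abs\<close> finite at almost every inner point.\<close>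

lemma potential_0_finite_imp_exists:
  assumes [measurable]: "g \<in> borel_measurable borel" and fin: "potential \<alpha> (right_abs \<alpha> g) 0 < \<infinity>"
  shows "AE x in lebesgue. x \<in> {0<..<1} \<longrightarrow> weyl_right_exists 1 \<alpha> (\<lambda>y. g y - g 1) x"
proof -
  have "AE x in lborel. ennreal (indicator {0<..<1} x * (x - 0) powr (-\<alpha>)) * right_abs \<alpha> g x \<noteq> \<infinity>"
    by (rule nn_integral_PInf_AE[OF _ less_imp_neq[OF fin[unfolded potential_def]]]) measurable
  then have "AE x in lborel. x \<in> {0<..<1} \<longrightarrow> weyl_right_exists 1 \<alpha> (\<lambda>y. g y - g 1) x"
  proof eventually_elim
    case (elim x)
    show ?case
    proof
      assume "x \<in> {0<..<1}"
      with elim have "right_abs \<alpha> g x < \<infinity>" by (auto simp: ennreal_mult_eq_top_iff less_top)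
      then show "weyl_right_exists 1 \<alpha> (\<lambda>y. g y - g 1) x"
        by (intro right_abs_finite_imp_exists) auto
    qed
  qed
  then show ?thesis by (rule AE_completion)
qed

text \<open>The path on which \<open>strat\<close> acts in block \<open>n\<close>: it starts at 0
  and has standard deviation \<open>(Suc n) ^ 2\<close> at the last node when \<open>B\<close> is
  the fractional Brownian motion.\<close>

definition bet :: "real \<Rightarrow> nat \<Rightarrow> (real \<Rightarrow> 'b \<Rightarrow> real) \<Rightarrow> nat \<Rightarrow> 'b \<Rightarrow> nat \<Rightarrow> real" where
  "bet H p B n \<omega> i = leverage H n * (B (node p n i) \<omega> - B (node p n 0) \<omega>)"

section \<open>Almost sure properties of the paths\<close>

context prob_space begin

text \<open>There are only countably many nodes, so finite expectations give finiteness at all of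
  them simultaneously; the bound for large \<open>n\<close> comes from
  \<open>AE_eventually_le_1\<close>.\<close>

lemma fbm_path_regularity:
  fixes B :: "real \<Rightarrow> 'a \<Rightarrow> real"
  assumes fbm: "fractional_brownian_motion M H B" and cont: "continuous_process M B"
    and \<alpha>: "0 < \<alpha>" "\<alpha> < 1" and H: "0 < H" "0 < H + \<alpha> - 1"
  defines "C \<equiv> 2 * ((1 + 1 / (H + \<alpha> - 1)) / (1 - \<alpha>))"
  shows "AE \<omega> in M. \<exists>g. g \<in> borel_measurable borel \<and> (\<forall>t\<in>{0..1}. g t = B t \<omega>) \<and>
    (\<forall>n. \<forall>i\<le>mesh p n. potential \<alpha> (right_abs \<alpha> g) (node p n i) < \<infinity> \<and> quotient_mass g (node p n i) < \<infinity>) \<and>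
    potential \<alpha> (right_abs \<alpha> g) 0 < \<infinity> \<and>
    (\<forall>\<^sub>F n in sequentially. (\<Sum>i\<le>mesh p n. potential \<alpha> (right_abs \<alpha> g) (node p n i))
        \<le> ennreal (C * (real (Suc n) ^ (p + 2) * gap n powr H)))"
proof -
  from cont obtain N where N: "N \<in> null_sets M" and "{\<omega>\<in>space M. \<not> continuous_on {0..} (\<lambda>t. B t \<omega>)} \<subseteq> N"
    unfolding continuous_process_def eventually_ae_filter by blast
  then have contN: "continuous_on {0..} (\<lambda>t. B t \<omega>)" if "\<omega> \<in> space M" "\<omega> \<notin> N" for \<omega>
    using that by blast
  \<comment> \<open>Clamping time to the unit interval and erasing the exceptional null set makes
    every path continuous on the whole line, hence the process jointly measurable.\<close>
  define X where "X = (\<lambda>t \<omega>. indicator (space M - N) \<omega> * B (max 0 (min 1 t)) \<omega>)"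
  have good: "AE \<omega> in M. \<omega> \<in> space M - N" using N by (auto intro: AE_not_in simp: AE_conj_iff)
  have [measurable]: "N \<in> sets M" using N by auto
  have gp: "gaussian_process M B" using fbm by (simp add: fractional_brownian_motion_def)
  have Xt: "X t \<in> borel_measurable M" for t
  proof -
    have [measurable]: "B (max 0 (min 1 t)) \<in> borel_measurable M"
      by (rule gaussian_process_measurable[OF gp]) simp
    show ?thesis unfolding X_def by measurable
  qed
  have Xc: "continuous_on UNIV (\<lambda>t. X t \<omega>)" for \<omega>
  proof (cases "\<omega> \<in> space M - N")
    case True
    have "continuous_on UNIV (\<lambda>t. B (max 0 (min 1 t)) \<omega>)"
      using contN True by (intro continuous_on_compose2[of "{0..}" "\<lambda>t. B t \<omega>" UNIV "\<lambda>t. max 0 (min 1 t)"] continuous_intros) auto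
    then show ?thesis using True by (simp add: X_def)
  qed (simp add: X_def)
  have Xm: "case_prod X \<in> borel_measurable (borel \<Otimes>\<^sub>M M)"
    using Xt Xc by (rule jointly_measurable_if_continuous)
  have inc: "(\<integral>\<^sup>+\<omega>. ennreal \<bar>X x \<omega> - X u \<omega>\<bar> \<partial>M) \<le> ennreal (\<bar>x - u\<bar> powr H)"
    if "0 < x" "x \<le> 1" "0 < u" "u \<le> 1" for x u
  proof -
    have "(\<integral>\<^sup>+\<omega>. ennreal \<bar>X x \<omega> - X u \<omega>\<bar> \<partial>M) = (\<integral>\<^sup>+\<omega>. ennreal \<bar>B x \<omega> - B u \<omega>\<bar> \<partial>M)"
    proof (rule nn_integral_cong_AE)
      show "AE \<omega> in M. ennreal \<bar>X x \<omega> - X u \<omega>\<bar> = ennreal \<bar>B x \<omega> - B u \<omega>\<bar>"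
        using good by eventually_elim (use that in \<open>simp add: X_def\<close>)
    qed
    then show ?thesis using fbm_increment_nn_abs[OF fbm, of u x] that by simp
  qed
  define Y where "Y = (\<lambda>q \<omega>. potential \<alpha> (right_abs \<alpha> (\<lambda>t. X t \<omega>)) q)"
  define Q where "Q = (\<lambda>q \<omega>. quotient_mass (\<lambda>t. X t \<omega>) q)"
  have Ym[measurable]: "Y q \<in> borel_measurable M" for q
    unfolding Y_def by (rule potential_measurable[OF Xm inc \<alpha> H])
  have Qm[measurable]: "Q q \<in> borel_measurable M" for q
    unfolding Q_def by (rule quotient_mass_measurable[OF Xm inc \<alpha> H])
  have Yle: "(\<integral>\<^sup>+\<omega>. Y q \<omega> \<partial>M) \<le> ennreal (C / 2 * (1 - q) powr H)" if "0 \<le> q" "q < 1" for q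
  proof -
    have "C / 2 = (1 + 1 / (H + \<alpha> - 1)) / (1 - \<alpha>)"
      unfolding C_def by (rule nonzero_mult_div_cancel_left) simp
    then show ?thesis
      using nn_integral_potential_le[OF Xm inc \<alpha> H that] by (simp only: Y_def)
  qed
  have C: "0 < C" using \<alpha> H by (simp add: C_def add_pos_pos)
  have Yfin: "AE \<omega> in M. Y q \<omega> < \<infinity>" if "0 \<le> q" "q < 1" for q
  proof -
    have "AE \<omega> in M. Y q \<omega> \<noteq> \<infinity>"
      by (rule nn_integral_PInf_AE[OF Ym less_imp_neq]) (use Yle[OF that] in \<open>simp add: le_less_trans\<close>)
    then show ?thesis by (simp add: less_top)
  qed
  have Qfin: "AE \<omega> in M. Q q \<omega> < \<infinity>" if "0 < q" "q < 1" for q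
  proof -
    have "AE \<omega> in M. Q q \<omega> \<noteq> \<infinity>"
      by (rule nn_integral_PInf_AE[OF Qm less_imp_neq])
         (use nn_integral_quotient_mass_le[OF Xm inc \<alpha> H that] in \<open>simp add: Q_def le_less_trans\<close>)
    then show ?thesis by (simp add: less_top)
  qed
  have fin: "AE \<omega> in M. \<forall>n i. i \<le> mesh p n \<longrightarrow> Y (node p n i) \<omega> < \<infinity> \<and> Q (node p n i) \<omega> < \<infinity>"
    unfolding AE_all_countable
  proof (intro allI)
    fix n i
    show "AE \<omega> in M. i \<le> mesh p n \<longrightarrow> Y (node p n i) \<omega> < \<infinity> \<and> Q (node p n i) \<omega> < \<infinity>"
    proof (cases "i \<le> mesh p n")
      case True
      note b = node_bounds[OF True]
      show ?thesis using Yfin[of "node p n i"] Qfin[of "node p n i"] b by auto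
    qed simp
  qed
  \<comment> \<open>The exponent \<open>p\<close> counts the nodes and the extra 2 makes the
    normalized expectations summable. The factor 2 in \<open>C\<close> covers the one additional
    node, as \<open>mesh p n + 1\<close> is at most twice \<open>mesh p n\<close>.\<close>
  define d where "d = (\<lambda>n. C * (real (Suc n) ^ (p + 2) * gap n powr H))"
  have d: "0 < d n" for n using C gap_pos[of n] by (simp add: d_def)
  have "AE \<omega> in M. \<forall>\<^sub>F n in sequentially. ennreal (1 / d n) * (\<Sum>i\<le>mesh p n. Y (node p n i) \<omega>) \<le> 1"
  proof (rule AE_eventually_le_1)
    show "(\<lambda>\<omega>. ennreal (1 / d n) * (\<Sum>i\<le>mesh p n. Y (node p n i) \<omega>)) \<in> borel_measurable M" for n
      by measurable
    show "(\<integral>\<^sup>+\<omega>. ennreal (1 / d n) * (\<Sum>i\<le>mesh p n. Y (node p n i) \<omega>) \<partial>M) \<le> ennreal (inverse (real (Suc n) ^ 2))" for n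
    proof -
      have "(\<integral>\<^sup>+\<omega>. ennreal (1 / d n) * (\<Sum>i\<le>mesh p n. Y (node p n i) \<omega>) \<partial>M)
          = ennreal (1 / d n) * (\<Sum>i\<le>mesh p n. \<integral>\<^sup>+\<omega>. Y (node p n i) \<omega> \<partial>M)"
        by (simp add: nn_integral_cmult nn_integral_sum)
      also have "\<dots> \<le> ennreal (1 / d n) * (\<Sum>i\<le>mesh p n. ennreal (C / 2 * gap n powr H))"
      proof (intro mult_left_mono sum_mono)
        fix i assume "i \<in> {..mesh p n}"
        then have i: "i \<le> mesh p n" by simp
        note b = node_bounds[OF i]
        have "(\<integral>\<^sup>+\<omega>. Y (node p n i) \<omega> \<partial>M) \<le> ennreal (C / 2 * (1 - node p n i) powr H)"
          using b by (intro Yle) auto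
        also have "\<dots> \<le> ennreal (C / 2 * gap n powr H)"
          using b C H by (intro ennreal_leI mult_left_mono powr_mono2) auto
        finally show "(\<integral>\<^sup>+\<omega>. Y (node p n i) \<omega> \<partial>M) \<le> ennreal (C / 2 * gap n powr H)" .
      qed simp
      also have "\<dots> = ennreal (1 / d n * ((real (mesh p n) + 1) * (C / 2 * gap n powr H)))"
        using C d[of n] by (subst sum_ennreal) (auto simp: ennreal_mult[symmetric])
      also have "\<dots> \<le> ennreal (inverse (real (Suc n) ^ 2))"
      proof (rule ennreal_leI)
        have "1 \<le> real (Suc n) ^ p" by (intro one_le_power) auto
        then have "real (mesh p n) + 1 \<le> 2 * real (Suc n) ^ p" by (simp add: mesh_def)
        then have "(real (mesh p n) + 1) * (C / 2 * gap n powr H) \<le> (2 * real (Suc n) ^ p) * (C / 2 * gap n powr H)"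
          using C by (intro mult_right_mono) auto
        also have "\<dots> = d n * inverse (real (Suc n) ^ 2)"
          by (simp add: d_def power_add power2_eq_square field_simps del: of_nat_Suc)
        finally show "1 / d n * ((real (mesh p n) + 1) * (C / 2 * gap n powr H)) \<le> inverse (real (Suc n) ^ 2)"
          using d[of n] by (simp add: field_simps)
      qed
      finally show ?thesis .
    qed
    show "summable (\<lambda>n. inverse (real (Suc n) ^ 2))"
      using inverse_power_summable[of 2, where 'a = real] summable_Suc_iff[of "\<lambda>n. inverse (real n ^ 2)"] by simp
  qed simp
  then have bound: "AE \<omega> in M. \<forall>\<^sub>F n in sequentially. (\<Sum>i\<le>mesh p n. Y (node p n i) \<omega>) \<le> ennreal (d n)"
  proof eventually_elim
    case (elim \<omega>)
    then show ?case
    proof eventually_elim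
      case (elim n)
      have "ennreal (d n) * (ennreal (1 / d n) * (\<Sum>i\<le>mesh p n. Y (node p n i) \<omega>)) \<le> ennreal (d n) * 1"
        by (intro mult_left_mono elim) simp
      then show ?case using d[of n] by (simp flip: mult.assoc ennreal_mult)
    qed
  qed
  \<comment> \<open>Time 0 is no node; this case gives the existence of the right derivative almost
    everywhere on (0, 1).\<close>
  have "AE \<omega> in M. Y 0 \<omega> < \<infinity>" by (rule Yfin) simp_all
  with good fin bound show ?thesis
  proof eventually_elim
    case (elim \<omega>)
    show ?case
    proof (intro exI[of _ "\<lambda>t. X t \<omega>"] conjI)
      show "(\<lambda>t. X t \<omega>) \<in> borel_measurable borel"
        using Xc by (intro borel_measurable_continuous_onI)
      show "\<forall>t\<in>{0..1}. X t \<omega> = B t \<omega>" using elim by (simp add: X_def)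
    qed (use elim in \<open>auto simp: Y_def Q_def d_def\<close>)
  qed
qed

text \<open>With \<open>m\<close> steps the mean is \<open>(Suc n) ^ 4 * m powr (1 - 2 * H)\<close>.
  The bound 6 on the exponent gained from the mesh outweighs the power 4 from the leverage and
  leaves the power 2 for summability.\<close>

lemma bet_quad_var_eventually_small:
  assumes fbm: "fractional_brownian_motion M H B" and p: "6 \<le> real p * (2 * H - 1)"
  shows "AE \<omega> in M. \<forall>\<^sub>F n in sequentially. quad_var (bet H p B n \<omega>) (mesh p n) \<le> 1 / 128"
proof -
  have incr: "(bet H p B n \<omega> (Suc j) - bet H p B n \<omega> j)\<^sup>2
      = (leverage H n)\<^sup>2 * (B (node p n (Suc j)) \<omega> - B (node p n j) \<omega>)\<^sup>2" for n j \<omega>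
    by (simp add: bet_def power_mult_distrib flip: right_diff_distrib)
  have nodes: "0 < node p n j" "0 < node p n (Suc j)" if "j < mesh p n" for n j
    using node_bounds(3)[of j p n] node_bounds(3)[of "Suc j" p n] that by auto
  have [measurable]: "(\<lambda>\<omega>. quad_var (bet H p B n \<omega>) (mesh p n)) \<in> borel_measurable M" for n
    unfolding quad_var_def incr
    by (intro borel_measurable_sum borel_measurable_times borel_measurable_const
        borel_measurable_power fbm_increment(1)[OF fbm] nodes) auto
  have int: "integrable M (\<lambda>\<omega>. quad_var (bet H p B n \<omega>) (mesh p n))"
    and val: "(\<integral>\<omega>. quad_var (bet H p B n \<omega>) (mesh p n) \<partial>M) \<le> inverse (real (Suc n) ^ 2)" for n
  proof -
    have i: "integrable M (\<lambda>\<omega>. (leverage H n)\<^sup>2 * (B (node p n (Suc j)) \<omega> - B (node p n j) \<omega>)\<^sup>2)" if "j < mesh p n" for j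
      using fbm_increment(2)[OF fbm nodes[OF that]] by simp
    then show "integrable M (\<lambda>\<omega>. quad_var (bet H p B n \<omega>) (mesh p n))"
      unfolding quad_var_def incr by (intro Bochner_Integration.integrable_sum) auto
    define m where "m = real (mesh p n)"
    have m: "0 < m" using mesh_pos[of p n] by (simp add: m_def)
    define e where "e = gap n / 2"
    have e: "0 < e" using gap_pos[of n] by (simp add: e_def)
    have "(\<integral>\<omega>. quad_var (bet H p B n \<omega>) (mesh p n) \<partial>M)
        = (\<Sum>j<mesh p n. (leverage H n)\<^sup>2 * (\<integral>\<omega>. (B (node p n (Suc j)) \<omega> - B (node p n j) \<omega>)\<^sup>2 \<partial>M))"
      unfolding quad_var_def incr using i by (subst Bochner_Integration.integral_sum) auto
    also have "\<dots> = (\<Sum>j<mesh p n. (leverage H n)\<^sup>2 * (e / m) powr (2 * H))"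
      using fbm_increment(3)[OF fbm nodes] m e by (intro sum.cong refl) (simp add: node_Suc_diff e_def m_def)
    also have "\<dots> = (leverage H n)\<^sup>2 * e powr (2 * H) * (m / m powr (2 * H))"
      using m e by (simp add: powr_divide m_def)
    also have "(leverage H n)\<^sup>2 * e powr (2 * H) = real (Suc n) ^ 4"
    proof -
      have "e powr (2 * H) = (e powr H)\<^sup>2" by (simp add: power2_eq_square flip: powr_add)
      then show ?thesis using e by (simp add: leverage_def e_def[symmetric] power_divide)
    qed
    also have "m / m powr (2 * H) = real (Suc n) powr (real p * (1 - 2 * H))"
    proof -
      have mp: "m = real (Suc n) powr (real p)" by (simp add: m_def mesh_def powr_realpow del: of_nat_Suc)
      have "m / m powr (2 * H) = m powr (1 - 2 * H)" using m by (simp add: powr_diff)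
      then show ?thesis by (simp only: mp powr_powr)
    qed
    also have "real (Suc n) ^ 4 * real (Suc n) powr (real p * (1 - 2 * H)) \<le> real (Suc n) ^ 4 * real (Suc n) powr (-6)"
      using p by (intro mult_left_mono powr_mono) (auto simp: algebra_simps)
    also have "real (Suc n) powr (-6) = inverse (real (Suc n) ^ 6)"
      by (simp add: powr_minus del: of_nat_Suc)
    also have "real (Suc n) ^ 4 * inverse (real (Suc n) ^ 6) = inverse (real (Suc n) ^ 2)"
      by (simp add: field_simps del: of_nat_Suc flip: power_add)
    finally show "(\<integral>\<omega>. quad_var (bet H p B n \<omega>) (mesh p n) \<partial>M) \<le> inverse (real (Suc n) ^ 2)" .
  qed
  have nn: "0 \<le> quad_var x i" for x i unfolding quad_var_def by (intro sum_nonneg) auto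
  have "AE \<omega> in M. \<forall>\<^sub>F n in sequentially. ennreal (128 * quad_var (bet H p B n \<omega>) (mesh p n)) \<le> 1"
  proof (rule AE_eventually_le_1)
    show "(\<integral>\<^sup>+\<omega>. ennreal (128 * quad_var (bet H p B n \<omega>) (mesh p n)) \<partial>M) \<le> ennreal (128 * inverse (real (Suc n) ^ 2))" for n
      using int[of n] val[of n] nn by (subst nn_integral_eq_integral) (auto intro!: ennreal_leI)
    show "summable (\<lambda>n. 128 * inverse (real (Suc n) ^ 2))"
      using inverse_power_summable[of 2, where 'a = real] summable_Suc_iff[of "\<lambda>n. inverse (real n ^ 2)"]
      by (intro summable_mult) simp
  qed simp_all
  then show ?thesis
  proof eventually_elim
    case (elim \<omega>)
    then show ?case by eventually_elim simp
  qed
qed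

text \<open>Failure forces an increment of at most \<open>2 / leverage H n\<close>, whose
  probability is at most \<open>2 / (Suc n) ^ 2\<close> by the small ball estimate.\<close>

lemma bet_eventually_large:
  assumes fbm: "fractional_brownian_motion M H B"
  shows "AE \<omega> in M. \<forall>\<^sub>F n in sequentially. 2 \<le> (bet H p B n \<omega> (mesh p n))\<^sup>2"
proof -
  define A where "A = (\<lambda>n. {\<omega>\<in>space M. \<bar>B (node p n (mesh p n)) \<omega> - B (node p n 0) \<omega>\<bar> \<le> 2 / leverage H n})"
  have nodes: "0 < node p n 0" "0 < node p n (mesh p n)" for n
    using node_bounds(3)[of 0 p n] node_bounds(3)[of "mesh p n" p n] by auto
  have diff: "node p n (mesh p n) - node p n 0 = gap n / 2" for n
    by (simp add: node_mesh node_0)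
  have "AE \<omega> in M. \<forall>\<^sub>F n in sequentially. \<omega> \<in> space M - A n"
  proof (rule borel_cantelli_AE1)
    show "A n \<in> sets M" for n
      unfolding A_def using fbm_increment(1)[OF fbm nodes[of n]] by measurable
    have "measure M (A n) \<le> 2 * inverse (real (Suc n) ^ 2)" for n
    proof -
      have "measure M (A n) \<le> (2 / leverage H n) / \<bar>node p n (mesh p n) - node p n 0\<bar> powr H"
        unfolding A_def using nodes[of n] diff[of n] gap_pos[of n] leverage_pos[of H n]
        by (intro fbm_small_ball[OF fbm]) auto
      also have "\<dots> = 2 * inverse (real (Suc n) ^ 2)"
      proof -
        have gen: "2 / (x / y) / y = 2 * inverse x" if "0 < y" for x y :: real
          using that by (simp add: divide_inverse)
        have "\<bar>gap n / 2\<bar> = gap n / 2" "0 < (gap n / 2) powr H" using gap_pos[of n] by simp_all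
        then show ?thesis unfolding diff leverage_def by (simp only: gen)
      qed
      finally show ?thesis .
    qed
    note le = this
    have sm: "summable (\<lambda>n. 2 * inverse (real (Suc n) ^ 2))"
      using inverse_power_summable[of 2, where 'a = real] summable_Suc_iff[of "\<lambda>n. inverse (real n ^ 2)"]
      by (intro summable_mult) simp
    show "summable (\<lambda>n. measure M (A n))"
      by (rule summable_comparison_test'[OF sm, of 0]) (use le in \<open>simp del: of_nat_Suc\<close>)
  qed (simp add: less_top[symmetric])
  then show ?thesis
  proof eventually_elim
    case (elim \<omega>)
    then show ?case
    proof eventually_elim
      case (elim n)
      then have "2 / leverage H n < \<bar>B (node p n (mesh p n)) \<omega> - B (node p n 0) \<omega>\<bar>"
        by (auto simp: A_def)
      then have "2 < \<bar>bet H p B n \<omega> (mesh p n)\<bar>"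
        using leverage_pos[of H n] by (simp add: bet_def abs_mult pos_divide_less_eq mult.commute)
      then have "2\<^sup>2 \<le> \<bar>bet H p B n \<omega> (mesh p n)\<bar>\<^sup>2" by (intro power_mono) auto
      then show ?case by simp
    qed
  qed
qed

end

section \<open>Adaptedness and replication\<close>

lemma basis_measurable_mono:
  assumes "standard_stochastic_basis M F" "0 \<le> s" "s \<le> t" "t \<le> 1" "f \<in> borel_measurable (F s)"
  shows "f \<in> borel_measurable (F t)"
proof (rule measurable_from_subalg[OF _ assms(5)])
  show "subalgebra (F t) (F s)"
    using assms by (auto simp: standard_stochastic_basis_def subalgebra_def)
qed

lemma quad_var_measurable:
  assumes "\<And>j. j \<le> i \<Longrightarrow> (\<lambda>\<omega>. x \<omega> j) \<in> borel_measurable N"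
  shows "(\<lambda>\<omega>. quad_var (x \<omega>) i) \<in> borel_measurable N"
  unfolding quad_var_def using assms
  by (intro borel_measurable_sum borel_measurable_power borel_measurable_diff) auto

text \<open>The decision to stop is taken at grid points only and involves no index beyond
  \<open>i\<close>.\<close>

lemma strat_measurable:
  assumes "\<And>j. j \<le> i \<Longrightarrow> (\<lambda>\<omega>. x \<omega> j) \<in> borel_measurable N"
  shows "(\<lambda>\<omega>. strat (x \<omega>) i) \<in> borel_measurable N"
proof -
  have "Measurable.pred N (\<lambda>\<omega>. \<forall>j\<in>{..i}. (x \<omega> j)\<^sup>2 - quad_var (x \<omega>) j < 1)"
  proof (rule pred_intros_finite)
    fix j assume "j \<in> {..i}"
    then have [measurable]: "(\<lambda>\<omega>. x \<omega> j) \<in> borel_measurable N" "(\<lambda>\<omega>. quad_var (x \<omega>) j) \<in> borel_measurable N"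
      using assms by (auto intro!: quad_var_measurable)
    show "Measurable.pred N (\<lambda>\<omega>. (x \<omega> j)\<^sup>2 - quad_var (x \<omega>) j < 1)" by measurable
  qed simp
  then show ?thesis
    unfolding strat_def using assms[of i] by (intro measurable_If borel_measurable_times) auto
qed

lemma gain_measurable:
  assumes "\<And>j. j \<le> m \<Longrightarrow> (\<lambda>\<omega>. x \<omega> j) \<in> borel_measurable N"
  shows "(\<lambda>\<omega>. gain (x \<omega>) m) \<in> borel_measurable N"
  unfolding gain_def using assms
  by (intro borel_measurable_sum borel_measurable_times borel_measurable_diff strat_measurable) auto

definition shortfall :: "real \<Rightarrow> nat \<Rightarrow> (real \<Rightarrow> 'w \<Rightarrow> real) \<Rightarrow> (real \<Rightarrow> 'w \<Rightarrow> real) \<Rightarrow> nat \<Rightarrow> 'w \<Rightarrow> real" where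
  "shortfall H p B Z n \<omega> = Z (node p n 0) \<omega> -
     wealth (\<lambda>n. Z (node p n 0) \<omega>) (\<lambda>n. gain (bet H p B n \<omega>) (mesh p n)) n"

text \<open>The difference of indicators is the indicator of a left-open interval: a position fixed
  with the information at \<open>node p n i\<close> is held strictly after that time.\<close>

definition hedge :: "real \<Rightarrow> nat \<Rightarrow> (real \<Rightarrow> 'w \<Rightarrow> real) \<Rightarrow> (real \<Rightarrow> 'w \<Rightarrow> real) \<Rightarrow> real \<Rightarrow> 'w \<Rightarrow> real" where
  "hedge H p B Z t \<omega> = (\<Sum>n. \<Sum>i<mesh p n. shortfall H p B Z n \<omega> * leverage H n * strat (bet H p B n \<omega>) i *
      (indicator {node p n i<..} t - indicator {node p n (Suc i)<..} t))"

text \<open>A term of the series is alive at \<open>t\<close> only if its node lies before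
  \<open>t\<close>, and its coefficient is measurable at that node.\<close>

lemma adapted_hedge:
  assumes basis: "standard_stochastic_basis M F" and B: "adapted F B" and Z: "adapted F Z"
  shows "adapted F (hedge H p B Z)"
proof -
  note mono = basis_measurable_mono[OF basis]
  have bet: "(\<lambda>\<omega>. bet H p B n \<omega> j) \<in> borel_measurable (F t)"
    if "j \<le> mesh p n" "node p n j \<le> t" "t \<le> 1" for n j t
  proof -
    have "node p n 0 \<le> node p n j" by (rule node_mono) simp
    moreover have "B (node p n i) \<in> borel_measurable (F t)" if "i \<le> mesh p n" "node p n i \<le> t" for i
      using B node_bounds[OF that(1)] by (intro mono[OF _ that(2) \<open>t \<le> 1\<close>]) (auto simp: adapted_def)
    ultimately have "B (node p n j) \<in> borel_measurable (F t)" "B (node p n 0) \<in> borel_measurable (F t)"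
      using that by auto
    then show ?thesis unfolding bet_def by measurable
  qed
  have wealth: "(\<lambda>\<omega>. wealth (\<lambda>n. Z (node p n 0) \<omega>) (\<lambda>n. gain (bet H p B n \<omega>) (mesh p n)) n)
      \<in> borel_measurable (F (node p n 0))" for n
  \<comment> \<open>The wealth at the start of block \<open>n + 1\<close> uses all of block
    \<open>n\<close>, which has ended by then.\<close>
  proof (induction n)
    case 0
    show ?case by simp
  next
    case (Suc n)
    have le: "0 \<le> node p n 0" "node p n 0 \<le> node p (Suc n) 0" "node p (Suc n) 0 \<le> 1"
      using node_bounds[of 0 p n] node_bounds[of 0 p "Suc n"] node_le_next[of 0 p n] by auto
    have [measurable]: "Z (node p n 0) \<in> borel_measurable (F (node p (Suc n) 0))"
      using Z le by (intro mono[OF le]) (auto simp: adapted_def)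
    have [measurable]: "(\<lambda>\<omega>. gain (bet H p B n \<omega>) (mesh p n)) \<in> borel_measurable (F (node p (Suc n) 0))"
      using node_le_next le by (intro gain_measurable bet) auto
    note [measurable] = mono[OF le Suc.IH]
    show ?case by simp
  qed
  show ?thesis
    unfolding adapted_def
  proof
    fix t :: real assume "t \<in> {0..1}"
    then have t: "0 \<le> t" "t \<le> 1" by auto
    show "hedge H p B Z t \<in> borel_measurable (F t)"
      unfolding hedge_def[abs_def]
    proof (intro borel_measurable_suminf borel_measurable_sum)
      fix n i assume "i \<in> {..<mesh p n}"
      then have i: "i \<le> mesh p n" by simp
      show "(\<lambda>\<omega>. shortfall H p B Z n \<omega> * leverage H n * strat (bet H p B n \<omega>) i *
          (indicator {node p n i<..} t - indicator {node p n (Suc i)<..} t)) \<in> borel_measurable (F t)"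
      proof (cases "node p n i < t")
        case True
        have n0: "node p n 0 \<le> node p n i" by (rule node_mono) simp
        have le: "0 \<le> node p n 0" "node p n 0 \<le> t" using node_bounds[of 0 p n] n0 True by auto
        have [measurable]: "Z (node p n 0) \<in> borel_measurable (F t)"
          using Z le t by (intro mono[OF le t(2)]) (auto simp: adapted_def)
        note [measurable] = mono[OF le t(2) wealth]
        have [measurable]: "(\<lambda>\<omega>. strat (bet H p B n \<omega>) i) \<in> borel_measurable (F t)"
        proof (intro strat_measurable bet)
          fix j assume "j \<le> i"
          then show "j \<le> mesh p n" "node p n j \<le> t" using i True node_mono[of j i p n] by auto
        qed (rule t)
        show ?thesis unfolding shortfall_def by measurable
      next
        \<comment> \<open>Both indicators are 0 at \<open>t\<close>, so the coefficient, possibly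
          not yet known, is multiplied by 0.\<close>
        case False
        then have "t \<le> node p n i" "t \<le> node p n (Suc i)" using node_mono[of i "Suc i" p n] by auto
        then show ?thesis by (simp add: indicator_def)
      qed
    qed
  qed
qed

text \<open>Block \<open>n\<close> pays exactly the increment of \<open>wealth\<close>, so the value
  of the series telescopes to the limit of the wealth. Targets and wealth have the same limit
  because the shortfall vanishes.\<close>

lemma hedge_replicates_path:
  fixes H \<alpha> :: real
  assumes \<alpha>: "0 < \<alpha>" "\<alpha> < 1" and H: "0 < H" "0 < H + \<alpha> - 1"
    and g: "g \<in> borel_measurable borel" and gB: "\<And>t. 0 \<le> t \<Longrightarrow> t \<le> 1 \<Longrightarrow> g t = B t \<omega>"
    and fin: "\<And>n i. i \<le> mesh p n \<Longrightarrow> potential \<alpha> (right_abs \<alpha> g) (node p n i) < \<infinity> \<and> quotient_mass g (node p n i) < \<infinity>"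
    and fin0: "potential \<alpha> (right_abs \<alpha> g) 0 < \<infinity>"
    and Y: "\<forall>\<^sub>F n in sequentially. (\<Sum>i\<le>mesh p n. potential \<alpha> (right_abs \<alpha> g) (node p n i))
        \<le> ennreal (C * (real (Suc n) ^ (p + 2) * gap n powr H))" and C: "0 \<le> C"
    and qv: "\<forall>\<^sub>F n in sequentially. quad_var (bet H p B n \<omega>) (mesh p n) \<le> 1 / 128"
    and large: "\<forall>\<^sub>F n in sequentially. 2 \<le> (bet H p B n \<omega> (mesh p n))\<^sup>2"
    and a: "1 < a" and Z: "\<And>t. 0 < t \<Longrightarrow> t < 1 \<Longrightarrow> \<bar>Z 1 \<omega> - Z t \<omega>\<bar> \<le> K * \<bar>ln (1 - t)\<bar> powr (-a)"
  shows "has_ext_frac_integral H \<alpha> (3/4) (\<lambda>t. hedge H p B Z t \<omega>) (\<lambda>t. B t \<omega>) (Z 1 \<omega>)"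
proof -
  define z where "z = (\<lambda>n. Z (node p n 0) \<omega>)"
  define G where "G = (\<lambda>n. gain (bet H p B n \<omega>) (mesh p n))"
  define R where "R = (\<lambda>n. z n - wealth z G n)"
  have R_eq: "shortfall H p B Z n \<omega> = R n" for n
    by (simp add: shortfall_def R_def z_def G_def)
  \<comment> \<open>At the start of block \<open>n\<close> the logarithm of the remaining time is
    exactly \<open>- (2 ^ n)\<close>.\<close>
  have zb: "\<bar>Z 1 \<omega> - z n\<bar> \<le> K * (2 ^ n) powr (-a)" for n
    using Z[of "node p n 0"] node_bounds[of 0 p n] by (simp add: z_def node_0 gap_def)
  \<comment> \<open>For \<open>n = 0\<close> the right-hand side of \<open>zb\<close> is
    \<open>K\<close> itself.\<close>
  have K: "0 \<le> K" using zb[of 0] by simp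
  have zb': "\<bar>Z 1 \<omega> - z n\<bar> \<le> K * (1 / 2) ^ n" for n
  proof -
    have "(2 ^ n) powr (-a) \<le> (2 ^ n :: real) powr (-1)" using a by (intro powr_mono) auto
    also have "\<dots> = (1 / 2) ^ n" by (simp add: powr_minus inverse_eq_divide power_divide)
    finally show ?thesis using zb[of n] K by (meson mult_left_mono order_trans)
  qed
  have dz: "\<bar>z (Suc n) - z n\<bar> \<le> (2 * K) * (1 / 2) ^ n" for n
  proof -
    have "K * (1 / 2) ^ Suc n \<le> K * (1 / 2) ^ n" using K by (intro mult_left_mono) auto
    then show ?thesis using zb'[of n] zb'[of "Suc n"] by linarith
  qed
  have half: "(\<lambda>n. c * (1 / 2) ^ n) \<longlonglongrightarrow> 0" for c :: real
    using tendsto_mult_left[OF LIMSEQ_realpow_zero[of "1 / 2 :: real"], of c] by simp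
  have z_lim: "z \<longlonglongrightarrow> Z 1 \<omega>"
    by (rule Lim_transform2[OF tendsto_const], rule Lim_null_comparison[OF _ half[of K]])
       (use zb' in \<open>auto simp: abs_minus_commute\<close>)
  have G1: "\<forall>\<^sub>F n in sequentially. \<bar>G n - 1\<bar> \<le> 1 / 4"
    using qv large
  proof eventually_elim
    case (elim n)
    show ?case unfolding G_def by (rule gain_near_1[OF _ elim]) (simp add: bet_def)
  qed
  obtain L where L: "\<forall>\<^sub>F n in sequentially. \<bar>R n\<bar> \<le> L * (1 / 2) ^ n" "0 \<le> L"
    using wealth_error[OF G1 dz] unfolding R_def by blast
  have "R \<longlonglongrightarrow> 0"
    by (rule Lim_null_comparison[OF _ half[of L]]) (use L in simp)
  then have "(\<lambda>n. z n - R n) \<longlonglongrightarrow> Z 1 \<omega> - 0" using z_lim by (intro tendsto_diff)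
  then have W: "wealth z G \<longlonglongrightarrow> Z 1 \<omega>" by (simp add: R_def)
  \<comment> \<open>The shortfall is constant during the block and factors out; the leverage turns
    increments of \<open>g\<close> into increments of \<open>bet\<close>, so the rest is the gain
    per unit bet.\<close>
  have inc: "(\<Sum>i<mesh p n. R n * leverage H n * strat (bet H p B n \<omega>) i * (g (node p n (Suc i)) - g (node p n i)))
      = wealth z G (Suc n) - wealth z G n" for n
  proof -
    have "(\<Sum>i<mesh p n. R n * leverage H n * strat (bet H p B n \<omega>) i * (g (node p n (Suc i)) - g (node p n i)))
        = (\<Sum>i<mesh p n. R n * (strat (bet H p B n \<omega>) i * (bet H p B n \<omega> (Suc i) - bet H p B n \<omega> i)))"
    proof (intro sum.cong refl)
      fix i assume "i \<in> {..<mesh p n}"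
      then have "i \<le> mesh p n" "Suc i \<le> mesh p n" by auto
      then have "g (node p n i) = B (node p n i) \<omega>" "g (node p n (Suc i)) = B (node p n (Suc i)) \<omega>"
        using node_bounds[of i p n] node_bounds[of "Suc i" p n] by (auto intro!: gB)
      then show "R n * leverage H n * strat (bet H p B n \<omega>) i * (g (node p n (Suc i)) - g (node p n i))
          = R n * (strat (bet H p B n \<omega>) i * (bet H p B n \<omega> (Suc i) - bet H p B n \<omega> i))"
        by (simp add: bet_def algebra_simps)
    qed
    then show ?thesis by (simp add: R_def G_def gain_def sum_distrib_left)
  qed
  have V: "(\<lambda>n. \<Sum>i<mesh p n. R n * leverage H n * strat (bet H p B n \<omega>) i * (g (node p n (Suc i)) - g (node p n i))) sums Z 1 \<omega>"
    unfolding inc using telescope_sums[OF W] by simp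
  have h: "\<forall>\<^sub>F n in sequentially. \<forall>i<mesh p n. \<bar>strat (bet H p B n \<omega>) i\<bar> \<le> 3"
    using qv by eventually_elim (auto intro!: strat_bound)
  have "\<exists>K. ext_bounded H \<alpha> (3/4) g (\<lambda>t. hedge H p B Z t \<omega>) (Z 1 \<omega>) K"
    unfolding hedge_def R_eq
    using fin by (intro step_integrand_ext_bounded[OF \<alpha> H g _ _ Y C L(2) L(1) h V]) auto
  then have "has_ext_frac_integral H \<alpha> (3/4) (\<lambda>t. hedge H p B Z t \<omega>) g (Z 1 \<omega>)"
    using ext_bounded_imp_has_ext_frac_integral potential_0_finite_imp_exists[OF g fin0] by blast
  then show ?thesis
    by (rule has_ext_frac_integral_cong) (rule gB)
qed

theorem theorem2:
  fixes H \<alpha> :: real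
  assumes "1 / 2 < H" and "H < 1"
    and "1 - H < \<alpha>" and "\<alpha> < 1 / 2"
  shows "\<exists>\<mu>>1/2. \<forall>(M :: 'w measure) F B \<xi> Z C a.
    standard_stochastic_basis M F \<and>
    fractional_brownian_motion M H B \<and> continuous_process M B \<and> adapted F B \<and>
    \<xi> \<in> borel_measurable (F 1) \<and>
    adapted F Z \<and> a > 1 \<and> C \<in> borel_measurable M \<and>
    log_approximated M Z C a \<xi> \<longrightarrow>
    (\<exists>\<psi>. adapted F \<psi> \<and>
      (AE \<omega> in M. has_ext_frac_integral H \<alpha> \<mu> (\<lambda>t. \<psi> t \<omega>) (\<lambda>t. B t \<omega>) (\<xi> \<omega>)))"
proof (intro exI[of _ "3/4"] conjI allI impI)
  fix M :: "'w measure" and F B \<xi> Z C a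
  assume asm: "standard_stochastic_basis M F \<and>
    fractional_brownian_motion M H B \<and> continuous_process M B \<and> adapted F B \<and>
    \<xi> \<in> borel_measurable (F 1) \<and>
    adapted F Z \<and> a > 1 \<and> C \<in> borel_measurable M \<and>
    log_approximated M Z C a \<xi>"
  then have basis: "standard_stochastic_basis M F" and fbm: "fractional_brownian_motion M H B"
    and cont: "continuous_process M B" and B: "adapted F B" and Z: "adapted F Z" and a: "1 < a"
    and log: "log_approximated M Z C a \<xi>" by auto
  interpret prob_space M using basis by (simp add: standard_stochastic_basis_def)
  have \<alpha>: "0 < \<alpha>" "\<alpha> < 1" and H: "0 < H" "0 < H + \<alpha> - 1" using assms by auto
  \<comment> \<open>Since \<open>2 * H - 1\<close> is positive, a polynomial mesh is fine enough;
    its degree depends on \<open>H\<close> alone.\<close>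
  obtain p where p: "6 / (2 * H - 1) \<le> real p" using real_arch_simple by blast
  then have p6: "6 \<le> real p * (2 * H - 1)" using assms by (simp add: field_simps)
  have "AE \<omega> in M. has_ext_frac_integral H \<alpha> (3/4) (\<lambda>t. hedge H p B Z t \<omega>) (\<lambda>t. B t \<omega>) (\<xi> \<omega>)"
    using fbm_path_regularity[OF fbm cont \<alpha> H, of p] bet_quad_var_eventually_small[OF fbm p6]
      bet_eventually_large[OF fbm, of p] log[unfolded log_approximated_def]
  proof eventually_elim
    case (elim \<omega>)
    from elim(1) obtain g where g: "g \<in> borel_measurable borel" "\<forall>t\<in>{0..1}. g t = B t \<omega>"
      "\<forall>n. \<forall>i\<le>mesh p n. potential \<alpha> (right_abs \<alpha> g) (node p n i) < \<infinity> \<and> quotient_mass g (node p n i) < \<infinity>"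
      "potential \<alpha> (right_abs \<alpha> g) 0 < \<infinity>"
      "\<forall>\<^sub>F n in sequentially. (\<Sum>i\<le>mesh p n. potential \<alpha> (right_abs \<alpha> g) (node p n i))
        \<le> ennreal (2 * ((1 + 1 / (H + \<alpha> - 1)) / (1 - \<alpha>)) * (real (Suc n) ^ (p + 2) * gap n powr H))"
      by blast
    have C: "0 \<le> 2 * ((1 + 1 / (H + \<alpha> - 1)) / (1 - \<alpha>))" using \<alpha> H by simp
    have "has_ext_frac_integral H \<alpha> (3/4) (\<lambda>t. hedge H p B Z t \<omega>) (\<lambda>t. B t \<omega>) (Z 1 \<omega>)"
    proof (rule hedge_replicates_path[OF \<alpha> H g(1) _ _ g(4,5) C elim(2,3) a])
      show "g t = B t \<omega>" if "0 \<le> t" "t \<le> 1" for t using g(2) that by simp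
      show "potential \<alpha> (right_abs \<alpha> g) (node p n i) < \<infinity> \<and> quotient_mass g (node p n i) < \<infinity>"
        if "i \<le> mesh p n" for n i using g(3) that by blast
      show "\<bar>Z 1 \<omega> - Z t \<omega>\<bar> \<le> C \<omega> * \<bar>ln (1 - t)\<bar> powr (-a)" if "0 < t" "t < 1" for t
        using bspec[OF conjunct2[OF elim(4)], of t] that by simp
    qed
    then show ?case using elim(4) by simp
  qed
  then show "\<exists>\<psi>. adapted F \<psi> \<and>
      (AE \<omega> in M. has_ext_frac_integral H \<alpha> (3/4) (\<lambda>t. \<psi> t \<omega>) (\<lambda>t. B t \<omega>) (\<xi> \<omega>))"
    using adapted_hedge[OF basis B Z, of H p] by blast
qed simp

end
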